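(* Let $(\alpha,\beta)\in\mathcal A$, suppose $X\in\mathcal D(\alpha,\beta)$ and suppose that the distribution of $X$ is non-lattice. Then, for every $\Delta>0$, $$c_n\,\mathbf P\big(S_n\in[x,x+\Delta)\,\big|\,\tau^->n\big)-\Delta\,p_{\alpha,\beta}(x/c_n)\to 0\quad\text{as }n\to\infty,$$ uniformly in $x\in(0,\infty)$.
   Context: $X,X_1,X_2,\dots$ are i.i.d. real random variables, $S_0=0$, $S_n=X_1+\dots+X_n$, and $\tau^-=\min\{n\ge1:S_n\le0\}$. $\mathcal A=\{0<\alpha<1,|\beta|<1\}\cup\{1<\alpha<2,|\beta|\le1\}\cup\{(1,0)\}\cup\{(2,0)\}$. Let $\mu(u)=u^{-2}\int_{[-u,u]}x^2\,\mathbf P(X\in dx)$, $u>0$, and let $(c_n)_{n\ge1}$ be a non-decreasing sequence of positive real numbers with $c_n=\sup\{u>0:\mu(u)>1/n\}$ for all sufficiently large $n$. For $(\alpha,\beta)\in\mathcal A$, $X\in\mathcal D(\alpha,\beta)$ means that $\mathbf EX=0$ if this moment exists and that $X$ lies in the domain of attraction of the stable law with characteristic function $$G_{\alpha,\beta}(t)=\exp\Big\{-c|t|^{\alpha}\Big(1-i\beta\frac{t}{|t|}\tan\frac{\pi\alpha}{2}\Big)\Big\}$$ (the $\beta\tan$ term being $0$ when $\beta=0$), with the convention that $c>0$ is the constant for which $S_n/c_n$ converges in distribution to this law (no centering needed). Lattice: the distribution of $X$ is lattice if its support is contained in $\{a+kh:k\in\mathbb Z\}$ for some $h>0$, $a\in[0,h)$;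 non-lattice otherwise. It is known that, for $X\in\mathcal D(\alpha,\beta)$, the law of $S_n/c_n$ conditioned on $\{\tau^->n\}$ converges weakly, as $n\to\infty$, to the law of a nonnegative random variable $M_{\alpha,\beta}$ with a density; $p_{\alpha,\beta}$ denotes the continuous version of this density on $(0,\infty)$. *)

theory Defs
  imports "HOL-Probability.Probability"
begin

definition admissible :: "(real \<times> real) set" where
  "admissible = {(\<alpha>, \<beta>). 0 < \<alpha> \<and> \<alpha> < 1 \<and> \<bar>\<beta>\<bar> < 1} \<union> {(\<alpha>, \<beta>). 1 < \<alpha> \<and> \<alpha> < 2 \<and> \<bar>\<beta>\<bar> \<le> 1} \<union> {(1, 0)} \<union> {(2, 0)}"

text \<open>For \<open>\<beta> = 0\<close> the skewness term vanishes because \<open>tan\<close> is total; \<open>sgn t\<close> is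
  \<open>t / \<bar>t\<bar>\<close>, and at \<open>t = 0\<close> the exponent is \<open>0\<close>.\<close>

definition stable_char :: "real \<Rightarrow> real \<Rightarrow> real \<Rightarrow> real \<Rightarrow> complex" where
  "stable_char \<kappa> \<alpha> \<beta> t =
     exp (- (of_real (\<kappa> * \<bar>t\<bar> powr \<alpha>)
             * (1 - \<i> * of_real (\<beta> * sgn t * tan (pi * \<alpha> / 2)))))"

definition stable_law :: "real \<Rightarrow> real \<Rightarrow> real \<Rightarrow> real measure \<Rightarrow> bool" where
  "stable_law \<kappa> \<alpha> \<beta> \<nu> \<longleftrightarrow> real_distribution \<nu> \<and> (\<forall>t. char \<nu> t = stable_char \<kappa> \<alpha> \<beta> t)"

definition truncated_moment :: "real measure \<Rightarrow> real \<Rightarrow> real" where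
  "truncated_moment F u = (LINT x:{-u..u}|F. x\<^sup>2) / u\<^sup>2"

definition norming_sequence :: "real measure \<Rightarrow> (nat \<Rightarrow> real) \<Rightarrow> bool" where
  "norming_sequence F c \<longleftrightarrow>
     (\<forall>n\<ge>1. 0 < c n) \<and> mono_on {1..} c \<and>
     (\<forall>\<^sub>F n in sequentially. c n = Sup {u. 0 < u \<and> truncated_moment F u > 1 / real n})"

definition distribution_support :: "real measure \<Rightarrow> real set" where
  "distribution_support F = {x. \<forall>U. open U \<and> x \<in> U \<longrightarrow> 0 < measure F U}"

definition lattice_distribution :: "real measure \<Rightarrow> bool" where
  "lattice_distribution F \<longleftrightarrow>
     (\<exists>h>0. \<exists>a\<in>{0..<h}. distribution_support F \<subseteq> {a + of_int k * h | k :: int. True})"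

text \<open>\<open>X\<^sub>1, X\<^sub>2, \<dots>\<close> are i.i.d. with law \<open>F\<close>; the index \<open>0\<close> is not used.\<close>

definition iid_with_law :: "'a measure \<Rightarrow> (nat \<Rightarrow> 'a \<Rightarrow> real) \<Rightarrow> real measure \<Rightarrow> bool" where
  "iid_with_law M X F \<longleftrightarrow>
     prob_space M \<and> prob_space.indep_vars M (\<lambda>_. borel) X {1..} \<and>
     (\<forall>i\<ge>1. distr M borel (X i) = F)"

definition walk :: "(nat \<Rightarrow> 'a \<Rightarrow> real) \<Rightarrow> nat \<Rightarrow> 'a \<Rightarrow> real" where
  "walk X n \<omega> = (\<Sum>i=1..n. X i \<omega>)"

text \<open>The value is \<open>\<infinity>\<close> if the walk stays positive forever.\<close>

definition tau_minus :: "(nat \<Rightarrow> 'a \<Rightarrow> real) \<Rightarrow> 'a \<Rightarrow> enat" where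
  "tau_minus X \<omega> = Inf (enat ` {n. 1 \<le> n \<and> walk X n \<omega> \<le> 0})"

definition domain_of_attraction ::
    "'a measure \<Rightarrow> (nat \<Rightarrow> 'a \<Rightarrow> real) \<Rightarrow> real measure \<Rightarrow> bool" where
  "domain_of_attraction M X \<nu> \<longleftrightarrow>
     (\<exists>a b :: nat \<Rightarrow> real. (\<forall>n\<ge>1. 0 < a n) \<and>
        weak_conv_m (\<lambda>n. distr M borel (\<lambda>\<omega>. (walk X n \<omega> - b n) / a n)) \<nu>)"

text \<open>The scale \<open>\<kappa>\<close> of the stable law is the one for which \<open>S\<^sub>n / c\<^sub>n\<close> converges without
  centering. This last requirement implies attraction to the same law; it is a genuine
  additional restriction only for \<open>\<alpha> = 1\<close>.\<close>

definition class_D ::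
    "'a measure \<Rightarrow> (nat \<Rightarrow> 'a \<Rightarrow> real) \<Rightarrow> real measure \<Rightarrow> (nat \<Rightarrow> real) \<Rightarrow> real \<Rightarrow> real \<Rightarrow> bool" where
  "class_D M X F c \<alpha> \<beta> \<longleftrightarrow>
     (integrable F (\<lambda>x. x) \<longrightarrow> (LINT x|F. x) = 0) \<and>
     (\<exists>\<kappa>>0. \<exists>\<nu>. stable_law \<kappa> \<alpha> \<beta> \<nu> \<and> domain_of_attraction M X \<nu> \<and>
        weak_conv_m (\<lambda>n. distr M borel (\<lambda>\<omega>. walk X n \<omega> / c n)) \<nu>)"

definition conditioned_law ::
    "'a measure \<Rightarrow> (nat \<Rightarrow> 'a \<Rightarrow> real) \<Rightarrow> (nat \<Rightarrow> real) \<Rightarrow> nat \<Rightarrow> real measure" where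
  "conditioned_law M X c n =
     distr (uniform_measure M {\<omega>\<in>space M. tau_minus X \<omega> > enat n}) borel (\<lambda>\<omega>. walk X n \<omega> / c n)"

text \<open>\<open>p\<close> is the continuous version, on \<open>(0, \<infinity>)\<close>, of the density of the weak limit of the
  conditioned laws. This determines \<open>p\<close> uniquely on \<open>(0, \<infinity>)\<close>; its values elsewhere are
  irrelevant.\<close>

definition limit_density ::
    "'a measure \<Rightarrow> (nat \<Rightarrow> 'a \<Rightarrow> real) \<Rightarrow> (nat \<Rightarrow> real) \<Rightarrow> (real \<Rightarrow> real) \<Rightarrow> bool" where
  "limit_density M X c p \<longleftrightarrow>
     continuous_on {0<..} p \<and> (\<forall>x>0. 0 \<le> p x) \<and>
     (let \<mu> = density lborel (\<lambda>x. ennreal (indicator {0<..} x * p x)) in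
        prob_space \<mu> \<and> weak_conv_m (conditioned_law M X c) \<mu>)"

end

theory Submission
  imports Defs "HOL-Complex_Analysis.Complex_Analysis"
begin

text \<open>
  No limiting local density of the unconditioned walk is needed. Stability of the limit gives
  \<open>\<bar>char F (u / c n)\<bar> ^ n \<le> exp (- \<theta> * \<bar>u\<bar> powr \<gamma>)\<close> on \<open>1 \<le> \<bar>u\<bar> \<le> r * c n\<close>, and non-latticeness
  makes the remaining frequencies exponentially small. Testing against Fejer kernels, whose
  transforms have compact support, this yields for all \<open>k\<close> of order \<open>n\<close> the bound
  \<open>P (S k \<in> {x..<x + \<Delta>}) = O (1 / c n)\<close> and the equicontinuity of \<open>x \<mapsto> c n * P (S k \<in> {x..<x + \<Delta>})\<close>
  on the scale \<open>c n\<close>.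

  Cutting the path into blocks transfers both to the walk conditioned to stay positive. For \<open>x\<close> of
  order \<open>c n\<close> the positivity constraint on a short final stretch may be dropped, which gives
  equicontinuity; together with the weak limit this forces the local limit, because a window of width
  \<open>h * c n\<close> splits into windows of width \<open>\<Delta>\<close> of nearly equal probability. For \<open>x\<close> much smaller than
  \<open>c n\<close> the time-reversed walk would have to stay below \<open>x\<close>, which is unlikely because the stable law
  charges the positive half-line: a stable law on the negative half-line has an explicit
  Laplace transform, and its boundary values force \<open>\<alpha> < 1\<close> and \<open>\<beta> = -1\<close>.
\<close>

section \<open>Fejer kernels\<close>

text \<open>Every error has to be small compared with \<open>surv n / c n\<close>, and
  \<open>surv n\<close> may itself tend to 0, so absolute bounds on the free walk are too weak. Each
  estimate therefore spends independent blocks of steps: an initial block pays the factor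
  \<open>surv\<close>, a block of order \<open>n\<close> on which nothing is imposed pays
  \<open>1 / c n\<close>, and in the error terms a further block supplies the small factor. This
  presupposes that \<open>surv\<close> takes comparable values at comparable times, which is
  extracted from the weak limit: the conditioned walk typically sits at a height of order
  \<open>c n\<close>, from where it survives a further fraction of \<open>n\<close> with fixed
  probability. A second obstacle is the order of choices. The band of the Fejer kernels is widened
  after the constant of the bound is known, so this constant must not depend on the band; only the
  threshold for \<open>n\<close> may. The growth of \<open>c\<close> comes from
  \<open>c (2 * n) / c n\<close> tending to \<open>2 powr (1 / \<alpha>)\<close>, which the uniform
  convergence of characteristic functions forces.\<close>

definition fejer_kernel :: "real \<Rightarrow> real \<Rightarrow> real" where
  "fejer_kernel a y = (if y = 0 then a else 2 * (1 - cos (a * y)) / (a * y\<^sup>2))"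

lemma fejer_kernel_measurable [measurable]: "fejer_kernel a \<in> borel_measurable borel"
  unfolding fejer_kernel_def by measurable

lemma fejer_kernel_nonneg: "0 < a \<Longrightarrow> 0 \<le> fejer_kernel a y"
  by (auto simp: fejer_kernel_def)

lemma fejer_kernel_scale: "0 < a \<Longrightarrow> fejer_kernel a y = a * fejer_kernel 1 (a * y)"
  by (auto simp: fejer_kernel_def field_simps power2_eq_square)

lemma one_minus_cos_le: "1 - cos (x::real) \<le> x\<^sup>2 / 2"
proof -
  have "1 - cos x = 2 * (sin (x / 2))\<^sup>2"
    using cos_double_sin[of "x/2"] by simp
  also have "\<dots> \<le> 2 * (x / 2)\<^sup>2"
    using abs_sin_x_le_abs_x[of "x / 2"]
    by (intro mult_left_mono) (simp_all add: abs_le_square_iff[symmetric] del: power_divide)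
  finally show ?thesis by (simp add: power2_eq_square)
qed

lemma one_minus_cos_ge: "\<bar>x::real\<bar> \<le> 1 \<Longrightarrow> x\<^sup>2 / 4 \<le> 1 - cos x"
proof -
  assume x: "\<bar>x\<bar> \<le> 1"
  have *: "y\<^sup>2 / 4 \<le> 1 - cos y" if y: "0 \<le> y" "y \<le> 1" for y :: real
  proof -
    define f where "f = (\<lambda>y::real. 1 - cos y - y\<^sup>2 / 4)"
    have "f 0 \<le> f y"
    proof (rule DERIV_nonneg_imp_nondecreasing[OF y(1)])
      fix z :: real assume z: "0 \<le> z" "z \<le> y"
      have "(f has_real_derivative sin z - z / 2) (at z)"
        unfolding f_def by (auto intro!: derivative_eq_intros simp: power2_eq_square)
      moreover have "z / 2 \<le> sin z"
      proof -
        define g where "g = (\<lambda>y::real. sin y - y / 2)"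
        have "g 0 \<le> g z"
        proof (rule DERIV_nonneg_imp_nondecreasing[OF z(1)])
          fix u :: real assume u: "0 \<le> u" "u \<le> z"
          have "(g has_real_derivative cos u - 1 / 2) (at u)"
            unfolding g_def by (auto intro!: derivative_eq_intros)
          moreover have "u\<^sup>2 \<le> 1" using u z y by (simp add: power_le_one)
          then have "1 / 2 \<le> cos u" using one_minus_cos_le[of u] by simp
          ultimately show "\<exists>y. (g has_real_derivative y) (at u) \<and> 0 \<le> y" by auto
        qed
        then show ?thesis by (simp add: g_def)
      qed
      ultimately show "\<exists>y. (f has_real_derivative y) (at z) \<and> 0 \<le> y" by auto
    qed
    then show ?thesis by (simp add: f_def)
  qed
  show ?thesis using *[of "\<bar>x\<bar>"] x by (simp add: cos_abs_real)
qed

lemma fejer_kernel_ge: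
  assumes "0 < a" "\<bar>y\<bar> \<le> 1 / a"
  shows "a / 2 \<le> fejer_kernel a y"
proof (cases "y = 0")
  case False
  have "\<bar>a * y\<bar> \<le> 1" using assms by (simp add: abs_mult field_simps)
  from one_minus_cos_ge[OF this] have "a * (a * y\<^sup>2) \<le> 4 * (1 - cos (a * y))"
    by (simp add: power_mult_distrib power2_eq_square mult_ac)
  then have "a \<le> 4 * (1 - cos (a * y)) / (a * y\<^sup>2)"
    using assms False by (subst pos_le_divide_eq) auto
  then show ?thesis using False by (simp add: fejer_kernel_def)
qed (use assms in \<open>simp add: fejer_kernel_def\<close>)

lemma fejer_kernel_le:
  assumes "0 < a"
  shows "fejer_kernel a y \<le> a"
proof (cases "y = 0")
  case False
  have "2 * (1 - cos (a * y)) \<le> a * (a * y\<^sup>2)"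
    using one_minus_cos_le[of "a * y"] by (simp add: power2_eq_square mult_ac)
  then show ?thesis
    using assms False by (simp only: fejer_kernel_def) (simp add: pos_divide_le_eq mult_ac)
qed (simp add: fejer_kernel_def)

lemma fejer_kernel_le_inverse_square:
  "0 < a \<Longrightarrow> y \<noteq> 0 \<Longrightarrow> fejer_kernel a y \<le> 4 / (a * y\<^sup>2)"
  using cos_ge_minus_one[of "a * y"]
  unfolding fejer_kernel_def by (simp, intro divide_right_mono) (linarith, simp)

lemma integrable_cauchy_kernel: "integrable lborel (\<lambda>x::real. 1 / (1 + x\<^sup>2))"
  using integrable_inverse_1_plus_square
  by (simp add: set_integrable_def einterval_def inverse_eq_divide)

lemma integrable_fejer_kernel_1: "integrable lborel (fejer_kernel 1)"
proof (rule Bochner_Integration.integrable_bound)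
  show "integrable lborel (\<lambda>x::real. 5 * (1 / (1 + x\<^sup>2)))"
    by (intro integrable_mult_right integrable_cauchy_kernel)
  show "AE x in lborel. norm (fejer_kernel 1 x) \<le> norm (5 * (1 / (1 + x\<^sup>2)))"
  proof (intro AE_I2)
    fix x :: real
    have "fejer_kernel 1 x \<le> 5 * (1 / (1 + x\<^sup>2))"
    proof (cases "x\<^sup>2 \<le> 4")
      case True
      then have "1 \<le> 5 * (1 / (1 + x\<^sup>2))" by (simp add: divide_simps add_pos_nonneg)
      then show ?thesis using fejer_kernel_le[of 1 x] by simp
    next
      case False
      then have "x \<noteq> 0" by auto
      have "4 / x\<^sup>2 \<le> 5 * (1 / (1 + x\<^sup>2))" using False by (simp add: divide_simps add_pos_nonneg)
      then show ?thesis using fejer_kernel_le_inverse_square[of 1 x] \<open>x \<noteq> 0\<close> by simp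
    qed
    then show "norm (fejer_kernel 1 x) \<le> norm (5 * (1 / (1 + x\<^sup>2)))"
      using fejer_kernel_nonneg[of 1 x] by (simp add: add_nonneg_nonneg)
  qed
qed simp

text \<open>This is \<open>2 * pi\<close>; positivity is enough to normalise by it.\<close>

definition fejer_mass :: real where
  "fejer_mass = (\<integral>y. fejer_kernel 1 y \<partial>lborel)"

lemma fejer_mass_pos: "0 < fejer_mass"
proof -
  have "(\<integral>y. indicator {-1..1::real} y * (1/2) \<partial>lborel) \<le> fejer_mass"
    unfolding fejer_mass_def
  proof (rule Bochner_Integration.integral_mono)
    show "integrable lborel (fejer_kernel 1)" by (fact integrable_fejer_kernel_1)
    show "integrable lborel (\<lambda>y::real. indicator {-1..1} y * (1/2) :: real)" by simp
    fix y :: real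
    show "indicator {-1..1} y * (1/2) \<le> fejer_kernel 1 y"
      using fejer_kernel_ge[of 1 y] fejer_kernel_nonneg[of 1 y] by (auto simp: indicator_def)
  qed
  then show ?thesis by simp
qed

lemma fejer_kernel_integral:
  assumes "0 < a"
  shows "integrable lborel (\<lambda>w. fejer_kernel a (y - w))"
    and "(\<integral>w. fejer_kernel a (y - w) \<partial>lborel) = fejer_mass"
proof -
  have eq: "(\<lambda>w. fejer_kernel a (y - w)) = (\<lambda>w. a * fejer_kernel 1 (a * y + (- a) * w))"
    using assms by (subst fejer_kernel_scale) (auto simp: algebra_simps)
  show "integrable lborel (\<lambda>w. fejer_kernel a (y - w))"
    unfolding eq using assms
    by (intro integrable_mult_right lborel_integrable_real_affine integrable_fejer_kernel_1) auto
  show "(\<integral>w. fejer_kernel a (y - w) \<partial>lborel) = fejer_mass"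
    unfolding eq fejer_mass_def using assms
    by (subst (2) lborel_integral_real_affine[where c = "-a" and t = "a * y"]) auto
qed

text \<open>The kernel is \<open>a * (sin (a * y / 2) / (a * y / 2)) ^ 2\<close>, extended
  continuously to \<open>y = 0\<close>. Being the transform of a triangle on \<open>[-a, a]\<close>,
  its expectation under a law only sees the characteristic function on that band.\<close>

lemma fejer_kernel_transform:
  assumes a: "0 < a"
  shows "(\<integral>t. indicator {-a..a} t * ((1 - \<bar>t\<bar> / a) * cos (t * y)) \<partial>lborel) = fejer_kernel a y"
proof -
  \<comment> \<open>Antiderivative on the right half, found by integration by parts;
    \<open>y = 0\<close> has its own formula because the general one divides by
    \<open>y\<close>.\<close>
  define F where "F = (\<lambda>t. if y = 0 then t - t\<^sup>2 / (2 * a)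
    else (1 - t / a) * sin (t * y) / y - cos (t * y) / (a * y\<^sup>2))"
  define f where "f = (\<lambda>t::real. (1 - \<bar>t\<bar> / a) * cos (t * y))"
  define h where "h = (\<lambda>t::real. indicator {0..a} t *\<^sub>R f t)"
  have cont: "continuous_on {0..a} f" unfolding f_def using a by (intro continuous_intros) auto
  have int: "integrable lborel h"
    unfolding h_def by (rule borel_integrable_compact[OF _ cont]) simp
  have "(\<integral>t. h t \<partial>lborel) = F a - F 0"
    unfolding h_def
  proof (rule integral_FTC_atLeastAtMost[OF _ _ cont])
    fix t assume t: "0 \<le> t" "t \<le> a"
    have "(F has_real_derivative f t) (at t)"
    proof (cases "y = 0")
      case True
      then show ?thesis unfolding F_def f_def using a t
        by (auto intro!: derivative_eq_intros simp: field_simps power2_eq_square)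
    next
      case False
      have "((\<lambda>t. (1 - t / a) * sin (t * y) / y - cos (t * y) / (a * y\<^sup>2)) has_real_derivative f t) (at t)"
        unfolding f_def using a t False
        by (auto intro!: derivative_eq_intros simp: divide_simps power2_eq_square)
      then show ?thesis using False by (simp add: F_def)
    qed
    then show "(F has_vector_derivative f t) (at t within {0..a})"
      by (simp add: has_real_derivative_iff_has_vector_derivative has_vector_derivative_at_within)
  qed (use a in auto)
  also have "F a - F 0 = fejer_kernel a y / 2"
    using a by (auto simp: F_def fejer_kernel_def field_simps power2_eq_square)
  finally have h: "(\<integral>t. h t \<partial>lborel) = fejer_kernel a y / 2" .
  have int': "integrable lborel (\<lambda>t. h (- t))"
    using lborel_integrable_real_affine[OF int, of "-1" 0] by simp
  have h': "(\<integral>t. h (- t) \<partial>lborel) = (\<integral>t. h t \<partial>lborel)"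
    by (subst (2) lborel_integral_real_affine[where c = "-1" and t = 0]) auto
  have "(\<integral>t. indicator {-a..a} t * ((1 - \<bar>t\<bar> / a) * cos (t * y)) \<partial>lborel) = (\<integral>t. h t + h (- t) \<partial>lborel)"
  proof (rule integral_cong_AE)
    \<comment> \<open>At \<open>t = 0\<close> both halves contribute, so the two integrands agree
      only almost everywhere.\<close>
    show "AE t in lborel. indicator {-a..a} t * ((1 - \<bar>t\<bar> / a) * cos (t * y)) = h t + h (- t)"
      using AE_lborel_singleton[of 0]
      by eventually_elim (auto simp: h_def f_def indicator_def)
    show "(\<lambda>t. h t + h (- t)) \<in> borel_measurable lborel" using int int' by measurable
  qed simp
  also have "\<dots> = fejer_kernel a y"
    using int int' h h' by simp
  finally show ?thesis .
qed

lemma integrable_on_band: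
  assumes [measurable]: "f \<in> borel_measurable borel" and "\<And>t. \<bar>t\<bar> \<le> a \<Longrightarrow> \<bar>f t\<bar> \<le> B"
  shows "integrable lborel (\<lambda>t::real. indicator {-a..a} t * (f t :: real))"
  by (rule integrableI_bounded_set[where A = "{-a..a}" and B = B])
     (use assms(2) in \<open>auto simp: indicator_def emeasure_lborel_Icc_eq\<close>)

lemma abs_Re_iexp_mult_le: "\<bar>Re (iexp x * z)\<bar> \<le> cmod z"
  by (metis abs_Re_le_cmod mult_1 norm_exp_i_times norm_mult)

lemma norm_iexp_diff_le: "cmod (iexp x - iexp y) \<le> \<bar>x - y\<bar>"
proof -
  have "cmod (iexp x - iexp y) = cmod (iexp y * (iexp (x - y) - 1))"
    by (simp add: exp_add[symmetric] algebra_simps)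
  also have "\<dots> = cmod (iexp (x - y) - 1)" by (simp add: norm_mult)
  also have "\<dots> \<le> \<bar>x - y\<bar>" using iexp_approx1[of "x - y" 0] by simp
  finally show ?thesis .
qed

lemma band_weight_le: "0 < a \<Longrightarrow> \<bar>t\<bar> \<le> a \<Longrightarrow> \<bar>1 - \<bar>t\<bar> / a\<bar> \<le> (1::real)"
  by (auto simp: abs_le_iff)

text \<open>Shifting the kernel by \<open>\<pi>\<close> turns \<open>1 - cos\<close> into \<open>1 + cos\<close>, so the two kernels have no
  common zero.\<close>

lemma cauchy_kernel_le_fejer:
  "1 / (1 + y\<^sup>2) \<le> 10 * (fejer_kernel 1 y + fejer_kernel 1 (y - pi))"
proof -
  have pi2: "pi\<^sup>2 \<le> 16" using pi_less_4 pi_gt_zero power_mono[of pi 4 2] by simp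
  have *: "(1 - cos u) / (40 * (1 + y\<^sup>2)) \<le> fejer_kernel 1 u / 2" if u: "u\<^sup>2 \<le> 40 * (1 + y\<^sup>2)" for u
  proof (cases "u = 0")
    case False
    have "(1 - cos u) / (40 * (1 + y\<^sup>2)) \<le> (1 - cos u) / u\<^sup>2"
      using u False by (intro divide_left_mono mult_pos_pos add_pos_nonneg) auto
    also have "(1 - cos u) / u\<^sup>2 = fejer_kernel 1 u / 2"
      using False by (simp add: fejer_kernel_def diff_divide_distrib)
    finally show ?thesis .
  qed (simp add: fejer_kernel_def)
  have "(y - pi)\<^sup>2 \<le> 2 * (y\<^sup>2 + pi\<^sup>2)"
    using zero_le_power2[of "y + pi"] by (simp add: power2_eq_square algebra_simps)
  \<comment> \<open>Here \<open>2 * pi\<^sup>2 \<le> 32\<close>, for which the constant 40 leaves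
    room.\<close>
  then have "(y - pi)\<^sup>2 \<le> 40 * (1 + y\<^sup>2)" using pi2 zero_le_power2[of y] by (smt (verit))
  moreover have "y\<^sup>2 \<le> 40 * (1 + y\<^sup>2)" by simp
  moreover have "1 - cos (y - pi) = 1 + cos y" by (simp add: cos_diff)
  ultimately have "(1 - cos y) / (40 * (1 + y\<^sup>2)) + (1 + cos y) / (40 * (1 + y\<^sup>2))
    \<le> (fejer_kernel 1 y + fejer_kernel 1 (y - pi)) / 2"
    using *[of y] *[of "y - pi"] by simp
  moreover have "(1 - cos y) / (40 * (1 + y\<^sup>2)) + (1 + cos y) / (40 * (1 + y\<^sup>2)) = 2 / (40 * (1 + y\<^sup>2))"
    by (simp add: add_divide_distrib[symmetric])
  moreover have "2 / (40 * (1 + y\<^sup>2)) = 1 / (1 + y\<^sup>2) / 20"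
    by (simp add: divide_simps)
  ultimately have "1 / (1 + y\<^sup>2) / 20 \<le> (fejer_kernel 1 y + fejer_kernel 1 (y - pi)) / 2"
    by metis
  moreover have "p / 20 \<le> q / 2 \<Longrightarrow> p \<le> 10 * q" for p q :: real by simp
  ultimately show ?thesis by blast
qed

section \<open>Fejer means of a probability law and concentration on windows\<close>

context real_distribution
begin

lemma integrable_fejer_kernel_diff: "0 < a \<Longrightarrow> integrable M (\<lambda>y. fejer_kernel a (y - x))"
  by (rule integrable_const_bound[where B = a])
     (auto simp: fejer_kernel_nonneg fejer_kernel_le)

lemma expectation_cos_eq_char: "(\<integral>y. cos (t * (y - x)) \<partial>M) = Re (iexp (- (t * x)) * char M t)"
proof -
  have "(\<integral>y. cos (t * (y - x)) \<partial>M) = (\<integral>y. Re (iexp (- (t * x)) * iexp (t * y)) \<partial>M)"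
    by (intro Bochner_Integration.integral_cong) (auto simp: exp_add[symmetric] Re_exp algebra_simps)
  also have "\<dots> = Re (\<integral>y. iexp (- (t * x)) * iexp (t * y) \<partial>M)"
    by (intro integral_Re integrable_mult_right integrable_iexp) auto
  also have "(\<integral>y. iexp (- (t * x)) * iexp (t * y) \<partial>M) = iexp (- (t * x)) * char M t"
    unfolding char_def by (rule Bochner_Integration.integral_mult_right) (auto intro!: integrable_iexp)
  finally show ?thesis .
qed

text \<open>Fubini on a compact band; the characteristic function enters only through frequencies of
  modulus at most \<open>a\<close>.\<close>

lemma expectation_fejer_kernel:
  assumes a: "0 < a"
  shows "(\<integral>y. fejer_kernel a (y - x) \<partial>M) =
    (\<integral>t. indicator {-a..a} t * ((1 - \<bar>t\<bar> / a) * Re (iexp (- (t * x)) * char M t)) \<partial>lborel)"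
proof -
  interpret P: pair_sigma_finite M lborel ..
  let ?f = "\<lambda>y t. indicator {-a..a} t * ((1 - \<bar>t\<bar> / a) * cos (t * (y - x)))"
  have int: "integrable (M \<Otimes>\<^sub>M lborel) (case_prod ?f)"
  proof (rule integrableI_bounded_set[where A = "UNIV \<times> {-a..a}" and B = 1])
    show "emeasure (M \<Otimes>\<^sub>M lborel) (UNIV \<times> {-a..a}) < \<infinity>"
      using a emeasure_space_1 by (subst lborel.emeasure_pair_measure_Times) auto
    have "norm ((1 - \<bar>t\<bar> / a) * cos (t * (y - x))) \<le> 1" if "t \<in> {-a..a}" for t y
    proof -
      have "\<bar>1 - \<bar>t\<bar> / a\<bar> \<le> 1" using that a by (auto simp: abs_le_iff)
      then have "\<bar>1 - \<bar>t\<bar> / a\<bar> * \<bar>cos (t * (y - x))\<bar> \<le> 1 * 1"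
        by (intro mult_mono) auto
      then show ?thesis by (simp add: abs_mult)
    qed
    then show "AE p\<in>UNIV \<times> {- a..a} in M \<Otimes>\<^sub>M lborel. norm (case_prod ?f p) \<le> 1"
      by (intro AE_I2) (auto split: prod.split)
  qed (auto simp: indicator_def)
  have "(\<integral>y. fejer_kernel a (y - x) \<partial>M) = (\<integral>y. (\<integral>t. ?f y t \<partial>lborel) \<partial>M)"
    by (subst fejer_kernel_transform[OF a]) simp
  also have "\<dots> = (\<integral>t. (\<integral>y. ?f y t \<partial>M) \<partial>lborel)"
    by (rule P.Fubini_integral[OF int, symmetric])
  also have "\<dots> = (\<integral>t. indicator {-a..a} t * ((1 - \<bar>t\<bar> / a) * Re (iexp (- (t * x)) * char M t)) \<partial>lborel)"
    by (intro Bochner_Integration.integral_cong) (simp_all add: expectation_cos_eq_char)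
  finally show ?thesis .
qed

text \<open>The summand 1 of the weight bounds Fejer means, the summand
  \<open>\<bar>t\<bar> * c\<close> bounds how fast they vary on the scale \<open>c\<close>; one
  quantity thus serves both concentration and equicontinuity.\<close>

definition weighted_char_mass :: "real \<Rightarrow> real \<Rightarrow> real" where
  "weighted_char_mass c a = (\<integral>t. indicator {-a..a} t * ((1 + \<bar>t\<bar> * c) * cmod (char M t)) \<partial>lborel)"

lemma integrable_weighted_char:
  assumes "0 \<le> c"
  shows "integrable lborel (\<lambda>t. indicator {-a..a} t * ((1 + \<bar>t\<bar> * c) * cmod (char M t)))"
proof (rule integrable_on_band)
  fix t assume "\<bar>t\<bar> \<le> a"
  then have "\<bar>1 + \<bar>t\<bar> * c\<bar> * cmod (char M t) \<le> (1 + a * c) * 1"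
    using assms by (intro mult_mono cmod_char_le_1) (auto intro: mult_right_mono)
  then show "\<bar>(1 + \<bar>t\<bar> * c) * cmod (char M t)\<bar> \<le> 1 + a * c"
    by (simp add: abs_mult)
qed simp

lemma weighted_char_mass_mono:
  assumes "0 \<le> c" "a \<le> b"
  shows "weighted_char_mass c a \<le> weighted_char_mass c b"
  unfolding weighted_char_mass_def
  by (intro Bochner_Integration.integral_mono integrable_weighted_char assms)
     (use assms in \<open>auto simp: indicator_def\<close>)

lemma expectation_fejer_kernel_le:
  assumes a: "0 < a" and c: "0 \<le> c"
  shows "(\<integral>y. fejer_kernel a (y - x) \<partial>M) \<le> weighted_char_mass c a"
  unfolding expectation_fejer_kernel[OF a] weighted_char_mass_def
proof (rule integral_mono')
  show "integrable lborel (\<lambda>t. indicator {-a..a} t * ((1 + \<bar>t\<bar> * c) * cmod (char M t)))"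
    using c by (rule integrable_weighted_char)
  fix t :: real
  show "0 \<le> indicator {-a..a} t * ((1 + \<bar>t\<bar> * c) * cmod (char M t))"
    using c by (auto simp: indicator_def)
  show "indicator {-a..a} t * ((1 - \<bar>t\<bar> / a) * Re (iexp (- (t * x)) * char M t))
    \<le> indicator {-a..a} t * ((1 + \<bar>t\<bar> * c) * cmod (char M t))"
  proof (cases "\<bar>t\<bar> \<le> a")
    case True
    have "(1 - \<bar>t\<bar> / a) * Re (iexp (- (t * x)) * char M t)
      \<le> \<bar>1 - \<bar>t\<bar> / a\<bar> * \<bar>Re (iexp (- (t * x)) * char M t)\<bar>"
      unfolding abs_mult[symmetric] by (rule abs_ge_self)
    also have "\<dots> \<le> (1 + \<bar>t\<bar> * c) * cmod (char M t)"
      using c band_weight_le[OF a True]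
      by (intro mult_mono abs_Re_iexp_mult_le) (auto intro: order_trans add_increasing2)
    finally show ?thesis using True by (simp add: indicator_def)
  qed (auto simp: indicator_def)
qed

text \<open>Moving the centre from \<open>x\<close> to \<open>y\<close> changes the phase at
  frequency \<open>t\<close> by at most \<open>\<bar>t\<bar> * \<bar>x - y\<bar>\<close>, which is
  \<open>\<bar>x - y\<bar> / c\<close> times the second part of the weight.\<close>

lemma expectation_fejer_kernel_diff_le:
  assumes a: "0 < a" and c: "0 < c"
  shows "\<bar>(\<integral>z. fejer_kernel a (z - x) \<partial>M) - (\<integral>z. fejer_kernel a (z - y) \<partial>M)\<bar>
    \<le> \<bar>x - y\<bar> / c * weighted_char_mass c a"
proof -
  let ?g = "\<lambda>x t. indicator {-a..a} t * ((1 - \<bar>t\<bar> / a) * Re (iexp (- (t * x)) * char M t))"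
  have int: "integrable lborel (?g x)" for x
  proof (rule integrable_on_band)
    fix t assume t: "\<bar>t\<bar> \<le> a"
    have "\<bar>1 - \<bar>t\<bar> / a\<bar> * \<bar>Re (iexp (- (t * x)) * char M t)\<bar> \<le> 1 * 1"
      by (intro mult_mono band_weight_le[OF a t] order_trans[OF abs_Re_iexp_mult_le cmod_char_le_1] abs_ge_zero zero_le_one)
    then show "\<bar>(1 - \<bar>t\<bar> / a) * Re (iexp (- (t * x)) * char M t)\<bar> \<le> 1"
      by (simp add: abs_mult)
  qed measurable
  have "\<bar>(\<integral>z. fejer_kernel a (z - x) \<partial>M) - (\<integral>z. fejer_kernel a (z - y) \<partial>M)\<bar>
    = \<bar>(\<integral>t. ?g x t - ?g y t \<partial>lborel)\<bar>"
    unfolding expectation_fejer_kernel[OF a] using int by simp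
  also have "\<dots> \<le> (\<integral>t. \<bar>?g x t - ?g y t\<bar> \<partial>lborel)"
    by (rule integral_abs_bound)
  also have "\<dots> \<le> (\<integral>t. \<bar>x - y\<bar> / c * (indicator {-a..a} t * ((1 + \<bar>t\<bar> * c) * cmod (char M t))) \<partial>lborel)"
  proof (rule Bochner_Integration.integral_mono)
    show "integrable lborel (\<lambda>t. \<bar>?g x t - ?g y t\<bar>)"
      by (intro integrable_abs Bochner_Integration.integrable_diff int)
    show "integrable lborel (\<lambda>t. \<bar>x - y\<bar> / c * (indicator {-a..a} t * ((1 + \<bar>t\<bar> * c) * cmod (char M t))))"
      using c by (intro integrable_mult_right integrable_weighted_char) auto
    have Re_diff: "\<bar>w * Re (u * z) - w * Re (v * z)\<bar> = \<bar>w\<bar> * \<bar>Re ((u - v) * z)\<bar>" for w u v z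
      unfolding abs_mult[symmetric] by (simp add: algebra_simps)
    fix t :: real
    show "\<bar>?g x t - ?g y t\<bar> \<le> \<bar>x - y\<bar> / c * (indicator {-a..a} t * ((1 + \<bar>t\<bar> * c) * cmod (char M t)))"
    proof (cases "\<bar>t\<bar> \<le> a")
      case True
      then have ind: "indicator {-a..a} t = (1::real)" by (auto simp: indicator_def)
      define u v where "u = iexp (- (t * x))" and "v = iexp (- (t * y))"
      have "cmod (u - v) \<le> \<bar>t\<bar> * \<bar>x - y\<bar>"
        unfolding u_def v_def using norm_iexp_diff_le[of "- (t * x)" "- (t * y)"]
        by (simp add: abs_mult[symmetric] algebra_simps abs_minus_commute)
      also have "\<bar>t\<bar> * \<bar>x - y\<bar> \<le> \<bar>x - y\<bar> / c * (1 + \<bar>t\<bar> * c)"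
        using c by (simp add: field_simps)
      finally have uv: "cmod (u - v) \<le> \<bar>x - y\<bar> / c * (1 + \<bar>t\<bar> * c)" .
      have "\<bar>?g x t - ?g y t\<bar> = \<bar>1 - \<bar>t\<bar> / a\<bar> * \<bar>Re ((u - v) * char M t)\<bar>"
        unfolding Re_diff[symmetric] ind mult_1 u_def v_def by (rule refl)
      also have "\<dots> \<le> 1 * cmod ((u - v) * char M t)"
        by (intro mult_mono abs_Re_le_cmod band_weight_le[OF a True]) auto
      also have "\<dots> \<le> (\<bar>x - y\<bar> / c * (1 + \<bar>t\<bar> * c)) * cmod (char M t)"
        unfolding norm_mult mult_1 by (intro mult_right_mono uv norm_ge_zero)
      finally show ?thesis unfolding ind by (simp only: mult_1 mult.assoc)
    qed (auto simp: indicator_def)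
  qed
  also have "\<dots> = \<bar>x - y\<bar> / c * weighted_char_mass c a"
    unfolding weighted_char_mass_def by simp
  finally show ?thesis .
qed

text \<open>The kernel with band \<open>1 / L\<close> is at least \<open>1 / (2 * L)\<close> on
  \<open>[0, L)\<close>, so a window of length \<open>L\<close> is dominated by \<open>2 * L\<close>
  times a Fejer mean.\<close>

lemma prob_window_le:
  assumes L: "0 < L" and c: "0 \<le> c"
  shows "prob {x..<x + L} \<le> 2 * L * weighted_char_mass c (1 / L)"
proof -
  have "prob {x..<x + L} * (1 / (2 * L)) = (\<integral>y. indicator {x..<x + L} y * (1 / (2 * L)) \<partial>M)"
    by simp
  also have "\<dots> \<le> (\<integral>y. fejer_kernel (1 / L) (y - x) \<partial>M)"
  proof (rule Bochner_Integration.integral_mono)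
    show "integrable M (\<lambda>y. fejer_kernel (1 / L) (y - x))"
      using L by (intro integrable_fejer_kernel_diff) auto
    fix y show "indicator {x..<x + L} y * (1 / (2 * L)) \<le> fejer_kernel (1 / L) (y - x)"
      using fejer_kernel_ge[of "1 / L" "y - x"] fejer_kernel_nonneg[of "1 / L" "y - x"] L
      by (auto simp: indicator_def)
    show "integrable M (\<lambda>y. indicator {x..<x + L} y * (1 / (2 * L)))"
      by (intro integrable_mult_left integrable_real_indicator) (auto simp: emeasure_eq_measure)
  qed
  also have "\<dots> \<le> weighted_char_mass c (1 / L)"
    using L c by (intro expectation_fejer_kernel_le) auto
  finally show ?thesis using L by (simp add: field_simps)
qed

text \<open>Smoothing errors decay like the Cauchy kernel, whose transform has unbounded support;
  domination by two Fejer kernels of band 1 brings its expectation back to a bounded band.\<close>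

lemma expectation_cauchy_kernel_le:
  assumes c: "0 \<le> c"
  shows "(\<integral>y. 1 / (1 + (y - x)\<^sup>2) \<partial>M) \<le> 20 * weighted_char_mass c 1"
proof -
  have "(\<integral>y. 1 / (1 + (y - x)\<^sup>2) \<partial>M)
    \<le> (\<integral>y. 10 * (fejer_kernel 1 (y - x) + fejer_kernel 1 (y - (x + pi))) \<partial>M)"
  proof (rule integral_mono')
    show "integrable M (\<lambda>y. 10 * (fejer_kernel 1 (y - x) + fejer_kernel 1 (y - (x + pi))))"
      by (intro integrable_mult_right Bochner_Integration.integrable_add integrable_fejer_kernel_diff) auto
    fix y show "1 / (1 + (y - x)\<^sup>2) \<le> 10 * (fejer_kernel 1 (y - x) + fejer_kernel 1 (y - (x + pi)))"
      using cauchy_kernel_le_fejer[of "y - x"] by (simp add: algebra_simps)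
  qed (simp add: fejer_kernel_nonneg)
  also have "\<dots> = 10 * ((\<integral>y. fejer_kernel 1 (y - x) \<partial>M) + (\<integral>y. fejer_kernel 1 (y - (x + pi)) \<partial>M))"
    by (simp add: integrable_fejer_kernel_diff)
  also have "\<dots> \<le> 10 * (weighted_char_mass c 1 + weighted_char_mass c 1)"
    using c by (intro mult_left_mono add_mono expectation_fejer_kernel_le) auto
  finally show ?thesis by simp
qed

end

section \<open>Smoothed windows\<close>

text \<open>Convolution of the window \<open>[0, L)\<close> with the Fejer kernel normalised to mass
  1; its values lie in \<open>[0, 1]\<close> and only frequencies up to \<open>a\<close> occur in
  it.\<close>

definition smooth_window :: "real \<Rightarrow> real \<Rightarrow> real \<Rightarrow> real" where
  "smooth_window a L y = (\<integral>w. indicator {0..<L} w * fejer_kernel a (y - w) \<partial>lborel) / fejer_mass"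

definition cauchy_mass :: real where
  "cauchy_mass = (\<integral>y. 1 / (1 + y\<^sup>2) \<partial>lborel)"

lemma cauchy_mass_nonneg: "0 \<le> cauchy_mass"
  unfolding cauchy_mass_def by (rule Bochner_Integration.integral_nonneg) (simp add: add_nonneg_nonneg)

lemma cauchy_kernel_integral:
  shows "integrable lborel (\<lambda>w. 1 / (1 + (y - w)\<^sup>2))"
    and "(\<integral>w. 1 / (1 + (y - w)\<^sup>2) \<partial>lborel) = cauchy_mass"
proof -
  have eq: "(\<lambda>w. 1 / (1 + (y - w)\<^sup>2)) = (\<lambda>w. 1 / (1 + (y + (- 1) * w)\<^sup>2))" by simp
  show "integrable lborel (\<lambda>w. 1 / (1 + (y - w)\<^sup>2))"
    unfolding eq by (rule lborel_integrable_real_affine[OF integrable_cauchy_kernel]) simp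
  show "(\<integral>w. 1 / (1 + (y - w)\<^sup>2) \<partial>lborel) = cauchy_mass"
    unfolding eq cauchy_mass_def
    by (subst (2) lborel_integral_real_affine[where c = "-1" and t = y]) auto
qed

text \<open>Away from the origin a wider band gains a factor \<open>1 / a\<close>, and the Cauchy
  form keeps the bound integrable in \<open>u\<close>.\<close>

lemma fejer_kernel_le_cauchy_kernel:
  assumes "0 < a" "0 < r" "r \<le> \<bar>u\<bar>"
  shows "fejer_kernel a u \<le> 4 * (1 + 1 / r\<^sup>2) / a * (1 / (1 + u\<^sup>2))"
proof -
  have u: "u \<noteq> 0" using assms by auto
  have "r\<^sup>2 \<le> u\<^sup>2" using assms by (simp add: abs_le_square_iff[symmetric])
  then have "1 \<le> u\<^sup>2 / r\<^sup>2" using assms by simp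
  then have "1 + u\<^sup>2 \<le> u\<^sup>2 * (1 + 1 / r\<^sup>2)" by (simp add: algebra_simps)
  then have "1 / u\<^sup>2 \<le> (1 + 1 / r\<^sup>2) * (1 / (1 + u\<^sup>2))"
    using u by (simp add: divide_simps add_pos_nonneg mult_ac)
  then have "4 / a * (1 / u\<^sup>2) \<le> 4 / a * ((1 + 1 / r\<^sup>2) * (1 / (1 + u\<^sup>2)))"
    using assms by (intro mult_left_mono) auto
  then show ?thesis
    using fejer_kernel_le_inverse_square[OF assms(1) u] by (simp add: mult_ac)
qed

lemma integrable_window_fejer:
  "0 < a \<Longrightarrow> A \<in> sets borel \<Longrightarrow> integrable lborel (\<lambda>w. indicator A w * fejer_kernel a (y - w))"
  using integrable_mult_indicator[OF _ fejer_kernel_integral(1)] by simp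

lemma smooth_window_nonneg: "0 < a \<Longrightarrow> 0 \<le> smooth_window a L y"
  unfolding smooth_window_def using fejer_mass_pos
  by (intro divide_nonneg_pos Bochner_Integration.integral_nonneg) (auto simp: fejer_kernel_nonneg indicator_def)

lemma one_minus_smooth_window:
  assumes "0 < a"
  shows "1 - smooth_window a L y = (\<integral>w. indicator (- {0..<L}) w * fejer_kernel a (y - w) \<partial>lborel) / fejer_mass"
proof -
  have "(\<integral>w. indicator (- {0..<L}) w * fejer_kernel a (y - w) \<partial>lborel)
    + (\<integral>w. indicator {0..<L} w * fejer_kernel a (y - w) \<partial>lborel)
    = (\<integral>w. fejer_kernel a (y - w) \<partial>lborel)"
    using assms
    by (subst Bochner_Integration.integral_add[OF integrable_window_fejer integrable_window_fejer, symmetric])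
       (auto intro!: Bochner_Integration.integral_cong simp: indicator_def)
  then show ?thesis
    using fejer_mass_pos by (simp add: smooth_window_def fejer_kernel_integral(2)[OF assms] field_simps)
qed

lemma smooth_window_le_1: "0 < a \<Longrightarrow> smooth_window a L y \<le> 1"
proof -
  assume a: "0 < a"
  have "0 \<le> 1 - smooth_window a L y"
    unfolding one_minus_smooth_window[OF a] using fejer_mass_pos a
    by (intro divide_nonneg_pos Bochner_Integration.integral_nonneg) (auto simp: fejer_kernel_nonneg indicator_def)
  then show ?thesis by simp
qed

lemma smooth_window_measurable [measurable]: "smooth_window a L \<in> borel_measurable borel"
  unfolding smooth_window_def by measurable

text \<open>Collects two regions of the smoothing estimate: \<open>4 * cauchy_mass\<close> comes
  from points well inside the window, \<open>8 * L\<close> from points well outside it.\<close>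

definition smooth_const :: "real \<Rightarrow> real \<Rightarrow> real" where
  "smooth_const r L = (1 + 1 / r\<^sup>2) * (1 + L\<^sup>2) * (4 * cauchy_mass + 8 * L) / fejer_mass"

lemma smooth_const_nonneg: "0 < L \<Longrightarrow> 0 \<le> smooth_const r L"
  unfolding smooth_const_def
  by (intro divide_nonneg_pos mult_nonneg_nonneg add_nonneg_nonneg cauchy_mass_nonneg fejer_mass_pos zero_le_one zero_le_power2 divide_nonneg_nonneg) simp_all

text \<open>Within \<open>r\<close> of an endpoint only the trivial bound 1 is available. Elsewhere
  the kernel has to carry mass over a distance at least \<open>r\<close>, which costs a multiple of
  \<open>1 / a\<close>. The decaying last factor matters, since its expectation under a spread-out
  law is small again.\<close>

lemma window_smooth_window_diff:
  assumes a: "0 < a" and r: "0 < r" and L: "0 < L"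
  shows "\<bar>indicator {0..<L} y - smooth_window a L y\<bar>
    \<le> indicator {-r..<r} y + indicator {L - r..<L + r} y + smooth_const r L / a * (1 / (1 + y\<^sup>2))"
proof -
  have K0: "0 \<le> smooth_const r L / a * (1 / (1 + y\<^sup>2))"
    using smooth_const_nonneg[OF L] a by (intro mult_nonneg_nonneg) (auto simp: add_nonneg_nonneg)
  let ?B = "4 * (1 + 1 / r\<^sup>2) / a"
  have B: "0 \<le> ?B" using a r by (simp add: add_nonneg_nonneg)
  have L2: "1 \<le> 1 + L\<^sup>2" by simp
  consider "y \<in> {-r..<r} \<union> {L - r..<L + r}" | "r \<le> y" "y < L - r" | "y < - r \<or> L + r \<le> y"
    by force
  then show ?thesis
  proof cases
    case 1
    have "\<bar>indicator {0..<L} y - smooth_window a L y\<bar> \<le> 1"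
      using smooth_window_nonneg[OF a, of L y] smooth_window_le_1[OF a, of L y]
      by (auto simp: indicator_def)
    then show ?thesis using 1 K0 by (auto simp: indicator_def)
  next
    case 2
    have "(\<integral>w. indicator (- {0..<L}) w * fejer_kernel a (y - w) \<partial>lborel)
      \<le> (\<integral>w. ?B * (1 / (1 + (y - w)\<^sup>2)) \<partial>lborel)"
    proof (rule Bochner_Integration.integral_mono)
      show "integrable lborel (\<lambda>w. indicator (- {0..<L}) w * fejer_kernel a (y - w))"
        using a by (intro integrable_window_fejer) auto
      show "integrable lborel (\<lambda>w. ?B * (1 / (1 + (y - w)\<^sup>2)))"
        by (intro integrable_mult_right cauchy_kernel_integral)
      fix w
      have "0 \<le> ?B * (1 / (1 + (y - w)\<^sup>2))"
        using B by (intro mult_nonneg_nonneg) (auto simp: add_nonneg_nonneg)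
      then show "indicator (- {0..<L}) w * fejer_kernel a (y - w) \<le> ?B * (1 / (1 + (y - w)\<^sup>2))"
        using fejer_kernel_le_cauchy_kernel[OF a r, of "y - w"] 2
        by (cases "w \<in> {0..<L}") auto
    qed
    also have "\<dots> = ?B * cauchy_mass"
      unfolding cauchy_kernel_integral(2)[of y, symmetric] by (rule Bochner_Integration.integral_mult_right_zero)
    finally have "1 - smooth_window a L y \<le> ?B * cauchy_mass / fejer_mass"
      unfolding one_minus_smooth_window[OF a] using fejer_mass_pos by (intro divide_right_mono) auto
    \<comment> \<open>Inside the window there is no decay to exploit; the factor
      \<open>1 + L\<^sup>2\<close> of \<open>smooth_const\<close> pays for writing a constant as a
      multiple of \<open>1 / (1 + y\<^sup>2)\<close> with \<open>y \<le> L\<close>.\<close>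
    also have "\<dots> \<le> smooth_const r L / a * (1 / (1 + L\<^sup>2))"
    proof -
      have "smooth_const r L / a * (1 / (1 + L\<^sup>2))
        = ((1 + L\<^sup>2) * (1 / (1 + L\<^sup>2))) * ((1 + 1 / r\<^sup>2) / a * (4 * cauchy_mass + 8 * L) / fejer_mass)"
        unfolding smooth_const_def by simp
      also have "(1 + L\<^sup>2) * (1 / (1 + L\<^sup>2)) = 1" using L2 by (metis nonzero_mult_div_cancel_left divide_self_if less_le_not_le linorder_not_less not_one_le_zero times_divide_eq_right mult.right_neutral)
      finally have eq: "smooth_const r L / a * (1 / (1 + L\<^sup>2)) = (1 + 1 / r\<^sup>2) / a * (4 * cauchy_mass + 8 * L) / fejer_mass"
        by simp
      have "?B * cauchy_mass = (1 + 1 / r\<^sup>2) / a * (4 * cauchy_mass)" by simp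
      also have "\<dots> \<le> (1 + 1 / r\<^sup>2) / a * (4 * cauchy_mass + 8 * L)"
        using a L by (intro mult_left_mono) (auto simp: add_nonneg_nonneg)
      finally show ?thesis unfolding eq using fejer_mass_pos by (intro divide_right_mono) auto
    qed
    also have "\<dots> \<le> smooth_const r L / a * (1 / (1 + y\<^sup>2))"
    proof -
      have "y\<^sup>2 \<le> L\<^sup>2" using 2 r by (intro power_mono) auto
      then show ?thesis using smooth_const_nonneg[OF L] a
        by (intro mult_left_mono divide_left_mono mult_pos_pos) (auto simp: add_pos_nonneg)
    qed
    finally show ?thesis
      using 2 r smooth_window_le_1[OF a, of L y] by (auto simp: indicator_def)
  next
    case 3
    let ?D = "?B * (2 * (1 + L\<^sup>2) / (1 + y\<^sup>2))"
    have "(\<integral>w. indicator {0..<L} w * fejer_kernel a (y - w) \<partial>lborel) \<le> (\<integral>w. indicator {0..<L} w * ?D \<partial>lborel)"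
    proof (rule Bochner_Integration.integral_mono)
      show "integrable lborel (\<lambda>w. indicator {0..<L} w * fejer_kernel a (y - w))"
        using a by (intro integrable_window_fejer) auto
      show "integrable lborel (\<lambda>w. indicator {0..<L} w * ?D)"
        using L by (intro integrable_mult_left integrable_real_indicator) auto
      fix w
      show "indicator {0..<L} w * fejer_kernel a (y - w) \<le> indicator {0..<L} w * ?D"
      proof (cases "w \<in> {0..<L}")
        case True
        have "r \<le> \<bar>y - w\<bar>" using 3 True by auto
        from fejer_kernel_le_cauchy_kernel[OF a r this]
        have "fejer_kernel a (y - w) \<le> ?B * (1 / (1 + (y - w)\<^sup>2))" .
        also have "\<dots> \<le> ?D"
        proof (rule mult_left_mono[OF _ B])
          have w2: "w\<^sup>2 \<le> L\<^sup>2" using True by (intro power_mono) auto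
          \<comment> \<open>Recentres the Cauchy kernel from \<open>w\<close> to 0 at the price of a
            factor \<open>2 * (1 + L\<^sup>2)\<close>.\<close>
          have "y\<^sup>2 \<le> 2 * (y - w)\<^sup>2 + 2 * w\<^sup>2"
            using zero_le_power2[of "y - 2 * w"] by (simp add: power2_eq_square algebra_simps)
          then have "1 + y\<^sup>2 \<le> 2 * (1 + L\<^sup>2) + 2 * (y - w)\<^sup>2" using w2 by simp
          also have "\<dots> \<le> 2 * (1 + L\<^sup>2) * (1 + (y - w)\<^sup>2)" by (simp add: algebra_simps)
          finally have "1 + y\<^sup>2 \<le> 2 * (1 + L\<^sup>2) * (1 + (y - w)\<^sup>2)" .
          moreover have "0 < 1 + y\<^sup>2" "0 < 1 + (y - w)\<^sup>2" by (auto intro: add_pos_nonneg)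
          ultimately show "1 / (1 + (y - w)\<^sup>2) \<le> 2 * (1 + L\<^sup>2) / (1 + y\<^sup>2)"
            by (simp add: pos_divide_le_eq pos_le_divide_eq)
        qed
        finally show ?thesis using True by simp
      qed simp
    qed
    also have "\<dots> = L * ?D"
      using L by (subst integral_mult_left_zero) simp
    finally have "smooth_window a L y \<le> L * ?D / fejer_mass"
      unfolding smooth_window_def using fejer_mass_pos by (intro divide_right_mono) auto
    also have "\<dots> = ((1 + 1 / r\<^sup>2) * (1 + L\<^sup>2) * (8 * L)) / fejer_mass / a * (1 / (1 + y\<^sup>2))"
    proof -
      have "L * (4 * p / a * (2 * q / s)) / t = p * q * (8 * L) / t / a * (1 / s)" for p q s t :: real
        by (simp add: mult_ac)
      then show ?thesis .
    qed
    also have "\<dots> \<le> smooth_const r L / a * (1 / (1 + y\<^sup>2))"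
    proof -
      have "(1 + 1 / r\<^sup>2) * (1 + L\<^sup>2) * (8 * L) \<le> (1 + 1 / r\<^sup>2) * (1 + L\<^sup>2) * (4 * cauchy_mass + 8 * L)"
        using cauchy_mass_nonneg by (intro mult_left_mono mult_nonneg_nonneg add_nonneg_nonneg) auto
      then show ?thesis
        unfolding smooth_const_def
        by (intro mult_right_mono divide_right_mono divide_nonneg_nonneg less_imp_le[OF a]
            less_imp_le[OF fejer_mass_pos] add_nonneg_nonneg zero_le_one zero_le_power2)
    qed
    finally show ?thesis
      using 3 r L smooth_window_nonneg[OF a, of L y] by (auto simp: indicator_def)
  qed
qed

section \<open>Window probabilities compared with their smoothed versions\<close>

context real_distribution
begin

lemma integrable_smooth_window: "0 < a \<Longrightarrow> integrable M (\<lambda>z. smooth_window a L (z - x))"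
  by (rule integrable_const_bound[where B = 1])
     (auto simp: smooth_window_nonneg smooth_window_le_1)

lemma expectation_smooth_window:
  assumes a: "0 < a" and L: "0 < L"
  shows "(\<integral>z. smooth_window a L (z - x) \<partial>M) =
    (\<integral>w. indicator {0..<L} w * (\<integral>z. fejer_kernel a (z - (x + w)) \<partial>M) \<partial>lborel) / fejer_mass"
proof -
  interpret P: pair_sigma_finite M lborel ..
  let ?f = "\<lambda>z w. indicator {0..<L} w * fejer_kernel a (z - (x + w))"
  have int: "integrable (M \<Otimes>\<^sub>M lborel) (case_prod ?f)"
  proof (rule integrableI_bounded_set[where A = "UNIV \<times> {0..<L}" and B = a])
    show "emeasure (M \<Otimes>\<^sub>M lborel) (UNIV \<times> {0..<L}) < \<infinity>"
      using L emeasure_space_1 by (subst lborel.emeasure_pair_measure_Times) auto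
    show "AE p in M \<Otimes>\<^sub>M lborel. p \<in> UNIV \<times> {0..<L} \<longrightarrow> norm (case_prod ?f p) \<le> a"
      using a by (intro AE_I2) (auto simp: fejer_kernel_nonneg fejer_kernel_le split: prod.split)
  qed (auto simp: indicator_def)
  have "(\<integral>z. smooth_window a L (z - x) \<partial>M) = (\<integral>z. (\<integral>w. ?f z w \<partial>lborel) \<partial>M) / fejer_mass"
    unfolding smooth_window_def by (simp add: algebra_simps)
  also have "(\<integral>z. (\<integral>w. ?f z w \<partial>lborel) \<partial>M) = (\<integral>w. (\<integral>z. ?f z w \<partial>M) \<partial>lborel)"
    by (rule P.Fubini_integral[OF int, symmetric])
  finally show ?thesis by simp
qed

lemma expectation_smooth_window_diff_le:
  assumes a: "0 < a" and L: "0 < L" and c: "0 < c"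
  shows "\<bar>(\<integral>z. smooth_window a L (z - x) \<partial>M) - (\<integral>z. smooth_window a L (z - y) \<partial>M)\<bar>
    \<le> L / fejer_mass * (\<bar>x - y\<bar> / c * weighted_char_mass c a)"
proof -
  let ?g = "\<lambda>x w. indicator {0..<L} w * (\<integral>z. fejer_kernel a (z - (x + w)) \<partial>M)"
  have int: "integrable lborel (?g x)" for x
  proof (rule integrableI_bounded_set[where A = "{0..<L}" and B = a])
    have "(\<integral>z. fejer_kernel a (z - (x + w)) \<partial>M) \<le> (\<integral>z. a \<partial>M)" for w
      using a by (intro Bochner_Integration.integral_mono integrable_fejer_kernel_diff)
        (auto simp: fejer_kernel_le)
    then show "AE w in lborel. w \<in> {0..<L} \<longrightarrow> norm (?g x w) \<le> a"
      using a by (intro AE_I2) (simp add: prob_space[simplified] Bochner_Integration.integral_nonneg fejer_kernel_nonneg)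
    show "?g x \<in> borel_measurable lborel" by measurable
  qed (use L in auto)
  have eq: "(\<integral>z. smooth_window a L (z - x) \<partial>M) - (\<integral>z. smooth_window a L (z - y) \<partial>M)
    = (\<integral>w. ?g x w - ?g y w \<partial>lborel) / fejer_mass"
    using int by (simp add: expectation_smooth_window[OF a L] diff_divide_distrib)
  have "\<bar>(\<integral>z. smooth_window a L (z - x) \<partial>M) - (\<integral>z. smooth_window a L (z - y) \<partial>M)\<bar>
    = \<bar>\<integral>w. ?g x w - ?g y w \<partial>lborel\<bar> / fejer_mass"
    unfolding eq abs_divide using fejer_mass_pos by simp
  also have "\<dots> \<le> (\<integral>w. indicator {0..<L} w * (\<bar>x - y\<bar> / c * weighted_char_mass c a) \<partial>lborel) / fejer_mass"
  proof (rule divide_right_mono)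
    show "\<bar>\<integral>w. ?g x w - ?g y w \<partial>lborel\<bar>
      \<le> (\<integral>w. indicator {0..<L} w * (\<bar>x - y\<bar> / c * weighted_char_mass c a) \<partial>lborel)"
    proof -
      have "\<bar>\<integral>w. ?g x w - ?g y w \<partial>lborel\<bar> \<le> (\<integral>w. \<bar>?g x w - ?g y w\<bar> \<partial>lborel)"
        by (rule integral_abs_bound)
      also have "\<dots> \<le> (\<integral>w. indicator {0..<L} w * (\<bar>x - y\<bar> / c * weighted_char_mass c a) \<partial>lborel)"
      proof (rule Bochner_Integration.integral_mono)
      show "integrable lborel (\<lambda>w. \<bar>?g x w - ?g y w\<bar>)"
        by (intro integrable_abs Bochner_Integration.integrable_diff int)
      show "integrable lborel (\<lambda>w. indicator {0..<L} w * (\<bar>x - y\<bar> / c * weighted_char_mass c a))"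
        using L by (intro integrable_mult_left integrable_real_indicator) auto
      fix w show "\<bar>?g x w - ?g y w\<bar> \<le> indicator {0..<L} w * (\<bar>x - y\<bar> / c * weighted_char_mass c a)"
        using expectation_fejer_kernel_diff_le[OF a c, of "x + w" "y + w"]
        by (cases "w \<in> {0..<L}") auto
      qed
      finally show ?thesis .
    qed
  qed (use fejer_mass_pos in auto)
  also have "\<dots> = L / fejer_mass * (\<bar>x - y\<bar> / c * weighted_char_mass c a)"
    using L by (subst integral_mult_left_zero) simp
  finally show ?thesis .
qed

text \<open>The strips around the two endpoints are windows of length \<open>2 * r\<close>, so their
  probabilities are again bounded by a weighted mass, and so is the Cauchy tail.\<close>

lemma window_smoothing_error:
  assumes a: "0 < a" and r: "0 < r" and L: "0 < L" and c: "0 \<le> c"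
  shows "\<bar>prob {x..<x + L} - (\<integral>z. smooth_window a L (z - x) \<partial>M)\<bar>
    \<le> 8 * r * weighted_char_mass c (1 / (2 * r)) + 20 * smooth_const r L / a * weighted_char_mass c 1"
proof -
  have ind: "integrable M (\<lambda>z. indicator {u..<v} (z - x) :: real)" for u v
    by (rule integrable_const_bound[where B = 1]) auto
  have ind_eq: "(\<integral>z. indicator {u..<v} (z - x) \<partial>M) = prob {x + u..<x + v}" for u v
  proof -
    have "(\<lambda>z. indicator {u..<v} (z - x) :: real) = indicator {x + u..<x + v}"
      by (auto simp: indicator_def fun_eq_iff)
    then show ?thesis by simp
  qed
  have cau: "integrable M (\<lambda>z. 1 / (1 + (z - x)\<^sup>2))"
    by (rule integrable_const_bound[where B = 1]) (auto simp: add_nonneg_nonneg divide_le_eq_1 add_pos_nonneg)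
  have "\<bar>prob {x..<x + L} - (\<integral>z. smooth_window a L (z - x) \<partial>M)\<bar>
    = \<bar>\<integral>z. indicator {0..<L} (z - x) - smooth_window a L (z - x) \<partial>M\<bar>"
    using a by (subst Bochner_Integration.integral_diff[OF ind integrable_smooth_window]) (auto simp: ind_eq)
  also have "\<dots> \<le> (\<integral>z. indicator {-r..<r} (z - x) + indicator {L - r..<L + r} (z - x)
      + smooth_const r L / a * (1 / (1 + (z - x)\<^sup>2)) \<partial>M)"
    using a by (intro order_trans[OF integral_abs_bound] Bochner_Integration.integral_mono
        integrable_abs Bochner_Integration.integrable_diff Bochner_Integration.integrable_add
        integrable_mult_right ind cau integrable_smooth_window window_smooth_window_diff r L)
  also have "\<dots> = prob {x - r..<x - r + 2 * r} + prob {x + L - r..<x + L - r + 2 * r}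
      + smooth_const r L / a * (\<integral>z. 1 / (1 + (z - x)\<^sup>2) \<partial>M)"
  proof -
    have "x - r + 2 * r = x + r" "x + L - r + 2 * r = x + (L + r)" by simp_all
    then show ?thesis
      by (subst Bochner_Integration.integral_add[OF Bochner_Integration.integrable_add[OF ind ind] integrable_mult_right[OF cau]],
          subst Bochner_Integration.integral_add[OF ind ind], unfold ind_eq Bochner_Integration.integral_mult_right_zero)
        (simp add: algebra_simps)
  qed
  also have "\<dots> \<le> 2 * (2 * r) * weighted_char_mass c (1 / (2 * r)) + 2 * (2 * r) * weighted_char_mass c (1 / (2 * r))
      + smooth_const r L / a * (20 * weighted_char_mass c 1)"
    using r a c smooth_const_nonneg[OF L]
    by (intro add_mono mult_left_mono prob_window_le expectation_cauchy_kernel_le) auto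
  finally show ?thesis by (simp add: mult_ac)
qed

lemma prob_window_diff_le:
  assumes a: "0 < a" and r: "0 < r" and L: "0 < L" and c: "0 < c"
  shows "\<bar>prob {x..<x + L} - prob {y..<y + L}\<bar>
    \<le> L / fejer_mass * (\<bar>x - y\<bar> / c * weighted_char_mass c a)
      + 2 * (8 * r * weighted_char_mass c (1 / (2 * r)) + 20 * smooth_const r L / a * weighted_char_mass c 1)"
proof -
  have "\<bar>p - f\<bar> \<le> e \<Longrightarrow> \<bar>q - g\<bar> \<le> e \<Longrightarrow> \<bar>f - g\<bar> \<le> d \<Longrightarrow> \<bar>p - q\<bar> \<le> d + 2 * e"
    for p q f g d e :: real by linarith
  from this[OF window_smoothing_error[OF a r L less_imp_le[OF c]]
      window_smoothing_error[OF a r L less_imp_le[OF c]] expectation_smooth_window_diff_le[OF a L c]]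
  show ?thesis .
qed

end

text \<open>The band is chosen from \<open>L\<close> and \<open>\<eta>\<close> alone, before the
  law, the scale and the constant. A bound on the weighted mass at this single band suffices because
  the mass grows with the band.\<close>

lemma window_equicontinuity:
  assumes L: "0 < L" and \<eta>: "0 < \<eta>"
  shows "\<exists>a\<ge>1. \<forall>\<mu> c C x y. real_distribution \<mu> \<longrightarrow> 0 < c \<longrightarrow>
    real_distribution.weighted_char_mass \<mu> c a \<le> C / c \<longrightarrow>
    \<bar>measure \<mu> {x..<x + L} - measure \<mu> {y..<y + L}\<bar> \<le> C / c * (L / fejer_mass * \<bar>x - y\<bar> / c + \<eta>)"
proof -
  \<comment> \<open>With this \<open>r\<close> the endpoint strips contribute
    \<open>16 * r = \<eta> / 2\<close>; the third entry of the maximum below makes the tail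
    contribute at most the other half.\<close>
  define r where "r = \<eta> / 32"
  define K where "K = smooth_const r L"
  define a where "a = Max {1, 1 / (2 * r), 80 * K / \<eta>}"
  have r: "0 < r" using \<eta> by (simp add: r_def)
  have a: "1 \<le> a" "1 / (2 * r) \<le> a" "80 * K / \<eta> \<le> a" by (auto simp: a_def)
  have K: "40 * K / a \<le> \<eta> / 2" using a \<eta> by (simp add: field_simps)
  have K0: "0 \<le> K" unfolding K_def using L by (rule smooth_const_nonneg)
  show ?thesis
  proof (intro exI[of _ a] conjI a allI impI)
    fix \<mu> c C x y
    assume \<mu>: "real_distribution \<mu>" and c: "(0::real) < c"
      and W: "real_distribution.weighted_char_mass \<mu> c a \<le> C / c"
    interpret real_distribution \<mu> by fact
    have W': "weighted_char_mass c b \<le> C / c" if "b \<le> a" for b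
      using weighted_char_mass_mono[OF less_imp_le[OF c] that] W by simp
    have "0 \<le> weighted_char_mass c a"
      unfolding weighted_char_mass_def using c by (intro Bochner_Integration.integral_nonneg mult_nonneg_nonneg add_nonneg_nonneg) auto
    then have C: "0 \<le> C / c" using W by simp
    have "\<bar>measure \<mu> {x..<x + L} - measure \<mu> {y..<y + L}\<bar>
      \<le> L / fejer_mass * (\<bar>x - y\<bar> / c * weighted_char_mass c a)
      + 2 * (8 * r * weighted_char_mass c (1 / (2 * r)) + 20 * smooth_const r L / a * weighted_char_mass c 1)"
      using a by (intro prob_window_diff_le r L c) auto
    also have "\<dots> \<le> L / fejer_mass * (\<bar>x - y\<bar> / c * (C / c)) + 2 * (8 * r * (C / c) + 20 * K / a * (C / c))"
      unfolding K_def[symmetric] using a r L c fejer_mass_pos K0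
      by (intro add_mono mult_left_mono W') auto
    also have "\<dots> = C / c * (L / fejer_mass * \<bar>x - y\<bar> / c + (\<eta> / 2 + 40 * K / a))"
    proof -
      have "l / m * (d / c * e) + 2 * (8 * (\<eta> / 32) * e + 20 * k / a * e) = e * (l / m * d / c + (\<eta> / 2 + 40 * k / a))"
        for l m d e k :: real by (simp add: algebra_simps)
      then show ?thesis unfolding r_def .
    qed
    also have "\<dots> \<le> C / c * (L / fejer_mass * \<bar>x - y\<bar> / c + \<eta>)"
      using K by (intro mult_left_mono[OF _ C] add_left_mono) linarith
    finally show "\<bar>measure \<mu> {x..<x + L} - measure \<mu> {y..<y + L}\<bar>
      \<le> C / c * (L / fejer_mass * \<bar>x - y\<bar> / c + \<eta>)" .
  qed
qed

section \<open>Norming sequences and decay of the characteristic function\<close>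

text \<open>Uniformity permits evaluation at points that move with \<open>n\<close>, as needed for
  the ratio \<open>c n / c (2 * n)\<close>.\<close>

lemma uniform_limit_eval:
  fixes f :: "nat \<Rightarrow> 'a \<Rightarrow> real"
  assumes "uniform_limit S f l sequentially" and "eventually (\<lambda>n. g n \<in> S) sequentially"
  shows "(\<lambda>n. f n (g n) - l (g n)) \<longlonglongrightarrow> 0"
proof (rule tendstoI)
  fix e :: real assume "0 < e"
  from uniform_limitD[OF assms(1) this] assms(2)
  show "\<forall>\<^sub>F n in sequentially. dist (f n (g n) - l (g n)) 0 < e"
    by eventually_elim (auto simp: dist_real_def)
qed

text \<open>The factor \<open>1 + u\<close> is the frequency weight; the factor
  \<open>1 + u\<^sup>2\<close> is later divided out to leave an integrable Cauchy density.\<close>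

lemma bounded_poly_times_stretched_exp:
  fixes d \<gamma> :: real
  assumes "0 < d" "0 < \<gamma>"
  shows "\<exists>D\<ge>0. \<forall>u\<ge>0. (1 + u) * (1 + u\<^sup>2) * exp (- (d * u powr \<gamma>)) \<le> D"
proof -
  have "((\<lambda>u::real. (1 + u) * (1 + u\<^sup>2) * exp (- (d * u powr \<gamma>))) \<longlongrightarrow> 0) at_top"
    using assms by real_asymp
  then have "eventually (\<lambda>u::real. (1 + u) * (1 + u\<^sup>2) * exp (- (d * u powr \<gamma>)) < 1) at_top"
    by (rule order_tendstoD) simp
  then obtain U where U: "\<And>u. U \<le> u \<Longrightarrow> (1 + u) * (1 + u\<^sup>2) * exp (- (d * u powr \<gamma>)) < 1"
    by (auto simp: eventually_at_top_linorder)
  define V where "V = \<bar>U\<bar>"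
  show ?thesis
  proof (intro exI[of _ "1 + (1 + V) * (1 + V\<^sup>2)"] conjI allI impI)
    show "0 \<le> 1 + (1 + V) * (1 + V\<^sup>2)" by (simp add: V_def add_nonneg_nonneg)
    fix u :: real assume u: "0 \<le> u"
    show "(1 + u) * (1 + u\<^sup>2) * exp (- (d * u powr \<gamma>)) \<le> 1 + (1 + V) * (1 + V\<^sup>2)"
    proof (cases "U \<le> u")
      case True
      then show ?thesis using U[OF True] by (simp add: V_def add_nonneg_nonneg add_increasing2)
    next
      case False
      then have "u \<le> V" by (simp add: V_def)
      then have "(1 + u) * (1 + u\<^sup>2) * exp (- (d * u powr \<gamma>)) \<le> (1 + V) * (1 + V\<^sup>2) * 1"
        using u assms by (intro mult_mono add_left_mono power_mono) (auto simp: add_nonneg_nonneg)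
      then show ?thesis by simp
    qed
  qed
qed

text \<open>Only moduli of characteristic functions enter the local bounds, so the skewness has
  dropped out; the last assumption is the form in which non-latticeness is used.\<close>

locale attracted_law = real_distribution F for F :: "real measure" +
  fixes c :: "nat \<Rightarrow> real" and \<kappa> \<alpha> :: real
  assumes c_pos: "1 \<le> n \<Longrightarrow> 0 < c n" and c_mono: "mono_on {1..} c"
    and \<kappa>: "0 < \<kappa>" and \<alpha>: "0 < \<alpha>"
    and char_limit: "uniform_limit {-T..T} (\<lambda>n t. cmod (char F (t / c n)) ^ n)
      (\<lambda>t. exp (- (\<kappa> * \<bar>t\<bar> powr \<alpha>))) sequentially"
    and char_less_1: "t \<noteq> 0 \<Longrightarrow> cmod (char F t) < 1"
begin

lemma c_le: "1 \<le> m \<Longrightarrow> m \<le> n \<Longrightarrow> c m \<le> c n"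
  using c_mono by (auto simp: mono_on_def)

text \<open>Put \<open>r n = c n / c (2 * n)\<close>. The number
  \<open>cmod (char F (1 / c (2 * n))) ^ (2 * n)\<close> tends to \<open>exp (- \<kappa>)\<close>,
  while its square root is the n-th power at the frequency \<open>r n / c n\<close>, hence close to
  \<open>exp (- (\<kappa> * r n powr \<alpha>))\<close>. So \<open>r n powr \<alpha>\<close> tends
  to \<open>1 / 2\<close>.\<close>

lemma c_double_limit: "(\<lambda>n. c (2 * n) / c n) \<longlonglongrightarrow> 2 powr (1 / \<alpha>)"
proof -
  define r where "r n = c n / c (2 * n)" for n
  \<comment> \<open>Monotonicity of \<open>c\<close> keeps \<open>r n\<close> inside
    \<open>[-1, 1]\<close>, where the limit is uniform.\<close>
  have r: "eventually (\<lambda>n. 0 < r n \<and> r n \<le> 1) sequentially"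
    using eventually_ge_at_top[of 1]
    by eventually_elim (auto simp: r_def c_pos c_le divide_le_eq_1_pos)
  define v where "v n = cmod (char F (r n / c n)) ^ n" for n
  have 1: "(\<lambda>n. v n - exp (- (\<kappa> * \<bar>r n\<bar> powr \<alpha>))) \<longlonglongrightarrow> 0"
    unfolding v_def using r by (intro uniform_limit_eval[OF char_limit[of 1]]) (auto elim: eventually_mono)
  have "(\<lambda>n. cmod (char F (1 / c n)) ^ n - exp (- (\<kappa> * \<bar>1\<bar> powr \<alpha>))) \<longlonglongrightarrow> 0"
    by (intro uniform_limit_eval[OF char_limit[of 1]]) auto
  then have "(\<lambda>n. cmod (char F (1 / c n)) ^ n) \<longlonglongrightarrow> exp (- \<kappa>)"
    by (simp add: LIM_zero_iff)
  then have "(\<lambda>n. cmod (char F (1 / c (2 * n))) ^ (2 * n)) \<longlonglongrightarrow> exp (- \<kappa>)"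
    by (rule LIMSEQ_subseq_LIMSEQ[unfolded comp_def, where f = "(*) 2"]) (simp add: strict_mono_def)
  then have "(\<lambda>n. sqrt (cmod (char F (1 / c (2 * n))) ^ (2 * n))) \<longlonglongrightarrow> sqrt (exp (- \<kappa>))"
    by (intro tendsto_real_sqrt)
  also have "sqrt (exp (- \<kappa>)) = exp (- (\<kappa> / 2))"
    by (rule real_sqrt_unique) (simp_all add: power2_eq_square exp_add[symmetric])
  also have "(\<lambda>n. sqrt (cmod (char F (1 / c (2 * n))) ^ (2 * n))) \<longlonglongrightarrow> exp (- (\<kappa> / 2)) \<longleftrightarrow> v \<longlonglongrightarrow> exp (- (\<kappa> / 2))"
  proof (rule tendsto_cong)
    show "\<forall>\<^sub>F n in sequentially. sqrt (cmod (char F (1 / c (2 * n))) ^ (2 * n)) = v n"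
      using eventually_ge_at_top[of 1]
    proof eventually_elim
      case (elim n)
      then have "r n / c n = 1 / c (2 * n)" using c_pos[of n] by (simp add: r_def)
      moreover have "sqrt (x ^ (2 * n)) = x ^ n" if "0 \<le> x" for x :: real
        using that by (simp add: mult.commute[of 2] power_mult)
      ultimately show ?case by (simp add: v_def)
    qed
  qed
  finally have "(\<lambda>n. v n - (v n - exp (- (\<kappa> * \<bar>r n\<bar> powr \<alpha>)))) \<longlonglongrightarrow> exp (- (\<kappa> / 2)) - 0"
    by (rule tendsto_diff[OF _ 1])
  then have "(\<lambda>n. exp (- (\<kappa> * \<bar>r n\<bar> powr \<alpha>))) \<longlonglongrightarrow> exp (- (\<kappa> / 2))" by simp
  then have "(\<lambda>n. ln (exp (- (\<kappa> * \<bar>r n\<bar> powr \<alpha>)))) \<longlonglongrightarrow> ln (exp (- (\<kappa> / 2)))"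
    by (intro tendsto_ln) auto
  then have "(\<lambda>n. - (\<kappa> * \<bar>r n\<bar> powr \<alpha>) / - \<kappa>) \<longlonglongrightarrow> - (\<kappa> / 2) / - \<kappa>"
    using \<kappa> by (intro tendsto_divide tendsto_const) auto
  then have "(\<lambda>n. \<bar>r n\<bar> powr \<alpha>) \<longlonglongrightarrow> 1 / 2" using \<kappa> by simp
  then have "(\<lambda>n. (\<bar>r n\<bar> powr \<alpha>) powr (- (1 / \<alpha>))) \<longlonglongrightarrow> (1 / 2) powr (- (1 / \<alpha>))"
    by (intro tendsto_powr tendsto_const) auto
  also have "(1 / 2) powr (- (1 / \<alpha>)) = 2 powr (1 / \<alpha>)"
    by (simp add: powr_minus powr_divide)
  also have "(\<lambda>n. (\<bar>r n\<bar> powr \<alpha>) powr (- (1 / \<alpha>))) \<longlonglongrightarrow> 2 powr (1 / \<alpha>)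
    \<longleftrightarrow> (\<lambda>n. c (2 * n) / c n) \<longlonglongrightarrow> 2 powr (1 / \<alpha>)"
  proof (rule tendsto_cong)
    show "\<forall>\<^sub>F n in sequentially. (\<bar>r n\<bar> powr \<alpha>) powr (- (1 / \<alpha>)) = c (2 * n) / c n"
      using r
    proof eventually_elim
      case (elim n)
      then have "(\<bar>r n\<bar> powr \<alpha>) powr (- (1 / \<alpha>)) = 1 / r n"
        using \<alpha> by (simp add: powr_powr powr_minus_divide)
      then show ?case by (simp add: r_def)
    qed
  qed
  finally show ?thesis .
qed

lemma c_double_bounds:
  obtains b B N where "1 < b" "b \<le> B" "1 \<le> N"
    "\<And>n. N \<le> n \<Longrightarrow> b * c n \<le> c (2 * n)" "\<And>n. N \<le> n \<Longrightarrow> c (2 * n) \<le> B * c n"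
proof -
  define L where "L = 2 powr (1 / \<alpha>)"
  have L: "1 < L" using \<alpha> by (simp add: L_def gr_one_powr)
  have "\<forall>\<^sub>F n in sequentially. (1 + L) / 2 < c (2 * n) / c n" "\<forall>\<^sub>F n in sequentially. c (2 * n) / c n < L + 1"
    by (intro order_tendstoD[OF c_double_limit[folded L_def]]; use L in simp)+
  then have "\<forall>\<^sub>F n in sequentially. 1 \<le> n \<and> (1 + L) / 2 < c (2 * n) / c n \<and> c (2 * n) / c n < L + 1"
    using eventually_ge_at_top[of 1] by eventually_elim auto
  then obtain N where N: "\<And>n. N \<le> n \<Longrightarrow> 1 \<le> n \<and> (1 + L) / 2 < c (2 * n) / c n \<and> c (2 * n) / c n < L + 1"
    by (auto simp: eventually_sequentially)
  show ?thesis
  proof (rule that[of "(1 + L) / 2" "L + 1" N])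
    fix n assume "N \<le> n"
    from N[OF this] c_pos[of n]
    show "(1 + L) / 2 * c n \<le> c (2 * n)" "c (2 * n) \<le> (L + 1) * c n"
      by (auto simp: pos_less_divide_eq pos_divide_less_eq)
  qed (use L N[of N] in auto)
qed

text \<open>The doubling factor \<open>b > 1\<close> is iterated until \<open>b ^ i\<close> exceeds
  \<open>R\<close>; the multiplier \<open>A\<close> is then \<open>2 ^ i\<close>, for all
  \<open>j\<close> at once.\<close>

lemma c_growth:
  obtains N where "1 \<le> N" "\<And>R. \<exists>A\<ge>1. \<forall>j\<ge>N. \<forall>n\<ge>A * j. R * c j \<le> c n"
proof -
  obtain b B N where b: "1 < b" and N: "1 \<le> N" and bN: "\<And>n. N \<le> n \<Longrightarrow> b * c n \<le> c (2 * n)"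
    using c_double_bounds by metis
  have pow: "b ^ i * c j \<le> c (2 ^ i * j)" if "N \<le> j" for i j
  proof (induction i)
    case (Suc i)
    have "b ^ Suc i * c j = b * (b ^ i * c j)" by simp
    also have "\<dots> \<le> b * c (2 ^ i * j)" using Suc b by (intro mult_left_mono) auto
    also have "\<dots> \<le> c (2 * (2 ^ i * j))"
      by (rule bN) (use that N in \<open>metis One_nat_def le_trans mult.commute mult_le_mono2 mult.right_neutral one_le_numeral one_le_power\<close>)
    finally show ?case by (simp add: mult.assoc)
  qed simp
  show ?thesis
  proof (rule that[OF N])
    fix R
    obtain i where i: "R < b ^ i" using b real_arch_pow by blast
    have "R * c j \<le> c n" if "N \<le> j" "2 ^ i * j \<le> n" for j n
    proof -
      have "R * c j \<le> b ^ i * c j" using i c_pos[of j] that N by (intro mult_right_mono) auto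
      also have "\<dots> \<le> c (2 ^ i * j)" by (rule pow) fact
      also have "\<dots> \<le> c n" using that N by (intro c_le) auto
      finally show ?thesis .
    qed
    then show "\<exists>A\<ge>1. \<forall>j\<ge>N. \<forall>n\<ge>A * j. R * c j \<le> c n" by (intro exI[of _ "2 ^ i"]) auto
  qed
qed

lemma c_at_top: "filterlim c at_top sequentially"
proof -
  obtain N where N: "1 \<le> N" and g: "\<And>R. \<exists>A\<ge>1. \<forall>j\<ge>N. \<forall>n\<ge>A * j. R * c j \<le> c n"
    using c_growth by metis
  show ?thesis unfolding filterlim_at_top eventually_sequentially
  proof
    fix Z
    obtain A where "\<forall>n\<ge>A * N. Z / c N * c N \<le> c n" using g by blast
    then show "\<exists>M. \<forall>n\<ge>M. Z \<le> c n" using c_pos[OF N] by auto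
  qed
qed

text \<open>The upper half of a Potter bound: iterating the doubling bound \<open>B\<close> over
  \<open>log 2 (n / j)\<close> dyadic steps produces the power \<open>p = log 2 B\<close>. Rounding
  up the number of steps costs one more factor \<open>B\<close>, which is the constant
  \<open>K\<close>.\<close>

lemma c_potter:
  obtains N K p where "1 \<le> N" "0 < K" "0 < p"
    "\<And>n. N \<le> n \<Longrightarrow> c (2 * n) \<le> K * c n"
    "\<And>j n. N \<le> j \<Longrightarrow> j \<le> n \<Longrightarrow> c n \<le> K * (real n / real j) powr p * c j"
proof -
  obtain b B N where b: "1 < b" "b \<le> B" and N: "1 \<le> N" and BN: "\<And>n. N \<le> n \<Longrightarrow> c (2 * n) \<le> B * c n"
    using c_double_bounds by metis
  define p where "p = log 2 B"
  have B: "1 < B" using b by simp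
  have p: "0 < p" using B by (simp add: p_def)
  have Bp: "B = 2 powr p" using B by (simp add: p_def)
  have pow: "c (2 ^ i * j) \<le> B ^ i * c j" if "N \<le> j" for i j
  proof (induction i)
    case (Suc i)
    have "c (2 ^ Suc i * j) \<le> B * c (2 ^ i * j)"
      unfolding power_Suc mult.assoc
      by (rule BN) (use that N in \<open>metis One_nat_def le_trans mult.commute mult_le_mono2 mult.right_neutral one_le_numeral one_le_power\<close>)
    also have "\<dots> \<le> B * (B ^ i * c j)" using Suc B by (intro mult_left_mono) auto
    finally show ?case by (simp add: mult.assoc)
  qed simp
  show ?thesis
  proof (rule that[of N "B" p])
    fix j n assume j: "N \<le> j" "j \<le> n"
    define i where "i = nat \<lceil>log 2 (real n / real j)\<rceil>"
    have jn: "1 \<le> real n / real j" using j N by simp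
    then have "0 \<le> log 2 (real n / real j)" by simp
    then have i: "log 2 (real n / real j) \<le> real i" "real i \<le> log 2 (real n / real j) + 1"
      unfolding i_def by linarith+
    have "real n / real j = 2 powr (log 2 (real n / real j))" using jn by simp
    also have "\<dots> \<le> 2 powr real i" using i by (intro powr_mono) auto
    finally have "real n \<le> 2 ^ i * real j" using jn j N by (simp add: powr_realpow field_simps)
    then have "real n \<le> real (2 ^ i * j)" by simp
    then have "n \<le> 2 ^ i * j" by (simp only: of_nat_le_iff)
    then have "c n \<le> c (2 ^ i * j)" using j N by (intro c_le) auto
    also have "\<dots> \<le> B ^ i * c j" using j by (intro pow)
    also have "B ^ i = (2 powr real i) powr p"
      using B by (simp add: Bp powr_powr powr_realpow[symmetric] mult.commute)
    also have "\<dots> \<le> (2 powr (log 2 (real n / real j) + 1)) powr p"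
      using i p by (intro powr_mono2 powr_mono) auto
    also have "2 powr (log 2 (real n / real j) + 1) = 2 * (real n / real j)"
      using jn by (simp add: powr_add)
    also have "(2 * (real n / real j)) powr p = B * (real n / real j) powr p"
      unfolding Bp using jn by (intro powr_mult) 
    finally show "c n \<le> B * (real n / real j) powr p * c j"
      using c_pos[of j] j N by (simp add: mult_right_mono)
  qed (use N p B BN in auto)
qed

text \<open>A small frequency \<open>s\<close> has its own time \<open>j\<close> with
  \<open>\<bar>s\<bar> * c j\<close> between \<open>1 / K\<close> and 1, at which the uniform limit
  keeps \<open>cmod (char F s) ^ j\<close> away from 1. The \<open>n\<close> steps contain about
  \<open>n / j\<close> such blocks, and the Potter bound makes \<open>n / j\<close> at least a
  multiple of a power of \<open>\<bar>s\<bar> * c n\<close>.\<close>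

lemma cmod_char_power_le:
  obtains N r \<theta> \<gamma> where "1 \<le> N" "0 < r" "0 < \<theta>" "0 < \<gamma>"
    "\<And>n s. N \<le> n \<Longrightarrow> \<bar>s\<bar> \<le> r \<Longrightarrow> 1 \<le> \<bar>s\<bar> * c n \<Longrightarrow>
      cmod (char F s) ^ n \<le> exp (- (\<theta> * (\<bar>s\<bar> * c n) powr \<gamma>))"
proof -
  obtain N K p where N: "1 \<le> N" and K: "0 < K" and p: "0 < p"
    and double: "\<And>n. N \<le> n \<Longrightarrow> c (2 * n) \<le> K * c n"
    and potter: "\<And>j n. N \<le> j \<Longrightarrow> j \<le> n \<Longrightarrow> c n \<le> K * (real n / real j) powr p * c j"
    using c_potter by metis
  \<comment> \<open>The largest value of the limit on
    \<open>1 / K \<le> \<bar>t\<bar> \<le> 1\<close>; \<open>q'\<close> lies halfway between it and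
    1, leaving room for the convergence error.\<close>
  define q where "q = exp (- (\<kappa> * (1 / K) powr \<alpha>))"
  have q: "0 < q" "q < 1" using \<kappa> K by (auto simp: q_def)
  define q' where "q' = (1 + q) / 2"
  have q': "0 < q'" "q' < 1" using q by (auto simp: q'_def)
  define \<theta>0 where "\<theta>0 = - ln q'"
  have \<theta>0: "0 < \<theta>0" using q' by (simp add: \<theta>0_def)
  have "0 < (1 - q) / 2" using q by simp
  from uniform_limitD[OF char_limit[of 1] this] obtain N0 where
    N0: "\<And>n t. N0 \<le> n \<Longrightarrow> t \<in> {-1..1} \<Longrightarrow>
      \<bar>cmod (char F (t / c n)) ^ n - exp (- (\<kappa> * \<bar>t\<bar> powr \<alpha>))\<bar> < (1 - q) / 2"
    unfolding eventually_sequentially dist_real_def by blast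
  define N1 where "N1 = max N N0"
  have N1: "1 \<le> N1" "N \<le> N1" "N0 \<le> N1" using N by (auto simp: N1_def)
  have block: "cmod (char F s) ^ j \<le> q'" if j: "N1 \<le> j" and s: "1 / K \<le> \<bar>s\<bar> * c j" "\<bar>s\<bar> * c j \<le> 1" for s j
  proof -
    have cj: "0 < c j" using j N1 by (intro c_pos) auto
    have abs_t: "\<bar>s * c j\<bar> = \<bar>s\<bar> * c j" using cj by (simp add: abs_mult)
    have "\<bar>cmod (char F (s * c j / c j)) ^ j - exp (- (\<kappa> * \<bar>s * c j\<bar> powr \<alpha>))\<bar> < (1 - q) / 2"
      using s abs_t j N1 by (intro N0) (auto simp: abs_le_iff)
    moreover have "exp (- (\<kappa> * \<bar>s * c j\<bar> powr \<alpha>)) \<le> q"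
      unfolding q_def abs_t using s \<kappa> K \<alpha> by (auto intro!: powr_mono2)
    moreover have "s * c j / c j = s" using cj by simp
    ultimately have "\<bar>cmod (char F s) ^ j - exp (- (\<kappa> * \<bar>s * c j\<bar> powr \<alpha>))\<bar> < (1 - q) / 2"
      "exp (- (\<kappa> * \<bar>s * c j\<bar> powr \<alpha>)) \<le> q" by simp_all
    then show ?thesis unfolding q'_def by argo
  qed
  show ?thesis
  proof (rule that[of N1 "1 / c N1" "\<theta>0 / 2 * (1 / K) powr (1 / p)" "1 / p"])
    fix n s assume n: "N1 \<le> n" and s: "\<bar>s\<bar> \<le> 1 / c N1" and sn: "1 \<le> \<bar>s\<bar> * c n"
    have s0: "0 < \<bar>s\<bar>" using sn by (cases "s = 0") auto
    \<comment> \<open>\<open>Max J\<close> is the last time up to \<open>n\<close> at which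
      \<open>\<bar>s\<bar> * c j\<close> has not passed 1; the restriction on
      \<open>\<bar>s\<bar>\<close> puts \<open>N1\<close> into \<open>J\<close>.\<close>
    define J where "J = {j. N1 \<le> j \<and> j \<le> n \<and> \<bar>s\<bar> * c j \<le> 1}"
    have fin: "finite J" unfolding J_def by (rule finite_subset[of _ "{..n}"]) auto
    have "N1 \<in> J" using n s c_pos[OF N1(1)] by (auto simp: J_def field_simps)
    then have jJ: "Max J \<in> J" using fin by (intro Max_in) auto
    define j where "j = Max J"
    have j: "N1 \<le> j" "j \<le> n" "\<bar>s\<bar> * c j \<le> 1" using jJ by (auto simp: j_def J_def)
    have j1: "1 \<le> j" using j N1 by simp
    have cj: "0 < c j" using j1 by (rule c_pos)
    have "1 / K \<le> \<bar>s\<bar> * c j"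
    proof -
      \<comment> \<open>By maximality the value at \<open>Suc j \<le> 2 * j\<close> already exceeds
        1 unless \<open>j = n\<close>; one doubling step then bounds the value at \<open>j\<close>
        from below.\<close>
      have "1 \<le> \<bar>s\<bar> * c (2 * j)"
      proof (cases "j = n")
        case True
        have "\<bar>s\<bar> * c n \<le> \<bar>s\<bar> * c (2 * j)" using True j1 by (intro mult_left_mono c_le) auto
        then show ?thesis using sn by simp
      next
        case False
        have "Suc j \<notin> J" using Max_ge[OF fin, of "Suc j"] by (auto simp: j_def)
        then have "1 < \<bar>s\<bar> * c (Suc j)" using False j by (auto simp: J_def)
        also have "\<dots> \<le> \<bar>s\<bar> * c (2 * j)" using j1 by (intro mult_left_mono c_le) auto
        finally show ?thesis by simp
      qed
      also have "\<dots> \<le> \<bar>s\<bar> * (K * c j)" using j N1 by (intro mult_left_mono double) auto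
      finally show ?thesis using K by (simp add: field_simps)
    qed
    from block[OF j(1) this j(3)] have bl: "cmod (char F s) ^ j \<le> q'" .
    define d where "d = n div j"
    have "cmod (char F s) ^ n \<le> cmod (char F s) ^ (j * d)"
      by (intro power_decreasing cmod_char_le_1) (auto simp: d_def)
    also have "\<dots> \<le> q' ^ d" unfolding power_mult using bl by (intro power_mono) auto
    also have "\<dots> = exp (- \<theta>0 * real d)"
      using q' by (simp add: \<theta>0_def mult.commute[of "ln q'"] exp_of_nat_mult)
    also have "\<dots> \<le> exp (- (\<theta>0 / 2 * (real n / real j)))"
    proof -
      \<comment> \<open>Rounding \<open>n / j\<close> down to a positive integer loses at most a
        factor 2.\<close>
      have "1 \<le> d" using j j1 by (simp add: d_def div_greater_zero_iff Suc_le_eq)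
      have "n < j * (d + 1)" using dividend_less_times_div[of j n] j1 by (simp add: d_def)
      then have "real n < real (j * (d + 1))" by (simp only: of_nat_less_iff)
      then have "real n / real j < real d + 1" using j1 by (simp add: pos_divide_less_eq algebra_simps)
      then have "real n / real j / 2 \<le> real d" proof -
        have "x < real d + 1 \<Longrightarrow> x / 2 \<le> real d" for x using \<open>1 \<le> d\<close> by simp
        then show ?thesis using \<open>real n / real j < real d + 1\<close> .
      qed
      then have "\<theta>0 * (real n / real j / 2) \<le> \<theta>0 * real d" using \<theta>0 by (intro mult_left_mono) auto
      then show ?thesis by simp
    qed
    also have "\<dots> \<le> exp (- (\<theta>0 / 2 * (1 / K) powr (1 / p) * (\<bar>s\<bar> * c n) powr (1 / p)))"
    proof -
      have "\<bar>s\<bar> * c n \<le> \<bar>s\<bar> * (K * (real n / real j) powr p * c j)"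
        using j N1 by (intro mult_left_mono potter) auto
      also have "\<dots> = (\<bar>s\<bar> * c j) * (K * (real n / real j) powr p)" by simp
      also have "\<dots> \<le> 1 * (K * (real n / real j) powr p)" using j K by (intro mult_right_mono) auto
      finally have "1 / K * (\<bar>s\<bar> * c n) \<le> (real n / real j) powr p" using K by (simp add: field_simps)
      then have "(1 / K * (\<bar>s\<bar> * c n)) powr (1 / p) \<le> ((real n / real j) powr p) powr (1 / p)"
        using K p sn by (intro powr_mono2) auto
      also have "\<dots> = real n / real j" using p by (simp add: powr_powr)
      finally have "(1 / K) powr (1 / p) * (\<bar>s\<bar> * c n) powr (1 / p) \<le> real n / real j"
        using K sn by (subst powr_mult[symmetric]) auto
      then have "\<theta>0 / 2 * ((1 / K) powr (1 / p) * (\<bar>s\<bar> * c n) powr (1 / p)) \<le> \<theta>0 / 2 * (real n / real j)"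
        using \<theta>0 by (intro mult_left_mono) auto
      then show ?thesis by (simp add: mult.assoc)
    qed
    finally show "cmod (char F s) ^ n \<le> exp (- (\<theta>0 / 2 * (1 / K) powr (1 / p) * (\<bar>s\<bar> * c n) powr (1 / p)))" .
  qed (use N1 c_pos[OF N1(1)] \<theta>0 K p in auto)
qed

text \<open>Compactness of the two bands and continuity make the pointwise strict bound uniform. The
  halfway value keeps \<open>q\<close> positive even if the maximum is 0.\<close>

lemma char_off_origin_le:
  assumes r: "0 < r"
  obtains q where "0 < q" "q < 1" "\<And>t. r \<le> \<bar>t\<bar> \<Longrightarrow> \<bar>t\<bar> \<le> a \<Longrightarrow> cmod (char F t) \<le> q"
proof (cases "r \<le> a")
  case True
  define S where "S = {-a..-r} \<union> {r..a}"
  have "compact S" "S \<noteq> {}" using True r by (auto simp: S_def)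
  moreover have "continuous_on S (\<lambda>t. cmod (char F t))"
    by (intro continuous_on_norm continuous_at_imp_continuous_on ballI isCont_char)
  ultimately obtain m where m: "m \<in> S" "\<And>t. t \<in> S \<Longrightarrow> cmod (char F t) \<le> cmod (char F m)"
    using continuous_attains_sup[of S "\<lambda>t. cmod (char F t)"] by auto
  have "cmod (char F m) < 1" using m r by (intro char_less_1) (auto simp: S_def)
  show ?thesis
  proof (rule that[of "(1 + cmod (char F m)) / 2"])
    fix t assume "r \<le> \<bar>t\<bar>" "\<bar>t\<bar> \<le> a"
    then have "cmod (char F t) \<le> cmod (char F m)" by (intro m) (auto simp: S_def)
    then show "cmod (char F t) \<le> (1 + cmod (char F m)) / 2" using \<open>cmod (char F m) < 1\<close> by simp
  qed (use \<open>cmod (char F m) < 1\<close> in \<open>auto simp: add_pos_nonneg\<close>)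
next
  case False
  show ?thesis by (rule that[of "1/2"]) (use False in auto)
qed

text \<open>The Potter bound from a fixed time shows that \<open>c n\<close> grows at most
  polynomially, which a geometric factor beats. The right-hand side is scaled for an integral over a
  band of length \<open>2 * a\<close>, which then contributes \<open>1 / c n\<close>.\<close>

lemma c_poly_times_geometric:
  assumes \<epsilon>: "0 < \<epsilon>" and a: "0 < a" and q: "0 < q" "q < 1"
  shows "\<forall>\<^sub>F n in sequentially. c n * (1 + a * c n) * q powr (\<epsilon> * real n) \<le> 1 / (2 * a)"
proof -
  obtain N K p where N: "1 \<le> N" and K: "0 < K" and p: "0 < p"
    and potter: "\<And>j n. N \<le> j \<Longrightarrow> j \<le> n \<Longrightarrow> c n \<le> K * (real n / real j) powr p * c j"
    using c_potter by metis
  define H where "H = K * (1 / real N) powr p * c N"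
  have H: "0 < H" using K c_pos[OF N] N by (simp add: H_def)
  define d where "d = - \<epsilon> * ln q"
  have d: "0 < d" using \<epsilon> q by (simp add: d_def mult_less_0_iff)
  have "((\<lambda>n. H * real n powr p * (1 + a * (H * real n powr p)) * exp (- (d * real n))) \<longlongrightarrow> 0) sequentially"
    using H a p d by real_asymp
  then have "\<forall>\<^sub>F n in sequentially. H * real n powr p * (1 + a * (H * real n powr p)) * exp (- (d * real n)) < 1 / (2 * a)"
    by (rule order_tendstoD) (use a in simp)
  then show ?thesis using eventually_ge_at_top[of N]
  proof eventually_elim
    case (elim n)
    have cn: "c n \<le> H * real n powr p"
      using potter[of N n] elim N by (simp add: H_def powr_divide mult_ac)
    have c0: "0 < c n" using elim N by (intro c_pos) auto
    have "c n * (1 + a * c n) * q powr (\<epsilon> * real n) = c n * (1 + a * c n) * exp (- (d * real n))"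
      using q by (simp add: powr_def d_def mult_ac)
    also have "\<dots> \<le> H * real n powr p * (1 + a * (H * real n powr p)) * exp (- (d * real n))"
      using cn c0 a H by (intro mult_mono add_left_mono mult_left_mono) (auto intro!: add_nonneg_nonneg mult_nonneg_nonneg)
    finally show ?case using elim by simp
  qed
qed

text \<open>Frequencies up to \<open>r\<close> are governed, after rescaling by \<open>c n\<close>,
  by a stretched exponential whose integral is of order \<open>1 / c n\<close>; the others are
  exponentially small in \<open>n\<close>. \<open>C\<close> is fixed before \<open>a\<close>: a
  wider band only delays the \<open>n\<close> from which the bound holds.\<close>

lemma weighted_char_power_bound:
  assumes \<epsilon>: "0 < \<epsilon>"
  shows "\<exists>C>0. \<forall>a>0. \<forall>\<^sub>F n in sequentially. \<forall>k. \<epsilon> * real n \<le> real k \<longrightarrow>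
    (\<integral>t. indicator {-a..a} t * ((1 + \<bar>t\<bar> * c n) * cmod (char F t) ^ k) \<partial>lborel) \<le> C / c n"
proof -
  obtain N r \<theta> \<gamma> where N: "1 \<le> N" and r: "0 < r" and \<theta>: "0 < \<theta>" and \<gamma>: "0 < \<gamma>"
    and dom: "\<And>n s. N \<le> n \<Longrightarrow> \<bar>s\<bar> \<le> r \<Longrightarrow> 1 \<le> \<bar>s\<bar> * c n \<Longrightarrow>
      cmod (char F s) ^ n \<le> exp (- (\<theta> * (\<bar>s\<bar> * c n) powr \<gamma>))"
    using cmod_char_power_le by metis
  have "0 < \<theta> * \<epsilon>" using \<theta> \<epsilon> by simp
  from bounded_poly_times_stretched_exp[OF this \<gamma>] obtain D where D: "0 \<le> D"
    "\<And>u. 0 \<le> u \<Longrightarrow> (1 + u) * (1 + u\<^sup>2) * exp (- (\<theta> * \<epsilon> * u powr \<gamma>)) \<le> D"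
    by auto
  \<comment> \<open>The added 4 covers \<open>u < 1\<close>, where
    \<open>2 * (1 + u\<^sup>2) \<le> 4\<close> replaces the stretched exponential.\<close>
  define E where "E = D + 4"
  \<comment> \<open>Passes from the n-th power to the k-th power for
    \<open>k \<ge> \<epsilon> * n\<close>. A vanishing value is treated apart, with
    \<open>k > 0\<close> ensured by \<open>\<epsilon> * n > 0\<close>.\<close>
  have pw: "cmod (char F t) ^ k \<le> b powr \<epsilon>"
    if b: "cmod (char F t) ^ n \<le> b" "0 < b" "b \<le> 1" and k: "\<epsilon> * real n \<le> real k" and n: "1 \<le> n" for t k n b
  proof (cases "char F t = 0")
    case True
    have "0 < \<epsilon> * real n" using \<epsilon> n by simp
    then have "0 < k" using k by (cases k) auto
    then show ?thesis using True by (simp add: zero_power)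
  next
    case False
    have "cmod (char F t) ^ k = cmod (char F t) powr real k" using False by (simp add: powr_realpow)
    also have "\<dots> \<le> cmod (char F t) powr (\<epsilon> * real n)"
      using k by (intro powr_mono' cmod_char_le_1) auto
    also have "\<dots> = (cmod (char F t) ^ n) powr \<epsilon>"
      using False by (simp add: powr_realpow[symmetric] powr_powr mult.commute)
    also have "\<dots> \<le> b powr \<epsilon>" using b \<epsilon> by (intro powr_mono2) auto
    finally show ?thesis .
  qed
  show ?thesis
  proof (intro exI[of _ "E * cauchy_mass + 1"] conjI allI impI)
    show "0 < E * cauchy_mass + 1" using D cauchy_mass_nonneg by (simp add: E_def add_nonneg_pos)
    fix a :: real assume a: "0 < a"
    obtain q where q: "0 < q" "q < 1" "\<And>t. r \<le> \<bar>t\<bar> \<Longrightarrow> \<bar>t\<bar> \<le> a \<Longrightarrow> cmod (char F t) \<le> q"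
      using char_off_origin_le[OF r] by metis
    show "\<forall>\<^sub>F n in sequentially. \<forall>k. \<epsilon> * real n \<le> real k \<longrightarrow>
      (\<integral>t. indicator {-a..a} t * ((1 + \<bar>t\<bar> * c n) * cmod (char F t) ^ k) \<partial>lborel) \<le> (E * cauchy_mass + 1) / c n"
      using c_poly_times_geometric[OF \<epsilon> a q(1,2)] eventually_ge_at_top[of N]
    proof eventually_elim
      case (elim n)
      have cn: "0 < c n" using elim N by (intro c_pos) auto
      show ?case
      proof (intro allI impI)
        fix k assume k: "\<epsilon> * real n \<le> real k"
        have c_int: "integrable lborel (\<lambda>t. 1 / (1 + (t * c n)\<^sup>2))"
          "(\<integral>t. 1 / (1 + (t * c n)\<^sup>2) \<partial>lborel) = cauchy_mass / c n"
          using lborel_integrable_real_affine[OF integrable_cauchy_kernel, of "c n" 0]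
            lborel_integral_real_affine[of "c n" "\<lambda>x. 1 / (1 + x\<^sup>2)" 0] cn
          by (simp_all add: cauchy_mass_def mult.commute)
        have i_int: "integrable lborel (\<lambda>t. indicator {-a..a} t * (1 / (2 * a * c n)))"
          by (intro integrable_mult_left integrable_real_indicator) (auto simp: emeasure_lborel_Icc_eq)
        have "(\<integral>t. indicator {-a..a} t * ((1 + \<bar>t\<bar> * c n) * cmod (char F t) ^ k) \<partial>lborel)
          \<le> (\<integral>t. E * (1 / (1 + (t * c n)\<^sup>2)) + indicator {-a..a} t * (1 / (2 * a * c n)) \<partial>lborel)"
        proof (rule integral_mono')
          show "integrable lborel (\<lambda>t. E * (1 / (1 + (t * c n)\<^sup>2)) + indicator {-a..a} t * (1 / (2 * a * c n)))"
            by (intro Bochner_Integration.integrable_add integrable_mult_right c_int i_int)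
          fix t :: real
          have E0: "0 \<le> E * (1 / (1 + (t * c n)\<^sup>2))" "0 \<le> indicator {-a..a} t * (1 / (2 * a * c n))"
            using D a cn by (auto simp: E_def add_nonneg_nonneg)
          then show "0 \<le> E * (1 / (1 + (t * c n)\<^sup>2)) + indicator {-a..a} t * (1 / (2 * a * c n))"
            by simp
          show "indicator {-a..a} t * ((1 + \<bar>t\<bar> * c n) * cmod (char F t) ^ k)
            \<le> E * (1 / (1 + (t * c n)\<^sup>2)) + indicator {-a..a} t * (1 / (2 * a * c n))"
          proof (cases "\<bar>t\<bar> \<le> a")
            case ta: True
            define u where "u = \<bar>t\<bar> * c n"
            have u: "0 \<le> u" "(t * c n)\<^sup>2 = u\<^sup>2" using cn by (auto simp: u_def power_mult_distrib)
            have den: "0 < 1 + u\<^sup>2" by (simp add: add_pos_nonneg)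
            have near: "(1 + u) * cmod (char F t) ^ k \<le> E * (1 / (1 + u\<^sup>2))" if "\<bar>t\<bar> \<le> r \<or> u < 1"
            proof (cases "u < 1")
              case True
              have "(1 + u) * cmod (char F t) ^ k \<le> 2 * 1"
                using True u by (intro mult_mono power_le_one cmod_char_le_1) auto
              also have "2 * 1 \<le> E * (1 / (1 + u\<^sup>2))"
              proof -
                have "u\<^sup>2 \<le> 1" using True u by (intro power_le_one) auto
                then have "2 * (1 + u\<^sup>2) \<le> E" using D by (simp add: E_def)
                then show ?thesis using den by (simp add: pos_le_divide_eq)
              qed
              finally show ?thesis .
            next
              case False
              then have "cmod (char F t) ^ n \<le> exp (- (\<theta> * u powr \<gamma>))"
                using that elim unfolding u_def by (intro dom) auto
              then have "cmod (char F t) ^ k \<le> exp (- (\<theta> * u powr \<gamma>)) powr \<epsilon>"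
                using k elim N \<theta> by (intro pw[of t n _ k]) auto
              also have "\<dots> = exp (- (\<theta> * \<epsilon> * u powr \<gamma>))"
                by (simp add: powr_def mult_ac)
              finally have "(1 + u) * cmod (char F t) ^ k \<le> (1 + u) * exp (- (\<theta> * \<epsilon> * u powr \<gamma>))"
                using u by (intro mult_left_mono) auto
              also have "\<dots> \<le> D * (1 / (1 + u\<^sup>2))"
                using D(2)[OF u(1)] den by (simp add: pos_le_divide_eq mult_ac)
              also have "\<dots> \<le> E * (1 / (1 + u\<^sup>2))"
                using den by (intro mult_right_mono) (auto simp: E_def)
              finally show ?thesis .
            qed
            have far: "(1 + u) * cmod (char F t) ^ k \<le> 1 / (2 * a * c n)" if "r \<le> \<bar>t\<bar>"
            proof -
              have "cmod (char F t) ^ k \<le> (q ^ n) powr \<epsilon>"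
                using k elim N q(1,2) q(3)[OF that ta] by (intro pw[of t n _ k] power_mono) (auto simp: power_le_one)
              also have "(q ^ n) powr \<epsilon> = q powr (\<epsilon> * real n)"
                using q by (simp add: powr_realpow[symmetric] powr_powr mult.commute)
              finally have "(1 + u) * cmod (char F t) ^ k \<le> (1 + a * c n) * q powr (\<epsilon> * real n)"
                using u ta cn a by (intro mult_mono) (auto simp: u_def)
              also have "\<dots> \<le> 1 / (2 * a) / c n"
                using elim(1) cn by (subst pos_le_divide_eq) (simp_all add: mult_ac)
              finally show ?thesis by simp
            qed
            have "(1 + u) * cmod (char F t) ^ k
              \<le> E * (1 / (1 + u\<^sup>2)) + indicator {-a..a} t * (1 / (2 * a * c n))"
            proof (cases "\<bar>t\<bar> \<le> r")
              case True
              with near E0 u show ?thesis by simp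
            next
              case False
              then have "(1 + u) * cmod (char F t) ^ k \<le> 1 / (2 * a * c n)" by (intro far) simp
              moreover have "indicator {-a..a} t = (1::real)" using ta by (auto simp: indicator_def)
              ultimately show ?thesis using E0(1) u by simp
            qed
            then show ?thesis using ta u unfolding u_def[symmetric] by (auto simp: indicator_def)
          next
            case False
            then have "indicator {-a..a} t = (0::real)" by (auto simp: indicator_def)
            then show ?thesis using E0 by simp
          qed
        qed
        also have "\<dots> = E * (cauchy_mass / c n) + 2 * a * (1 / (2 * a * c n))"
          using a by (subst Bochner_Integration.integral_add[OF integrable_mult_right[OF c_int(1)] i_int])
            (simp only: Bochner_Integration.integral_mult_right_zero c_int, simp)
        also have "\<dots> = (E * cauchy_mass + 1) / c n"
          using a cn by (simp add: add_divide_distrib)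
        finally show "(\<integral>t. indicator {-a..a} t * ((1 + \<bar>t\<bar> * c n) * cmod (char F t) ^ k) \<partial>lborel)
          \<le> (E * cauchy_mass + 1) / c n" .
      qed
    qed
  qed
qed

end

section \<open>Walks with independent steps\<close>

text \<open>Formulated for every law with characteristic function \<open>char F t ^ k\<close>, so
  that it applies to the sum over any block of \<open>k\<close> steps. The window length only
  affects the band \<open>1 / L\<close> and hence the threshold, leaving \<open>C\<close> free of
  \<open>L\<close>.\<close>

lemma (in attracted_law) window_concentration:
  assumes \<epsilon>: "0 < \<epsilon>"
  shows "\<exists>C>0. \<forall>L>0. \<forall>\<^sub>F n in sequentially. \<forall>k \<mu> x. \<epsilon> * real n \<le> real k \<longrightarrow>
    real_distribution \<mu> \<longrightarrow> (\<forall>t. char \<mu> t = char F t ^ k) \<longrightarrow> measure \<mu> {x..<x + L} \<le> C * L / c n"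
proof -
  obtain C where C: "0 < C" "\<And>a. 0 < a \<Longrightarrow> \<forall>\<^sub>F n in sequentially. \<forall>k. \<epsilon> * real n \<le> real k \<longrightarrow>
    (\<integral>t. indicator {-a..a} t * ((1 + \<bar>t\<bar> * c n) * cmod (char F t) ^ k) \<partial>lborel) \<le> C / c n"
    using weighted_char_power_bound[OF \<epsilon>] by blast
  show ?thesis
  proof (intro exI[of _ "2 * C"] conjI allI impI)
    fix L :: real assume L: "0 < L"
    have "0 < 1 / L" using L by simp
    from C(2)[OF this] eventually_ge_at_top[of 1]
    show "\<forall>\<^sub>F n in sequentially. \<forall>k \<mu> x. \<epsilon> * real n \<le> real k \<longrightarrow>
      real_distribution \<mu> \<longrightarrow> (\<forall>t. char \<mu> t = char F t ^ k) \<longrightarrow> measure \<mu> {x..<x + L} \<le> 2 * C * L / c n"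
    proof eventually_elim
      case (elim n)
      have cn: "0 < c n" using elim by (intro c_pos) auto
      show ?case
      proof (intro allI impI)
        fix k \<mu> x
        assume k: "\<epsilon> * real n \<le> real k" and "real_distribution \<mu>" and ch: "\<forall>t. char \<mu> t = char F t ^ k"
        interpret \<mu>: real_distribution \<mu> by fact
        have "\<mu>.weighted_char_mass (c n) (1 / L) \<le> C / c n"
          unfolding \<mu>.weighted_char_mass_def using elim k ch by (simp add: norm_power)
        then have "2 * L * \<mu>.weighted_char_mass (c n) (1 / L) \<le> 2 * L * (C / c n)"
          using L by (intro mult_left_mono) auto
        with \<mu>.prob_window_le[OF L less_imp_le[OF cn], of x] show "measure \<mu> {x..<x + L} \<le> 2 * C * L / c n"
          by (simp add: mult_ac)
      qed
    qed
  qed (use C in simp)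
qed

text \<open>\<open>C\<close> precedes \<open>\<eta>\<close>: the residual error is made small by
  widening the band, which leaves the constant of the weighted bound unchanged.\<close>

lemma (in attracted_law) window_equicontinuous:
  assumes \<epsilon>: "0 < \<epsilon>" and L: "0 < L"
  shows "\<exists>C>0. \<forall>\<eta>>0. \<forall>\<^sub>F n in sequentially. \<forall>k \<mu> x y. \<epsilon> * real n \<le> real k \<longrightarrow>
    real_distribution \<mu> \<longrightarrow> (\<forall>t. char \<mu> t = char F t ^ k) \<longrightarrow>
    \<bar>measure \<mu> {x..<x + L} - measure \<mu> {y..<y + L}\<bar> \<le> (C * \<bar>x - y\<bar> / c n + \<eta>) / c n"
proof -
  obtain C where C: "0 < C" "\<And>a. 0 < a \<Longrightarrow> \<forall>\<^sub>F n in sequentially. \<forall>k. \<epsilon> * real n \<le> real k \<longrightarrow>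
    (\<integral>t. indicator {-a..a} t * ((1 + \<bar>t\<bar> * c n) * cmod (char F t) ^ k) \<partial>lborel) \<le> C / c n"
    using weighted_char_power_bound[OF \<epsilon>] by blast
  show ?thesis
  proof (intro exI[of _ "C * (L / fejer_mass)"] conjI allI impI)
    fix \<eta> :: real assume \<eta>: "0 < \<eta>"
    then have "0 < \<eta> / C" using C by simp
    from window_equicontinuity[OF L this] obtain a where a: "1 \<le> a" and
      W: "\<forall>\<mu> c C' x y. real_distribution \<mu> \<longrightarrow> 0 < c \<longrightarrow>
        real_distribution.weighted_char_mass \<mu> c a \<le> C' / c \<longrightarrow>
        \<bar>measure \<mu> {x..<x + L} - measure \<mu> {y..<y + L}\<bar> \<le> C' / c * (L / fejer_mass * \<bar>x - y\<bar> / c + \<eta> / C)"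
      by blast
    have "0 < a" using a by simp
    from C(2)[OF this] eventually_ge_at_top[of 1]
    show "\<forall>\<^sub>F n in sequentially. \<forall>k \<mu> x y. \<epsilon> * real n \<le> real k \<longrightarrow>
      real_distribution \<mu> \<longrightarrow> (\<forall>t. char \<mu> t = char F t ^ k) \<longrightarrow>
      \<bar>measure \<mu> {x..<x + L} - measure \<mu> {y..<y + L}\<bar> \<le> (C * (L / fejer_mass) * \<bar>x - y\<bar> / c n + \<eta>) / c n"
    proof eventually_elim
      case (elim n)
      have cn: "0 < c n" using elim by (intro c_pos) auto
      show ?case
      proof (intro allI impI)
        fix k \<mu> x y
        assume k: "\<epsilon> * real n \<le> real k" and \<mu>: "real_distribution \<mu>" and ch: "\<forall>t. char \<mu> t = char F t ^ k"
        interpret \<mu>: real_distribution \<mu> by fact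
        have "\<mu>.weighted_char_mass (c n) a \<le> C / c n"
          unfolding \<mu>.weighted_char_mass_def using elim k ch by (simp add: norm_power)
        with W \<mu> cn have "\<bar>measure \<mu> {x..<x + L} - measure \<mu> {y..<y + L}\<bar>
          \<le> C / c n * (L / fejer_mass * \<bar>x - y\<bar> / c n + \<eta> / C)" by blast
        also have "\<dots> = (C * (L / fejer_mass) * \<bar>x - y\<bar> / c n + \<eta>) / c n"
          using C by (simp add: add_divide_distrib distrib_left mult_ac)
        finally show "\<bar>measure \<mu> {x..<x + L} - measure \<mu> {y..<y + L}\<bar>
          \<le> (C * (L / fejer_mass) * \<bar>x - y\<bar> / c n + \<eta>) / c n" .
      qed
    qed
  qed (use C L fejer_mass_pos in simp)
qed

section \<open>Independence of disjoint blocks of steps\<close>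

locale iid_walk = prob_space M for M :: "'a measure" +
  fixes X :: "nat \<Rightarrow> 'a \<Rightarrow> real" and F :: "real measure"
  assumes indep: "indep_vars (\<lambda>_. borel) X {1..}"
    and law: "1 \<le> i \<Longrightarrow> distr M borel (X i) = F"
begin

lemma step_measurable [measurable (raw)]: "1 \<le> i \<Longrightarrow> X i \<in> borel_measurable M"
  using indep by (auto simp: indep_vars_def)

lemma law_real_distribution: "real_distribution F"
  using law[of 1] real_distribution_distr[OF step_measurable[of 1]] by simp

definition bsum :: "nat set \<Rightarrow> 'a \<Rightarrow> real" where "bsum I \<omega> = (\<Sum>i\<in>I. X i \<omega>)"

text \<open>The sigma-algebra of the steps with index in \<open>I\<close>, encoded by preimages
  under the vector of these steps, so that independence over disjoint index sets is that of two
  restricted vectors.\<close>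

definition block_algebra :: "nat set \<Rightarrow> 'a measure" where
  "block_algebra I = vimage_algebra (space M) (\<lambda>\<omega>. restrict (\<lambda>i. X i \<omega>) I) (PiM I (\<lambda>_. borel))"

lemma space_block_algebra [simp]: "space (block_algebra I) = space M"
  by (simp add: block_algebra_def)

lemma sets_block_algebra:
  "sets (block_algebra I) = {(\<lambda>\<omega>. restrict (\<lambda>i. X i \<omega>) I) -` A \<inter> space M | A. A \<in> sets (PiM I (\<lambda>_. borel))}"
  unfolding block_algebra_def by (rule sets_vimage_algebra2) (auto simp: space_PiM)

lemma step_measurable_block: "i \<in> I \<Longrightarrow> X i \<in> borel_measurable (block_algebra I)"
proof -
  assume i: "i \<in> I"
  have "(\<lambda>\<omega>. restrict (\<lambda>i. X i \<omega>) I) \<in> measurable (block_algebra I) (PiM I (\<lambda>_. borel))"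
    unfolding block_algebra_def by (rule measurable_vimage_algebra1) (auto simp: space_PiM)
  from measurable_compose[OF this measurable_component_singleton[OF i]]
  show ?thesis using i by simp
qed

lemma bsum_measurable_block: "J \<subseteq> I \<Longrightarrow> bsum J \<in> borel_measurable (block_algebra I)"
  unfolding bsum_def by (intro borel_measurable_sum step_measurable_block) auto

lemma bsum_measurable: "J \<subseteq> {1..} \<Longrightarrow> bsum J \<in> borel_measurable M"
  unfolding bsum_def by (intro borel_measurable_sum step_measurable) auto

lemma block_algebra_subset_events:
  assumes "I \<subseteq> {1..}" shows "sets (block_algebra I) \<subseteq> events"
proof
  fix E assume "E \<in> sets (block_algebra I)"
  then obtain A where A: "E = (\<lambda>\<omega>. restrict (\<lambda>i. X i \<omega>) I) -` A \<inter> space M" "A \<in> sets (PiM I (\<lambda>_. borel))"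
    by (auto simp: sets_block_algebra)
  have "(\<lambda>\<omega>. restrict (\<lambda>i. X i \<omega>) I) \<in> measurable M (PiM I (\<lambda>_. borel))"
    using assms by (intro measurable_restrict step_measurable) auto
  from measurable_sets[OF this A(2)] show "E \<in> events" using A(1) by simp
qed

lemma block_algebra_mono:
  assumes "I \<subseteq> J" shows "sets (block_algebra I) \<subseteq> sets (block_algebra J)"
proof
  fix E assume "E \<in> sets (block_algebra I)"
  then obtain A where A: "E = (\<lambda>\<omega>. restrict (\<lambda>i. X i \<omega>) I) -` A \<inter> space M" "A \<in> sets (PiM I (\<lambda>_. borel))"
    by (auto simp: sets_block_algebra)
  have "(\<lambda>\<omega>. restrict (\<lambda>i. X i \<omega>) I) \<in> measurable (block_algebra J) (PiM I (\<lambda>_. borel))"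
    using assms by (intro measurable_restrict step_measurable_block) auto
  from measurable_sets[OF this A(2)] show "E \<in> sets (block_algebra J)" using A(1) by simp
qed

lemma block_indep:
  assumes IJ: "I \<inter> J = {}" "I \<subseteq> {1..}" "J \<subseteq> {1..}"
    and A: "A \<in> sets (block_algebra I)" and B: "B \<in> sets (block_algebra J)"
  shows "prob (A \<inter> B) = prob A * prob B"
proof -
  let ?V = "\<lambda>I \<omega>. restrict (\<lambda>i. X i \<omega>) I"
  obtain A' B' where A': "A = ?V I -` A' \<inter> space M" "A' \<in> sets (PiM I (\<lambda>_. borel))"
    and B': "B = ?V J -` B' \<inter> space M" "B' \<in> sets (PiM J (\<lambda>_. borel))"
    using A B by (auto simp: sets_block_algebra)
  have "indep_var (PiM I (\<lambda>_. borel)) (?V I) (PiM J (\<lambda>_. borel)) (?V J)"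
    by (rule indep_var_restrict[OF indep IJ])
  note indep_varD[OF this A'(2) B'(2)]
  moreover have "A \<inter> B = (\<lambda>\<omega>. (?V I \<omega>, ?V J \<omega>)) -` (A' \<times> B') \<inter> space M"
    unfolding A' B' by blast
  ultimately show ?thesis unfolding A' B' by simp
qed

text \<open>Conditioning on the steps in \<open>I\<close>: the outcome, seen through
  \<open>block_algebra I\<close>, and \<open>bsum J\<close> have a product law, so Fubini replaces
  the window event by the probability of a window whose position \<open>h\<close> is frozen.\<close>

lemma block_smoothing_integral:
  assumes IJ: "I \<inter> J = {}" "I \<subseteq> {1..}" "J \<subseteq> {1..}"
    and A: "A \<in> sets (block_algebra I)" and h: "h \<in> borel_measurable (block_algebra I)"
  shows "prob (A \<inter> {\<omega> \<in> space M. bsum J \<omega> \<in> {h \<omega>..<h \<omega> + L}}) =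
    (\<integral>\<omega>. indicator A \<omega> * measure (distr M borel (bsum J)) {h \<omega>..<h \<omega> + L} \<partial>M)"
    and "integrable M (\<lambda>\<omega>. indicator A \<omega> * measure (distr M borel (bsum J)) {h \<omega>..<h \<omega> + L})"
proof -
  let ?G = "block_algebra I" and ?D = "distr M borel (bsum J)"
  \<comment> \<open>The identity into the coarser sigma-algebra serves as the random element
    carrying all information about the steps in \<open>I\<close>.\<close>
  have id: "(\<lambda>\<omega>. \<omega>) \<in> measurable M ?G"
    using block_algebra_subset_events[OF IJ(2)] by (auto intro!: measurableI)
  have bJ [measurable]: "bsum J \<in> borel_measurable M" using IJ by (intro bsum_measurable)
  have bJ': "bsum J \<in> borel_measurable (block_algebra J)" by (rule bsum_measurable_block) simp
  let ?P = "distr M ?G (\<lambda>\<omega>. \<omega>)"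
  interpret P: prob_space ?P by (rule prob_space_distr[OF id])
  interpret D: prob_space ?D by (rule prob_space_distr[OF bJ])
  interpret PD: pair_prob_space ?P ?D ..
  have pair: "(\<lambda>\<omega>. (\<omega>, bsum J \<omega>)) \<in> measurable M (?G \<Otimes>\<^sub>M borel)"
    using id bJ by (intro measurable_Pair) auto
  have joint: "?P \<Otimes>\<^sub>M ?D = distr M (?G \<Otimes>\<^sub>M borel) (\<lambda>\<omega>. (\<omega>, bsum J \<omega>))"
  proof (rule pair_measure_eqI)
    show "sigma_finite_measure ?P" "sigma_finite_measure ?D" by unfold_locales
    show "sets (?P \<Otimes>\<^sub>M ?D) = sets (distr M (?G \<Otimes>\<^sub>M borel) (\<lambda>\<omega>. (\<omega>, bsum J \<omega>)))"
      by (simp cong: sets_pair_measure_cong)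
    fix E B assume E: "E \<in> sets ?P" and B: "B \<in> sets ?D"
    have E': "E \<in> sets ?G" "E \<inter> space M = E" "E \<in> events"
      using E sets.sets_into_space[of E ?G] block_algebra_subset_events[OF IJ(2)] by auto
    have B': "bsum J -` B \<inter> space M \<in> sets (block_algebra J)"
      using B measurable_sets[OF bJ', of B] by simp
    have "emeasure ?P E * emeasure ?D B = emeasure M E * emeasure M (bsum J -` B \<inter> space M)"
      using E' B by (simp add: emeasure_distr[OF id] emeasure_distr[OF bJ] vimage_def Int_commute)
    also have "\<dots> = emeasure M (E \<inter> (bsum J -` B \<inter> space M))"
      using block_indep[OF IJ E'(1) B'] by (simp add: emeasure_eq_measure ennreal_mult)
    also have "E \<inter> (bsum J -` B \<inter> space M) = (\<lambda>\<omega>. (\<omega>, bsum J \<omega>)) -` (E \<times> B) \<inter> space M"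
      using E'(2) by auto
    also have "emeasure M \<dots> = emeasure (distr M (?G \<Otimes>\<^sub>M borel) (\<lambda>\<omega>. (\<omega>, bsum J \<omega>))) (E \<times> B)"
      using E' B by (intro emeasure_distr[OF pair, symmetric]) auto
    finally show "emeasure ?P E * emeasure ?D B = emeasure (distr M (?G \<Otimes>\<^sub>M borel) (\<lambda>\<omega>. (\<omega>, bsum J \<omega>))) (E \<times> B)" .
  qed
  note [measurable] = A h
  define S where "S = {p \<in> space (?G \<Otimes>\<^sub>M borel). fst p \<in> A \<and> h (fst p) \<le> snd p \<and> snd p < h (fst p) + L}"
  have S: "S \<in> sets (?G \<Otimes>\<^sub>M borel)" unfolding S_def by measurable
  then have S': "S \<in> sets (?P \<Otimes>\<^sub>M ?D)" by (simp cong: sets_pair_measure_cong)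
  have AM: "A \<subseteq> space M" using sets.sets_into_space[OF A] by simp
  have intS: "integrable (?P \<Otimes>\<^sub>M ?D) (indicator S :: _ \<Rightarrow> real)"
    using S' by (intro integrable_real_indicator) (auto simp: PD.emeasure_eq_measure)
  have inner: "(\<integral>d. indicator S (\<omega>, d) \<partial>?D) = indicator A \<omega> * measure ?D {h \<omega>..<h \<omega> + L}"
    if "\<omega> \<in> space M" for \<omega>
  proof -
    have "(\<lambda>d. indicator S (\<omega>, d) :: real) = (\<lambda>d. indicator A \<omega> * indicator {h \<omega>..<h \<omega> + L} d)"
      using that by (auto simp: S_def indicator_def space_pair_measure fun_eq_iff)
    then show ?thesis by simp
  qed
  have "prob (A \<inter> {\<omega> \<in> space M. bsum J \<omega> \<in> {h \<omega>..<h \<omega> + L}}) = measure (?P \<Otimes>\<^sub>M ?D) S"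
    unfolding joint using AM by (subst measure_distr[OF pair S])
      (auto intro!: arg_cong[where f = prob] simp: S_def space_pair_measure)
  also have "\<dots> = (\<integral>p. indicator S p \<partial>(?P \<Otimes>\<^sub>M ?D))" using S' by simp
  also have "\<dots> = (\<integral>\<omega>. (\<integral>d. indicator S (\<omega>, d) \<partial>?D) \<partial>?P)"
    by (rule PD.integral_fst'[OF intS, symmetric])
  also have "\<dots> = (\<integral>\<omega>. indicator A \<omega> * measure ?D {h \<omega>..<h \<omega> + L} \<partial>?P)"
    by (intro Bochner_Integration.integral_cong refl inner) simp
  finally have eq: "prob (A \<inter> {\<omega> \<in> space M. bsum J \<omega> \<in> {h \<omega>..<h \<omega> + L}})
    = (\<integral>\<omega>. indicator A \<omega> * measure ?D {h \<omega>..<h \<omega> + L} \<partial>?P)" .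
  have int: "integrable ?P (\<lambda>\<omega>. indicator A \<omega> * measure ?D {h \<omega>..<h \<omega> + L})"
  proof -
    have "integrable ?P (\<lambda>\<omega>. (\<integral>d. indicator S (\<omega>, d) \<partial>?D) :: real)" by (rule PD.integrable_fst'[OF intS])
    then show ?thesis
      by (rule Bochner_Integration.integrable_cong[THEN iffD1, rotated 2]) (auto simp: inner)
  qed
  then have m: "(\<lambda>\<omega>. indicator A \<omega> * measure ?D {h \<omega>..<h \<omega> + L}) \<in> borel_measurable ?G" by simp
  show "prob (A \<inter> {\<omega> \<in> space M. bsum J \<omega> \<in> {h \<omega>..<h \<omega> + L}}) =
    (\<integral>\<omega>. indicator A \<omega> * measure ?D {h \<omega>..<h \<omega> + L} \<partial>M)"
    unfolding eq by (rule integral_distr[OF id m])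
  show "integrable M (\<lambda>\<omega>. indicator A \<omega> * measure ?D {h \<omega>..<h \<omega> + L})"
    using int by (simp add: integrable_distr_eq[OF id m])
qed

text \<open>Retaining the factor \<open>prob A\<close> is what later makes the errors relative to
  the survival probability.\<close>

lemma block_smoothing_le:
  assumes IJ: "I \<inter> J = {}" "I \<subseteq> {1..}" "J \<subseteq> {1..}"
    and A: "A \<in> sets (block_algebra I)" and h: "h \<in> borel_measurable (block_algebra I)"
    and Q: "\<And>x. measure (distr M borel (bsum J)) {x..<x + L} \<le> Q"
  shows "prob (A \<inter> {\<omega> \<in> space M. bsum J \<omega> \<in> {h \<omega>..<h \<omega> + L}}) \<le> prob A * Q"
proof -
  have AM: "A \<in> events" using A block_algebra_subset_events[OF IJ(2)] by auto
  have "(\<integral>\<omega>. indicator A \<omega> * measure (distr M borel (bsum J)) {h \<omega>..<h \<omega> + L} \<partial>M)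
    \<le> (\<integral>\<omega>. indicator A \<omega> * Q \<partial>M)"
    by (intro Bochner_Integration.integral_mono block_smoothing_integral[OF IJ A h]
        integrable_mult_left integrable_real_indicator AM mult_left_mono Q) (auto simp: emeasure_eq_measure)
  also have "\<dots> = prob A * Q" using AM by simp
  finally show ?thesis unfolding block_smoothing_integral(1)[OF IJ A h] .
qed

lemma block_smoothing_diff_le:
  assumes IJ: "I \<inter> J = {}" "I \<subseteq> {1..}" "J \<subseteq> {1..}"
    and A: "A \<in> sets (block_algebra I)"
    and h: "h \<in> borel_measurable (block_algebra I)" and h': "h' \<in> borel_measurable (block_algebra I)"
    and Q: "\<And>\<omega>. \<bar>measure (distr M borel (bsum J)) {h \<omega>..<h \<omega> + L}
      - measure (distr M borel (bsum J)) {h' \<omega>..<h' \<omega> + L}\<bar> \<le> Q"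
  shows "\<bar>prob (A \<inter> {\<omega> \<in> space M. bsum J \<omega> \<in> {h \<omega>..<h \<omega> + L}})
    - prob (A \<inter> {\<omega> \<in> space M. bsum J \<omega> \<in> {h' \<omega>..<h' \<omega> + L}})\<bar> \<le> prob A * Q"
proof -
  let ?f = "\<lambda>h \<omega>. indicator A \<omega> * measure (distr M borel (bsum J)) {h \<omega>..<h \<omega> + L}"
  have AM: "A \<in> events" using A block_algebra_subset_events[OF IJ(2)] by auto
  note int = block_smoothing_integral(2)[OF IJ A h, of L] block_smoothing_integral(2)[OF IJ A h', of L]
  have "\<bar>(\<integral>\<omega>. ?f h \<omega> \<partial>M) - (\<integral>\<omega>. ?f h' \<omega> \<partial>M)\<bar> = \<bar>\<integral>\<omega>. ?f h \<omega> - ?f h' \<omega> \<partial>M\<bar>"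
    using int by simp
  also have "\<dots> \<le> (\<integral>\<omega>. \<bar>?f h \<omega> - ?f h' \<omega>\<bar> \<partial>M)" by (rule integral_abs_bound)
  also have "\<dots> \<le> (\<integral>\<omega>. indicator A \<omega> * Q \<partial>M)"
  proof (rule Bochner_Integration.integral_mono)
    show "integrable M (\<lambda>\<omega>. \<bar>?f h \<omega> - ?f h' \<omega>\<bar>)"
      by (intro integrable_abs Bochner_Integration.integrable_diff int)
    show "integrable M (\<lambda>\<omega>. indicator A \<omega> * Q)"
      using AM by (intro integrable_mult_left integrable_real_indicator) (auto simp: emeasure_eq_measure)
    fix \<omega> show "\<bar>?f h \<omega> - ?f h' \<omega>\<bar> \<le> indicator A \<omega> * Q"
      using Q[of \<omega>] by (cases "\<omega> \<in> A") auto
  qed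
  also have "\<dots> = prob A * Q" using AM by simp
  finally show ?thesis
    unfolding block_smoothing_integral(1)[OF IJ A h] block_smoothing_integral(1)[OF IJ A h'] .
qed

lemma char_bsum:
  assumes "finite J" "J \<subseteq> {1..}"
  shows "char (distr M borel (bsum J)) t = char F t ^ card J"
proof -
  have "char (distr M borel (\<lambda>\<omega>. \<Sum>i\<in>J. X i \<omega>)) t = (\<Prod>i\<in>J. char (distr M borel (X i)) t)"
    by (rule char_distr_sum[OF indep_vars_subset[OF indep assms(2)]])
  also have "\<dots> = (\<Prod>i\<in>J. char F t)"
    using assms law by (intro prod.cong refl) (metis atLeast_iff subset_iff)
  finally show ?thesis by (simp add: bsum_def[abs_def])
qed

lemma walk_eq_bsum: "walk X n = bsum {1..n}"
  by (auto simp: walk_def bsum_def)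

lemma bsum_distribution:
  assumes "J \<subseteq> {1..}" shows "real_distribution (distr M borel (bsum J))"
  using bsum_measurable[OF assms] by (rule real_distribution_distr)

lemma distr_bsum_eq_walk:
  assumes "finite J" "J \<subseteq> {1..}"
  shows "distr M borel (bsum J) = distr M borel (walk X (card J))"
  unfolding walk_eq_bsum using assms
  by (intro Levy_uniqueness bsum_distribution) (auto simp: char_bsum fun_eq_iff)

lemma prob_bsum_eq_walk:
  assumes "finite J" "J \<subseteq> {1..}" "B \<in> sets borel"
  shows "prob {\<omega> \<in> space M. bsum J \<omega> \<in> B} = prob {\<omega> \<in> space M. walk X (card J) \<omega> \<in> B}"
proof -
  have "measure (distr M borel (bsum J)) B = measure (distr M borel (walk X (card J))) B"
    using distr_bsum_eq_walk assms by simp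
  then show ?thesis
    using assms bsum_measurable[of J] bsum_measurable[of "{1..card J}"]
    by (simp add: measure_distr walk_eq_bsum vimage_def Int_def conj_commute)
qed

text \<open>Reversal and shift of a path are both injective renumberings of the steps, so this one
  fact covers them.\<close>

lemma reindex:
  assumes \<sigma>: "inj_on \<sigma> {1..}" "\<sigma> ` {1..} \<subseteq> {1..}"
  shows "iid_walk M (\<lambda>i. X (\<sigma> i)) F"
proof unfold_locales
  show "distr M borel (X (\<sigma> i)) = F" if "1 \<le> i" for i using that \<sigma> by (intro law) auto
  let ?G = "\<lambda>i. {X i -` A \<inter> space M |A. A \<in> sets borel}"
  have rv: "\<forall>i\<in>{1..}. X (\<sigma> i) \<in> borel_measurable M" using \<sigma> by (auto intro!: step_measurable)
  have ind: "indep_sets ?G {1..}" using indep by (simp add: indep_vars_def2)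
  have "indep_sets (\<lambda>i. ?G (\<sigma> i)) {1..}"
  proof (rule indep_setsI)
    show "?G (\<sigma> i) \<subseteq> events" if "i \<in> {1..}" for i using rv that by (auto intro: measurable_sets)
    fix A J assume J: "J \<noteq> {}" "J \<subseteq> {1..}" "finite J" and A: "\<forall>j\<in>J. A j \<in> ?G (\<sigma> j)"
    have inj: "inj_on \<sigma> J" using J \<sigma> by (auto intro: inj_on_subset)
    define A' where "A' i = A (the_inv_into J \<sigma> i)" for i
    have A': "A' (\<sigma> j) = A j" if "j \<in> J" for j
      using that inj by (simp add: A'_def the_inv_into_f_f)
    have "prob (\<Inter>i\<in>\<sigma> ` J. A' i) = (\<Prod>i\<in>\<sigma> ` J. prob (A' i))"
    proof (rule indep_setsD[OF ind])
      show "\<sigma> ` J \<subseteq> {1..}" using J \<sigma> by blast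
      show "\<forall>i\<in>\<sigma> ` J. A' i \<in> ?G i" using A A' by auto
    qed (use J in auto)
    then show "prob (\<Inter>j\<in>J. A j) = (\<Prod>j\<in>J. prob (A j))"
      using A' by (simp add: prod.reindex[OF inj])
  qed
  then show "indep_vars (\<lambda>_. borel) (\<lambda>i. X (\<sigma> i)) {1..}"
    using rv by (simp add: indep_vars_def2)
qed

end

section \<open>Characteristic functions and weak convergence\<close>

text \<open>Mean value bound on a half-plane; the factor \<open>exp m\<close> later absorbs the
  unbounded factor in difference quotients of the Laplace transform.\<close>

lemma norm_exp_diff_le:
  assumes "Re v \<le> m" "Re w \<le> m"
  shows "cmod (exp v - exp w) \<le> exp m * cmod (v - w)"
proof (rule field_differentiable_bound[where S = "{z. Re z \<le> m}"])
  show "convex {z. Re z \<le> m}" by (rule convex_halfspace_Re_le)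
  show "(exp has_field_derivative exp z) (at z within {z. Re z \<le> m})" for z :: complex
    by (rule DERIV_subset[OF DERIV_exp]) simp
qed (use assms in auto)

text \<open>A Skorokhod coupling makes the convergence pointwise; the difference of characteristic
  functions is then at most the mean of
  \<open>min 2 (\<bar>T\<bar> * \<bar>Yn n x - Y x\<bar>)\<close>, a bound free of
  \<open>t\<close>.\<close>

lemma weak_conv_imp_char_uniform:
  assumes \<mu>: "\<And>n. real_distribution (\<mu> n)" and \<nu>: "real_distribution \<nu>" and conv: "weak_conv_m \<mu> \<nu>"
  shows "uniform_limit {-T..T} (\<lambda>n t. char (\<mu> n) t) (char \<nu>) sequentially"
proof -
  obtain \<Omega> :: "real measure" and Yn :: "nat \<Rightarrow> real \<Rightarrow> real" and Y where \<Omega>: "prob_space \<Omega>"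
    and Yn [measurable]: "\<And>n. Yn n \<in> borel_measurable \<Omega>" and Yn_d: "\<And>n. distr \<Omega> borel (Yn n) = \<mu> n"
    and Y: "Y \<in> measurable \<Omega> lborel" and Y_d: "distr \<Omega> borel Y = \<nu>"
    and lim: "\<And>x. x \<in> space \<Omega> \<Longrightarrow> (\<lambda>n. Yn n x) \<longlonglongrightarrow> Y x"
    using Skorohod[OF \<mu> \<nu> conv] by blast
  interpret prob_space \<Omega> by fact
  have Y' [measurable]: "Y \<in> borel_measurable \<Omega>" using Y by simp
  define d where "d n = expectation (\<lambda>x. min 2 (\<bar>T\<bar> * \<bar>Yn n x - Y x\<bar>))" for n
  have "d \<longlonglongrightarrow> expectation (\<lambda>x. 0)"
    unfolding d_def
  proof (rule integral_dominated_convergence[where w = "\<lambda>_. 2"])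
    show "AE x in \<Omega>. (\<lambda>n. min 2 (\<bar>T\<bar> * \<bar>Yn n x - Y x\<bar>)) \<longlonglongrightarrow> 0"
    proof (intro AE_I2)
      fix x assume "x \<in> space \<Omega>"
      then have "(\<lambda>n. \<bar>Yn n x - Y x\<bar>) \<longlonglongrightarrow> 0"
        using lim by (intro tendsto_rabs_zero) (simp add: LIM_zero)
      then have "(\<lambda>n. min 2 (\<bar>T\<bar> * \<bar>Yn n x - Y x\<bar>)) \<longlonglongrightarrow> min 2 (\<bar>T\<bar> * 0)"
        by (intro tendsto_intros)
      then show "(\<lambda>n. min 2 (\<bar>T\<bar> * \<bar>Yn n x - Y x\<bar>)) \<longlonglongrightarrow> 0" by simp
    qed
  qed auto
  then have d0: "d \<longlonglongrightarrow> 0" by simp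
  have bd: "cmod (char (\<mu> n) t - char \<nu> t) \<le> d n" if t: "\<bar>t\<bar> \<le> \<bar>T\<bar>" for n t
  proof -
    have int: "integrable \<Omega> (\<lambda>x. iexp (t * Yn n x))" "integrable \<Omega> (\<lambda>x. iexp (t * Y x))"
      by (intro integrable_iexp; simp)+
    have "char (\<mu> n) t - char \<nu> t = (CLINT x|\<Omega>. iexp (t * Yn n x) - iexp (t * Y x))"
      using int unfolding Yn_d[symmetric] Y_d[symmetric] char_def
      by (subst (1 2) integral_distr) auto
    also have "cmod \<dots> \<le> (\<integral>x. cmod (iexp (t * Yn n x) - iexp (t * Y x)) \<partial>\<Omega>)"
      by (rule integral_norm_bound)
    also have "\<dots> \<le> d n" unfolding d_def
    proof (rule Bochner_Integration.integral_mono)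
      show "integrable \<Omega> (\<lambda>x. cmod (iexp (t * Yn n x) - iexp (t * Y x)))"
        using int by (intro integrable_norm Bochner_Integration.integrable_diff)
      show "integrable \<Omega> (\<lambda>x. min 2 (\<bar>T\<bar> * \<bar>Yn n x - Y x\<bar>))"
        by (rule integrable_const_bound[where B = 2]) auto
      fix x
      have "cmod (iexp (t * Yn n x) - iexp (t * Y x)) \<le> \<bar>t * Yn n x - t * Y x\<bar>" 
        by (rule norm_iexp_diff_le)
      also have "\<dots> = \<bar>t\<bar> * \<bar>Yn n x - Y x\<bar>" by (simp add: abs_mult[symmetric] right_diff_distrib)
      also have "\<dots> \<le> \<bar>T\<bar> * \<bar>Yn n x - Y x\<bar>" using t by (intro mult_right_mono) auto
      finally have "cmod (iexp (t * Yn n x) - iexp (t * Y x)) \<le> \<bar>T\<bar> * \<bar>Yn n x - Y x\<bar>" .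
      moreover have "cmod (iexp (t * Yn n x) - iexp (t * Y x)) \<le> 1 + 1"
        by (rule order_trans[OF norm_triangle_ineq4]) (simp del: of_real_mult)
      ultimately show "cmod (iexp (t * Yn n x) - iexp (t * Y x)) \<le> min 2 (\<bar>T\<bar> * \<bar>Yn n x - Y x\<bar>)" by simp
    qed
    finally show ?thesis .
  qed
  show ?thesis
  proof (rule uniform_limitI)
    fix e :: real assume "0 < e"
    with d0 have "\<forall>\<^sub>F n in sequentially. d n < e" by (rule order_tendstoD)
    then show "\<forall>\<^sub>F n in sequentially. \<forall>t\<in>{-T..T}. dist (char (\<mu> n) t) (char \<nu> t) < e"
    proof eventually_elim
      case (elim n)
      show ?case
      proof
        fix t assume "t \<in> {-T..T}"
        then have "\<bar>t\<bar> \<le> \<bar>T\<bar>" by auto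
        from bd[OF this, of n] elim show "dist (char (\<mu> n) t) (char \<nu> t) < e" by (simp add: dist_norm)
      qed
    qed
  qed
qed

lemma cmod_stable_char: "cmod (stable_char \<kappa> \<alpha> \<beta> t) = exp (- (\<kappa> * \<bar>t\<bar> powr \<alpha>))"
  by (simp add: stable_char_def)

text \<open>If the modulus is 1 with phase \<open>\<theta>\<close>, then
  \<open>cos (t * y - \<theta>)\<close> has mean 1 and so equals 1 almost surely, which confines the
  law to the progression \<open>\<theta> / t + (2 * pi / t) * k\<close>.\<close>

lemma char_less_1_of_non_lattice:
  assumes F: "real_distribution F" and nl: "\<not> lattice_distribution F" and t: "t \<noteq> 0"
  shows "cmod (char F t) < 1"
proof (rule ccontr)
  interpret real_distribution F by fact
  assume "\<not> ?thesis"
  then have 1: "cmod (char F t) = 1" using cmod_char_le_1[of t] by simp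
  then obtain \<theta> where \<theta>: "char F t = iexp \<theta>"
    by (metis complex_norm_eq_1_exp mult.commute)
  have "(\<integral>y. cos (t * (y - \<theta> / t)) \<partial>F) = Re (iexp (- (t * (\<theta> / t))) * char F t)"
    by (rule expectation_cos_eq_char)
  also have "\<dots> = 1" using t unfolding \<theta> by (simp add: exp_add[symmetric])
  finally have c1: "(\<integral>y. cos (t * y - \<theta>) \<partial>F) = 1" using t by (simp add: right_diff_distrib)
  have intc: "integrable F (\<lambda>y. cos (t * y - \<theta>))"
    by (rule integrable_const_bound[where B = 1]) auto
  have "(\<integral>y. 1 - cos (t * y - \<theta>) \<partial>F) = 0"
    using intc c1 prob_space by (subst Bochner_Integration.integral_diff) auto
  then have AE: "AE y in F. 1 - cos (t * y - \<theta>) = 0"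
    using intc by (subst (asm) integral_nonneg_eq_0_iff_AE) auto
  define C where "C = {y. cos (t * y - \<theta>) = 1}"
  have clC: "closed C" unfolding C_def by (intro closed_Collect_eq continuous_intros)
  have "AE y in F. y \<notin> - C" using AE by eventually_elim (simp add: C_def)
  then have m0: "measure F (- C) = 0"
    using clC by (subst measure_eq_AE[where B = "{}"]) auto
  \<comment> \<open>\<open>C\<close> is closed, so its complement is an open null set and contains
    no point of the support.\<close>
  have sub: "distribution_support F \<subseteq> C"
  proof
    fix x assume x: "x \<in> distribution_support F"
    show "x \<in> C"
    proof (rule ccontr)
      assume "x \<notin> C"
      moreover have "open (- C)" using clC by (rule open_Compl)
      ultimately have "0 < measure F (- C)" using x by (auto simp: distribution_support_def)
      then show False using m0 by simp
    qed
  qed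
  define h where "h = 2 * pi / \<bar>t\<bar>"
  have h: "0 < h" using t by (simp add: h_def)
  \<comment> \<open>Reduces the offset \<open>\<theta> / t\<close> modulo \<open>h\<close> into
    \<open>[0, h)\<close>, as the definition of a lattice demands.\<close>
  define m where "m = \<lfloor>\<theta> / t / h\<rfloor>"
  define a where "a = \<theta> / t - of_int m * h"
  have "of_int m \<le> \<theta> / t / h" "\<theta> / t / h < of_int m + 1" unfolding m_def by linarith+
  then have "of_int m * h \<le> \<theta> / t" "\<theta> / t < (of_int m + 1) * h"
    using h by (simp_all only: pos_le_divide_eq pos_divide_less_eq)
  then have a: "a \<in> {0..<h}" by (simp add: a_def algebra_simps)
  have "C \<subseteq> {a + of_int k * h | k :: int. True}"
  proof
    fix y assume "y \<in> C"
    then obtain k :: int where "t * y - \<theta> = of_int k * 2 * pi" by (auto simp: C_def cos_one_2pi_int)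
    then have "t * y = \<theta> + of_int k * 2 * pi" by simp
    then have "y = \<theta> / t + of_int k * (2 * pi / t)" using t by (simp add: field_simps)
    also have "2 * pi / t = sgn t * h" using t by (simp add: h_def sgn_real_def)
    finally have "y = a + of_int (m + (if 0 < t then k else - k)) * h"
      using t by (auto simp: a_def sgn_real_def algebra_simps)
    then show "y \<in> {a + of_int k * h | k :: int. True}" by blast
  qed
  with sub nl h a show False unfolding lattice_distribution_def by blast
qed

text \<open>Nonnegativity turns additivity into monotonicity. Comparing a multiple of
  \<open>u\<close> with the neighbouring integers bounds all large multiples of
  \<open>G u - u * G 1\<close> by \<open>G 1\<close>, so the difference vanishes.\<close>

lemma additive_nonneg_imp_linear:
  fixes G :: "real \<Rightarrow> real"
  assumes add: "\<And>u v. 0 < u \<Longrightarrow> 0 < v \<Longrightarrow> G (u + v) = G u + G v"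
    and nonneg: "\<And>u. 0 < u \<Longrightarrow> 0 \<le> G u" and u: "0 < u"
  shows "G u = u * G 1"
proof -
  have mult: "G (real (Suc n) * v) = real (Suc n) * G v" if "0 < v" for n v
  proof (induction n)
    case (Suc n)
    have "G (real (Suc (Suc n)) * v) = G (real (Suc n) * v + v)" by (simp add: algebra_simps)
    also have "\<dots> = G (real (Suc n) * v) + G v" using that by (intro add) auto
    finally show ?case using Suc by (simp add: algebra_simps)
  qed simp
  have mono: "G v \<le> G w" if "0 < v" "v \<le> w" for v w
  proof (cases "v = w")
    case False
    then have "G w = G v + G (w - v)" using add[of v "w - v"] that by simp
    then show ?thesis using nonneg[of "w - v"] that False by simp
  qed simp
  have bound: "\<bar>real (Suc n) * (G u - u * G 1)\<bar> \<le> G 1" if n: "1 / u \<le> real (Suc n)" for n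
  proof -
    define w where "w = real (Suc n) * u"
    have w1: "1 \<le> w" using n u by (simp add: w_def pos_divide_le_eq)
    define k where "k = nat \<lfloor>w\<rfloor>"
    have k: "1 \<le> k" "real k \<le> w" "w \<le> real (Suc k)" using w1 unfolding k_def by linarith+
    obtain k' where k': "k = Suc k'" using k by (cases k) auto
    have "G (real k) \<le> G w" "G w \<le> G (real (Suc k))" using k by (auto intro!: mono)
    moreover have "G (real k) = real k * G 1" "G (real (Suc k)) = real (Suc k) * G 1"
      using mult[of 1 k'] mult[of 1 k] k' by simp_all
    moreover have "G w = real (Suc n) * G u" unfolding w_def using u by (rule mult)
    moreover have "real k * G 1 \<le> w * G 1" "w * G 1 \<le> real (Suc k) * G 1"
      using k nonneg[of 1] by (auto intro!: mult_right_mono)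
    ultimately have "\<bar>real (Suc n) * G u - w * G 1\<bar> \<le> G 1" by (simp add: algebra_simps abs_le_iff)
    then show ?thesis by (simp add: w_def algebra_simps)
  qed
  show ?thesis
  proof (rule ccontr)
    assume "G u \<noteq> u * G 1"
    then have e: "0 < \<bar>G u - u * G 1\<bar>" by simp
    obtain n :: nat where n: "max (1 / u) (G 1 / \<bar>G u - u * G 1\<bar>) < real n" using reals_Archimedean2 by blast
    then have "G 1 / \<bar>G u - u * G 1\<bar> < real (Suc n)" by simp
    then have "G 1 < real (Suc n) * \<bar>G u - u * G 1\<bar>" using e by (simp add: pos_divide_less_eq)
    moreover have "\<bar>real (Suc n) * (G u - u * G 1)\<bar> \<le> G 1" using n by (intro bound) simp
    ultimately show False by (simp add: abs_mult)
  qed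
qed

section \<open>Positive mass of stable laws\<close>

lemma inverse_Suc_limit: "(\<lambda>n. 1 / real (Suc n)) \<longlonglongrightarrow> 0"
  using LIMSEQ_inverse_real_of_nat by (simp only: inverse_eq_divide)

text \<open>The situation to be refuted: a stable law without mass on the positive half-line, whose
  exponential moments are finite for all nonnegative arguments.\<close>

locale nonpositive_stable = real_distribution \<nu> for \<nu> :: "real measure" +
  fixes \<kappa> \<alpha> \<beta> :: real
  assumes \<kappa>: "0 < \<kappa>" and \<alpha>: "0 < \<alpha>" and char_\<nu>: "char \<nu> t = stable_char \<kappa> \<alpha> \<beta> t"
    and nonpos: "AE x in \<nu>. x \<le> 0"
begin

lemma char_scale_mult:
  assumes "0 < a" "0 < b"
  shows "char \<nu> (a * t) * char \<nu> (b * t) = char \<nu> ((a powr \<alpha> + b powr \<alpha>) powr (1 / \<alpha>) * t)"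
proof -
  define g where "g = (a powr \<alpha> + b powr \<alpha>) powr (1 / \<alpha>)"
  have ab: "0 < a powr \<alpha> + b powr \<alpha>" using assms by (simp add: add_pos_pos)
  then have g: "0 < g" "g powr \<alpha> = a powr \<alpha> + b powr \<alpha>"
    using \<alpha> by (simp_all add: g_def powr_powr)
  have s: "sgn (a * t) = sgn t" "sgn (b * t) = sgn t" "sgn (g * t) = sgn t"
    using assms g by (auto simp: sgn_mult)
  have p: "\<bar>a * t\<bar> powr \<alpha> = a powr \<alpha> * \<bar>t\<bar> powr \<alpha>" "\<bar>b * t\<bar> powr \<alpha> = b powr \<alpha> * \<bar>t\<bar> powr \<alpha>"
    "\<bar>g * t\<bar> powr \<alpha> = (a powr \<alpha> + b powr \<alpha>) * \<bar>t\<bar> powr \<alpha>"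
    using assms g by (simp_all add: abs_mult powr_mult)
  show ?thesis
    unfolding g_def[symmetric] char_\<nu> stable_char_def s p exp_add[symmetric]
    by (rule arg_cong[where f = exp]) (simp add: algebra_simps)
qed

lemma scaled_sum_distr:
  assumes ab: "0 < a" "0 < b"
  shows "distr (\<nu> \<Otimes>\<^sub>M \<nu>) borel (\<lambda>(x, y). a * x + b * y)
    = distr \<nu> borel (\<lambda>x. (a powr \<alpha> + b powr \<alpha>) powr (1 / \<alpha>) * x)"
proof (rule Levy_uniqueness)
  interpret P: pair_prob_space \<nu> \<nu> ..
  show "real_distribution (distr (\<nu> \<Otimes>\<^sub>M \<nu>) borel (\<lambda>(x, y). a * x + b * y))"
    by (rule P.real_distribution_distr) simp
  show "real_distribution (distr \<nu> borel (\<lambda>x. (a powr \<alpha> + b powr \<alpha>) powr (1 / \<alpha>) * x))"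
    by (rule real_distribution_distr) simp
  show "char (distr (\<nu> \<Otimes>\<^sub>M \<nu>) borel (\<lambda>(x, y). a * x + b * y))
    = char (distr \<nu> borel (\<lambda>x. (a powr \<alpha> + b powr \<alpha>) powr (1 / \<alpha>) * x))"
  proof
    fix t
    let ?f = "\<lambda>(x, y). iexp (a * t * x) * iexp (b * t * y)"
    have int: "integrable (\<nu> \<Otimes>\<^sub>M \<nu>) ?f"
      by (rule P.integrable_const_bound[where B = 1]) (auto simp: norm_mult split: prod.split)
    have "char (distr (\<nu> \<Otimes>\<^sub>M \<nu>) borel (\<lambda>(x, y). a * x + b * y)) t = (CLINT p|\<nu> \<Otimes>\<^sub>M \<nu>. ?f p)"
      unfolding char_def
      by (subst integral_distr) (auto intro!: Bochner_Integration.integral_cong simp: exp_add[symmetric] algebra_simps)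
    also have "\<dots> = (CLINT x|\<nu>. CLINT y|\<nu>. iexp (a * t * x) * iexp (b * t * y))"
      using P.integral_fst'[OF int] by simp
    also have "\<dots> = char \<nu> (a * t) * char \<nu> (b * t)"
      unfolding char_def by simp
    also have "\<dots> = char \<nu> ((a powr \<alpha> + b powr \<alpha>) powr (1 / \<alpha>) * t)" by (rule char_scale_mult[OF ab])
    also have "\<dots> = char (distr \<nu> borel (\<lambda>x. (a powr \<alpha> + b powr \<alpha>) powr (1 / \<alpha>) * x)) t"
      unfolding char_def by (subst integral_distr) (auto simp: mult_ac)
    finally show "char (distr (\<nu> \<Otimes>\<^sub>M \<nu>) borel (\<lambda>(x, y). a * x + b * y)) t
      = char (distr \<nu> borel (\<lambda>x. (a powr \<alpha> + b powr \<alpha>) powr (1 / \<alpha>) * x)) t" .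
  qed
qed

definition mgf :: "real \<Rightarrow> real" where "mgf s = (\<integral>x. exp (s * x) \<partial>\<nu>)"

lemma exp_le_1_AE: "0 \<le> s \<Longrightarrow> AE x in \<nu>. exp (s * x) \<le> 1"
  using nonpos by eventually_elim (simp add: mult_nonneg_nonpos)

lemma integrable_exp: "0 \<le> s \<Longrightarrow> integrable \<nu> (\<lambda>x. exp (s * x))"
  by (rule integrable_const_bound[where B = 1]) (use exp_le_1_AE in auto)

lemma nn_integral_exp: "0 \<le> s \<Longrightarrow> (\<integral>\<^sup>+x. ennreal (exp (s * x)) \<partial>\<nu>) = ennreal (mgf s)"
  unfolding mgf_def by (rule nn_integral_eq_integral[OF integrable_exp]) auto

lemma mgf_le_1: "0 \<le> s \<Longrightarrow> mgf s \<le> 1"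
proof -
  assume s: "0 \<le> s"
  have "mgf s \<le> (\<integral>x. 1 \<partial>\<nu>)" unfolding mgf_def
    by (rule integral_mono_AE[OF integrable_exp[OF s] _ exp_le_1_AE[OF s]]) simp
  then show ?thesis using prob_space by simp
qed

lemma mgf_pos: "0 \<le> s \<Longrightarrow> 0 < mgf s"
proof -
  assume s: "0 \<le> s"
  have "mgf s \<noteq> 0"
  proof
    assume "mgf s = 0"
    then have "AE x in \<nu>. exp (s * x) = 0"
      unfolding mgf_def by (subst (asm) integral_nonneg_eq_0_iff_AE[OF integrable_exp[OF s]]) auto
    then show False by simp
  qed
  moreover have "0 \<le> mgf s" unfolding mgf_def by (rule Bochner_Integration.integral_nonneg) simp
  ultimately show ?thesis by simp
qed

text \<open>Stability carried over to the Laplace transform through an equality of laws; with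
  nonnegative integrals Tonelli applies without integrability conditions.\<close>

lemma mgf_scale_mult:
  assumes ab: "0 < a" "0 < b"
  shows "mgf a * mgf b = mgf ((a powr \<alpha> + b powr \<alpha>) powr (1 / \<alpha>))"
proof -
  interpret P: pair_prob_space \<nu> \<nu> ..
  let ?g = "(a powr \<alpha> + b powr \<alpha>) powr (1 / \<alpha>)"
  have "ennreal (mgf a * mgf b) = ennreal (mgf a) * ennreal (mgf b)"
    using mgf_pos[of a] mgf_pos[of b] ab by (intro ennreal_mult) auto
  also have "\<dots> = (\<integral>\<^sup>+x. ennreal (exp (a * x)) * (\<integral>\<^sup>+y. ennreal (exp (b * y)) \<partial>\<nu>) \<partial>\<nu>)"
    using ab by (subst nn_integral_multc) (auto simp: nn_integral_exp)
  also have "\<dots> = (\<integral>\<^sup>+x. (\<integral>\<^sup>+y. ennreal (exp (a * x + b * y)) \<partial>\<nu>) \<partial>\<nu>)"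
    by (subst nn_integral_cmult[symmetric]) (auto simp: exp_add ennreal_mult)
  also have "\<dots> = (\<integral>\<^sup>+p. ennreal (exp (case p of (x, y) \<Rightarrow> a * x + b * y)) \<partial>(\<nu> \<Otimes>\<^sub>M \<nu>))"
    by (subst nn_integral_fst[symmetric]) auto
  also have "\<dots> = (\<integral>\<^sup>+u. ennreal (exp u) \<partial>distr (\<nu> \<Otimes>\<^sub>M \<nu>) borel (\<lambda>(x, y). a * x + b * y))"
    by (subst nn_integral_distr) auto
  also have "\<dots> = (\<integral>\<^sup>+u. ennreal (exp u) \<partial>distr \<nu> borel (\<lambda>x. ?g * x))"
    by (simp only: scaled_sum_distr[OF ab])
  also have "\<dots> = ennreal (mgf ?g)"
    by (subst nn_integral_distr) (auto simp: nn_integral_exp)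
  finally show ?thesis using mgf_pos[of a] mgf_pos[of b] mgf_pos[of ?g] ab by (simp add: ennreal_inj)
qed

text \<open>In the variable \<open>u = s powr \<alpha>\<close> the logarithm of \<open>mgf\<close>
  is additive, and it has a constant sign because \<open>mgf \<le> 1\<close>; Cauchy's functional
  equation leaves only a multiple of \<open>u\<close>.\<close>

lemma mgf_eq: "\<exists>C\<ge>0. \<forall>s>0. mgf s = exp (- (C * s powr \<alpha>))"
proof -
  define G where "G u = - ln (mgf (u powr (1 / \<alpha>)))" for u
  have "G u = u * G 1" if "0 < u" for u
  proof (rule additive_nonneg_imp_linear[OF _ _ that])
    fix u v :: real assume uv: "0 < u" "0 < v"
    have "mgf (u powr (1 / \<alpha>)) * mgf (v powr (1 / \<alpha>)) = mgf ((u + v) powr (1 / \<alpha>))"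
      using mgf_scale_mult[of "u powr (1 / \<alpha>)" "v powr (1 / \<alpha>)"] uv \<alpha> by (simp add: powr_powr)
    then show "G (u + v) = G u + G v"
      using mgf_pos[of "u powr (1 / \<alpha>)"] mgf_pos[of "v powr (1 / \<alpha>)"] unfolding G_def
      by (metis ln_mult_pos minus_add_distrib powr_ge_zero)
  next
    fix u :: real
    show "0 \<le> G u" using mgf_le_1[of "u powr (1 / \<alpha>)"] mgf_pos[of "u powr (1 / \<alpha>)"]
      by (simp add: G_def)
  qed
  note lin = this
  show ?thesis
  proof (intro exI[of _ "G 1"] conjI allI impI)
    show "0 \<le> G 1" using mgf_le_1[of 1] mgf_pos[of 1] by (simp add: G_def)
    fix s :: real assume s: "0 < s"
    have "(s powr \<alpha>) powr (1 / \<alpha>) = s" using s \<alpha> by (simp add: powr_powr)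
    then have "- ln (mgf s) = s powr \<alpha> * G 1" using lin[of "s powr \<alpha>"] s by (simp add: G_def)
    then have "exp (ln (mgf s)) = exp (- (G 1 * s powr \<alpha>))" by (simp add: mult.commute)
    then show "mgf s = exp (- (G 1 * s powr \<alpha>))" using mgf_pos[of s] s by simp
  qed
qed

definition laplace :: "complex \<Rightarrow> complex" where
  "laplace z = (CLINT x|\<nu>. exp (z * complex_of_real x))"

lemma integrable_laplace: "0 \<le> Re z \<Longrightarrow> integrable \<nu> (\<lambda>x. exp (z * complex_of_real x))"
  by (rule integrable_const_bound[where B = 1]) (use exp_le_1_AE[of "Re z"] in auto)

text \<open>Dominated convergence of difference quotients along sequences: at
  \<open>Re z > 0\<close> the exponential decay on the negative half-line absorbs the factor
  \<open>\<bar>x\<bar>\<close>.\<close>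

lemma laplace_holomorphic: "laplace holomorphic_on {z. 0 < Re z}"
proof (rule holomorphic_onI)
  fix z assume "z \<in> {z. 0 < Re z}"
  then have z: "0 < Re z" by simp
  \<comment> \<open>Half the distance to the imaginary axis, so that all points of the ball keep
    real part at least \<open>r\<close>.\<close>
  define r where "r = Re z / 2"
  have r: "0 < r" using z by (simp add: r_def)
  have "(laplace has_field_derivative (CLINT x|\<nu>. x * exp (z * complex_of_real x))) (at z within ball z r)"
    unfolding has_field_derivative_iff tendsto_at_iff_sequentially
  proof (intro allI impI)
    fix Z assume Z: "\<forall>i. Z i \<in> ball z r - {z}" and lim: "Z \<longlonglongrightarrow> z"
    have Zr: "r \<le> Re (Z i)" for i
      using Z abs_Re_le_cmod[of "z - Z i"] by (auto simp: dist_norm r_def) (smt (verit) DiffD1 mem_ball field_sum_of_halves dist_norm)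
    have Zz: "Z i \<noteq> z" for i using Z by auto
    have q: "((\<lambda>y. (laplace y - laplace z) / (y - z)) \<circ> Z) i
      = (CLINT x|\<nu>. (exp (Z i * complex_of_real x) - exp (z * complex_of_real x)) / (Z i - z))" for i
      using integrable_laplace[of "Z i"] integrable_laplace[of z] Zr[of i] r z
      by (simp add: laplace_def)
    show "((\<lambda>y. (laplace y - laplace z) / (y - z)) \<circ> Z) \<longlonglongrightarrow> (CLINT x|\<nu>. x * exp (z * complex_of_real x))"
      unfolding q[abs_def]
    proof (rule integral_dominated_convergence[where w = "\<lambda>_. 1 / r"])
      show "AE x in \<nu>. (\<lambda>i. (exp (Z i * complex_of_real x) - exp (z * complex_of_real x)) / (Z i - z))
        \<longlonglongrightarrow> x * exp (z * complex_of_real x)"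
      proof (intro AE_I2)
        fix x
        have "((\<lambda>y. exp (y * complex_of_real x)) has_field_derivative x * exp (z * complex_of_real x)) (at z)"
          by (auto intro!: derivative_eq_intros)
        then have "((\<lambda>y. (exp (y * complex_of_real x) - exp (z * complex_of_real x)) / (y - z))
          \<longlongrightarrow> x * exp (z * complex_of_real x)) (at z)"
          by (simp add: has_field_derivative_iff)
        then show "(\<lambda>i. (exp (Z i * complex_of_real x) - exp (z * complex_of_real x)) / (Z i - z))
          \<longlonglongrightarrow> x * exp (z * complex_of_real x)"
          unfolding tendsto_at_iff_sequentially using Zz lim by (auto simp: comp_def)
      qed
      show "AE x in \<nu>. cmod ((exp (Z i * complex_of_real x) - exp (z * complex_of_real x)) / (Z i - z)) \<le> 1 / r" for i
        using nonpos
      proof eventually_elim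
        case (elim x)
        have "cmod (exp (Z i * complex_of_real x) - exp (z * complex_of_real x))
          \<le> exp (r * x) * cmod (Z i * complex_of_real x - z * complex_of_real x)"
        proof (rule norm_exp_diff_le)
          show "Re (Z i * complex_of_real x) \<le> r * x"
            using mult_right_mono_neg[OF Zr elim] by simp
          have "r \<le> Re z" using z by (simp add: r_def)
          from mult_right_mono_neg[OF this elim] show "Re (z * complex_of_real x) \<le> r * x" by simp
        qed
        also have "\<dots> = exp (r * x) * (- x) * cmod (Z i - z)"
          using elim by (simp add: left_diff_distrib[symmetric] norm_mult)
        also have "exp (r * x) * (- x) \<le> 1 / r"
        proof -
          have "r * (- x) \<le> exp (r * (- x))" using exp_ge_add_one_self[of "r * (- x)"] by simp
          then have "exp (r * x) * (r * (- x)) \<le> exp (r * x) * exp (r * (- x))" by (intro mult_left_mono) auto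
          also have "\<dots> = 1" by (simp add: exp_add[symmetric])
          finally show ?thesis using r by (simp add: field_simps)
        qed
        finally show ?case using Zz[of i] by (simp add: norm_divide pos_divide_le_eq mult_right_mono)
      qed
    qed auto
  qed
  then have "(laplace has_field_derivative (CLINT x|\<nu>. x * exp (z * complex_of_real x))) (at z)"
    using r by (simp add: at_within_open[of z "ball z r"])
  then show "laplace field_differentiable at z within {z. 0 < Re z}"
    using field_differentiable_at_within field_differentiable_def by blast
qed

text \<open>Both sides are holomorphic on the right half-plane and agree on the positive reals, so
  the identity theorem applies.\<close>

lemma laplace_eq:
  assumes C: "\<forall>s>0. mgf s = exp (- (C * s powr \<alpha>))" and z: "0 < Re z"
  shows "laplace z = exp (- (of_real C * z powr of_real \<alpha>))"
proof -
  let ?S = "{z. 0 < Re z}" and ?U = "complex_of_real ` {0<..}"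
  have "laplace z - exp (- (of_real C * z powr of_real \<alpha>)) = 0"
  proof (rule analytic_continuation[where f = "\<lambda>z. laplace z - exp (- (of_real C * z powr of_real \<alpha>))"
        and S = ?S and U = ?U and \<xi> = 1])
    show "(\<lambda>z. laplace z - exp (- (of_real C * z powr of_real \<alpha>))) holomorphic_on ?S"
      by (intro holomorphic_intros laplace_holomorphic) (auto simp: complex_nonpos_Reals_iff)
    show "open ?S" by (rule open_halfspace_Re_gt)
    show "connected ?S" by (intro convex_connected convex_halfspace_Re_gt)
    show "1 islimpt ?U"
      unfolding islimpt_sequential
    proof (intro exI conjI allI)
      fix n
      show "complex_of_real (1 + 1 / real (Suc n)) \<in> ?U - {1}"
        by (auto simp del: of_real_add of_real_divide simp: add_pos_pos of_real_eq_1_iff)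
      have "(\<lambda>n. 1 + 1 / real (Suc n)) \<longlonglongrightarrow> 1 + 0"
        by (intro tendsto_add tendsto_const inverse_Suc_limit)
      then have "(\<lambda>n. complex_of_real (1 + 1 / real (Suc n))) \<longlonglongrightarrow> complex_of_real (1 + 0)"
        by (rule tendsto_of_real)
      then show "(\<lambda>n. complex_of_real (1 + 1 / real (Suc n))) \<longlonglongrightarrow> 1"
        by (simp only: add_0_right of_real_1)
    qed
    fix w assume "w \<in> ?U"
    then obtain s where s: "w = complex_of_real s" "0 < s" by auto
    have "laplace w = complex_of_real (mgf s)"
      unfolding laplace_def mgf_def s integral_complex_of_real[symmetric]
      by (simp only: exp_of_real[symmetric] of_real_mult)
    also have "\<dots> = exp (- (of_real C * w powr of_real \<alpha>))"
      using C s by (simp add: exp_of_real[symmetric] powr_of_real)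
    finally show "laplace w - exp (- (of_real C * w powr of_real \<alpha>)) = 0" by simp
  qed (use z in auto)
  then show ?thesis by simp
qed

text \<open>On approach to the imaginary axis from the right the integrand stays bounded by 1, so
  the boundary values of \<open>laplace\<close> are the characteristic function.\<close>

lemma laplace_boundary: "(\<lambda>n. laplace (Complex (1 / real (Suc n)) t)) \<longlonglongrightarrow> char \<nu> t"
  unfolding laplace_def char_def
proof (rule integral_dominated_convergence[where w = "\<lambda>_. 1"])
  show "AE x in \<nu>. (\<lambda>n. exp (Complex (1 / real (Suc n)) t * complex_of_real x)) \<longlonglongrightarrow> iexp (t * x)"
  proof (intro AE_I2)
    fix x
    have "(\<lambda>n. Complex (1 / real (Suc n)) t) \<longlonglongrightarrow> Complex 0 t"
      by (intro tendsto_Complex tendsto_const inverse_Suc_limit)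
    then have "(\<lambda>n. exp (Complex (1 / real (Suc n)) t * complex_of_real x)) \<longlonglongrightarrow> exp (Complex 0 t * complex_of_real x)"
      by (intro tendsto_exp tendsto_mult tendsto_const)
    moreover have "Complex 0 t * complex_of_real x = \<i> * complex_of_real (t * x)"
      by (simp add: complex_eq_iff)
    ultimately show "(\<lambda>n. exp (Complex (1 / real (Suc n)) t * complex_of_real x)) \<longlonglongrightarrow> iexp (t * x)" by simp
  qed
  show "AE x in \<nu>. cmod (exp (Complex (1 / real (Suc n)) t * complex_of_real x)) \<le> 1" for n
    using exp_le_1_AE[of "1 / real (Suc n)"] by simp
qed auto

text \<open>On the imaginary axis the explicit transform reads
  \<open>exp (- C * t powr \<alpha> * exp (\<i> * pi * \<alpha> / 2))\<close> for
  \<open>t > 0\<close>, to be matched with the stable form. Real parts force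
  \<open>cos (pi * \<alpha> / 2) > 0\<close>, hence \<open>\<alpha> < 1\<close>; imaginary parts
  force \<open>\<beta> = -1\<close>.\<close>

lemma stable_parameters: "\<alpha> \<le> 2 \<Longrightarrow> \<alpha> < 1 \<and> \<beta> = -1"
proof -
  assume \<alpha>2: "\<alpha> \<le> 2"
  obtain C where C0: "0 \<le> C" and C: "\<forall>s>0. mgf s = exp (- (C * s powr \<alpha>))"
    using mgf_eq by blast
  define T where "T = tan (pi * \<alpha> / 2)"
  \<comment> \<open>The difference of the two exponents divided by \<open>t powr \<alpha>\<close>, a
    number independent of \<open>t\<close>.\<close>
  define w where "w = of_real \<kappa> * (1 - \<i> * of_real (\<beta> * T)) - of_real C * exp (\<i> * of_real (pi * \<alpha> / 2))"
  have w1: "exp (of_real \<rho> * w) = 1" if \<rho>: "0 < \<rho>" for \<rho>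
  proof -
    define t where "t = \<rho> powr (1 / \<alpha>)"
    have t: "0 < t" "t powr \<alpha> = \<rho>" using \<rho> \<alpha> by (auto simp: t_def powr_powr)
    have "(\<lambda>n. Complex (1 / real (Suc n)) t) \<longlonglongrightarrow> Complex 0 t"
      by (intro tendsto_Complex tendsto_const inverse_Suc_limit)
    then have "(\<lambda>n. exp (- (of_real C * Complex (1 / real (Suc n)) t powr of_real \<alpha>)))
      \<longlonglongrightarrow> exp (- (of_real C * Complex 0 t powr of_real \<alpha>))"
      using t by (intro tendsto_exp tendsto_minus tendsto_mult tendsto_const tendsto_powr_complex)
        (auto simp: complex_nonpos_Reals_iff)
    moreover have "(\<lambda>n. laplace (Complex (1 / real (Suc n)) t))
      = (\<lambda>n. exp (- (of_real C * Complex (1 / real (Suc n)) t powr of_real \<alpha>)))"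
      by (intro ext laplace_eq[OF C]) simp
    ultimately have eq: "char \<nu> t = exp (- (of_real C * Complex 0 t powr of_real \<alpha>))"
      using laplace_boundary[of t] LIMSEQ_unique by metis
    have "Complex 0 t = \<i> * complex_of_real t" by (simp add: complex_eq_iff)
    then have L: "Ln (Complex 0 t) = \<i> * of_real (pi / 2) + of_real (ln t)"
      using Ln_times_of_real[of t \<i>] t by (simp only: mult.commute[of \<i>]) (simp add: add.commute Ln_of_real)
    have nz: "Complex 0 t \<noteq> 0" using t by (simp add: complex_eq_iff)
    have "Complex 0 t powr of_real \<alpha> = exp (of_real \<alpha> * (\<i> * of_real (pi / 2) + of_real (ln t)))"
      using nz by (simp only: powr_def L if_False)
    also have "\<dots> = exp (\<i> * of_real (pi * \<alpha> / 2)) * exp (of_real (\<alpha> * ln t))"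
      unfolding exp_add[symmetric] by (rule arg_cong[where f = exp]) (simp add: algebra_simps)
    also have "exp (of_real (\<alpha> * ln t)) = complex_of_real \<rho>"
      using t by (simp only: exp_of_real t(2)[symmetric] powr_def) simp
    finally have pw: "Complex 0 t powr of_real \<alpha> = of_real \<rho> * exp (\<i> * of_real (pi * \<alpha> / 2))" by simp
    have "char \<nu> t = exp (- (of_real (\<kappa> * \<rho>) * (1 - \<i> * of_real (\<beta> * T))))"
      using t unfolding char_\<nu> stable_char_def by (simp add: T_def)
    then have "exp (- (of_real (\<kappa> * \<rho>) * (1 - \<i> * of_real (\<beta> * T))))
      = exp (- (of_real C * (of_real \<rho> * exp (\<i> * of_real (pi * \<alpha> / 2)))))"
      using eq pw by simp
    then have "exp (- (of_real C * (of_real \<rho> * exp (\<i> * of_real (pi * \<alpha> / 2))))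
      - - (of_real (\<kappa> * \<rho>) * (1 - \<i> * of_real (\<beta> * T)))) = 1"
      by (simp only: exp_diff) simp
    then show ?thesis by (simp add: w_def algebra_simps)
  qed
  have "w = 0"
  proof (rule ccontr)
    assume w: "w \<noteq> 0"
    have "Re w = 0" using w1[of 1] by (simp add: exp_eq_1)
    with w have I: "Im w \<noteq> 0" by (auto simp: complex_eq_iff)
    \<comment> \<open>Equality of exponentials determines an exponent only up to multiples of
      \<open>2 * pi * \<i>\<close>; scaling so that \<open>\<rho> * Im w\<close> is
      \<open>pi\<close> or \<open>- pi\<close> excludes every nonzero \<open>w\<close>.\<close>
    define \<rho> where "\<rho> = pi / \<bar>Im w\<bar>"
    have \<rho>: "0 < \<rho>" using I by (simp add: \<rho>_def)
    from w1[OF this] obtain n :: int where n: "\<rho> * Im w = of_int (2 * n) * pi" by (auto simp: exp_eq_1)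
    have "\<rho> * Im w = sgn (Im w) * pi" using I by (simp add: \<rho>_def sgn_real_def)
    then have "sgn (Im w) = of_int (2 * n)" using n by simp
    then have "1 = 2 * n \<or> -1 = 2 * n" using I
      by (auto simp: sgn_real_def split: if_splits)
    then show False by presburger
  qed
  then have "Re w = 0" "Im w = 0" by simp_all
  then have ReIm: "\<kappa> = C * cos (pi * \<alpha> / 2)" "- (\<kappa> * (\<beta> * T)) = C * sin (pi * \<alpha> / 2)"
    by (simp_all add: w_def Re_exp Im_exp)
  have cpos: "0 < cos (pi * \<alpha> / 2)"
    using ReIm(1) \<kappa> C0 by (metis mult_nonneg_nonpos not_less)
  have "\<alpha> < 1"
  proof (rule ccontr)
    assume "\<not> \<alpha> < 1"
    then have "pi / 2 \<le> pi * \<alpha> / 2" "pi * \<alpha> / 2 \<le> pi" using \<alpha>2 pi_gt_zero by (auto simp: mult_le_cancel_left_pos)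
    then have "cos (pi * \<alpha> / 2) \<le> cos (pi / 2)" by (intro cos_monotone_0_pi_le) auto
    then show False using cpos by simp
  qed
  then have "0 < T" unfolding T_def using \<alpha> by (intro tan_gt_zero) auto
  moreover have "C * sin (pi * \<alpha> / 2) = \<kappa> * T"
    using cpos ReIm(1) by (simp add: T_def tan_def)
  ultimately have "\<kappa> * T * (1 + \<beta>) = 0" using ReIm(2) by (simp add: algebra_simps)
  then have "\<beta> = -1" using \<kappa> \<open>0 < T\<close> by auto
  with \<open>\<alpha> < 1\<close> show ?thesis by simp
qed

end

text \<open>The case \<open>\<alpha> < 1\<close>, \<open>\<beta> = -1\<close> is the one-sided one,
  which \<open>admissible\<close> excludes by \<open>\<bar>\<beta>\<bar> < 1\<close> in that
  range.\<close>

lemma stable_law_positive_mass: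
  assumes "(\<alpha>, \<beta>) \<in> admissible" "0 < \<kappa>" "stable_law \<kappa> \<alpha> \<beta> \<nu>"
  shows "0 < measure \<nu> {0<..}"
proof (rule ccontr)
  interpret real_distribution \<nu> using assms by (simp add: stable_law_def)
  assume "\<not> ?thesis"
  then have "prob {0<..} = 0" using measure_nonneg[of \<nu> "{0<..}"] by linarith
  then have "AE x in \<nu>. x \<notin> {0<..}"
    by (intro AE_not_in null_setsI) (auto simp: emeasure_eq_measure)
  then interpret nonpositive_stable \<nu> \<kappa> \<alpha> \<beta>
    using assms by unfold_locales (auto simp: stable_law_def admissible_def)
  show False using stable_parameters assms(1) by (auto simp: admissible_def)
qed

section \<open>Maximal inequalities\<close>

text \<open>The ramp \<open>cts_step a b\<close> is continuous and lies between the two indicator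
  functions, so the comparison holds at arbitrary points, whether or not the limit has atoms
  there.\<close>

lemma weak_conv_cdf_sandwich:
  assumes \<mu>: "\<And>n. real_distribution (\<mu> n)" and \<nu>: "real_distribution \<nu>" and conv: "weak_conv_m \<mu> \<nu>"
    and ab: "a < b" and e: "0 < e"
  shows "\<forall>\<^sub>F n in sequentially. cdf (\<mu> n) a < cdf \<nu> b + e"
    and "\<forall>\<^sub>F n in sequentially. cdf \<nu> a - e < cdf (\<mu> n) b"
proof -
  have cont: "isCont (cts_step a b) x" for x
    using uniformly_continuous_imp_continuous[OF cts_step_uniformly_continuous[OF ab]]
    by (simp add: continuous_on_eq_continuous_at)
  have lim: "(\<lambda>n. integral\<^sup>L (\<mu> n) (cts_step a b)) \<longlonglongrightarrow> integral\<^sup>L \<nu> (cts_step a b)"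
    by (rule weak_conv_imp_integral_bdd_continuous_conv[OF \<mu> \<nu> conv cont, where B = 1])
      (use ab in \<open>auto simp: cts_step_def\<close>)
  have "integral\<^sup>L \<nu> (cts_step a b) < cdf \<nu> b + e"
    using real_distribution.cdf_cts_step(2)[OF \<nu> ab] e by simp
  from order_tendstoD(2)[OF lim this]
  show "\<forall>\<^sub>F n in sequentially. cdf (\<mu> n) a < cdf \<nu> b + e"
    by eventually_elim (use real_distribution.cdf_cts_step(1)[OF \<mu> ab] in \<open>auto intro: le_less_trans\<close>)
  have "cdf \<nu> a - e < integral\<^sup>L \<nu> (cts_step a b)"
    using real_distribution.cdf_cts_step(1)[OF \<nu> ab] e by simp
  from order_tendstoD(1)[OF lim this]
  show "\<forall>\<^sub>F n in sequentially. cdf \<nu> a - e < cdf (\<mu> n) b"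
    by eventually_elim (use real_distribution.cdf_cts_step(2)[OF \<mu> ab] in \<open>auto intro: less_le_trans\<close>)
qed

lemma (in real_distribution) prob_greater: "prob {x<..} = 1 - cdf M x"
proof -
  have "{x<..} = space M - {..x}" by auto
  then show ?thesis unfolding cdf_def by (simp only:) (subst prob_compl; simp)
qed

section \<open>Reversed and shifted paths, Ottaviani's inequality\<close>

context iid_walk
begin

lemma walk_measurable [measurable]: "walk X n \<in> borel_measurable M"
  unfolding walk_eq_bsum by (rule bsum_measurable) auto

lemma walk_measurable_block: "j \<le> m \<Longrightarrow> walk X j \<in> borel_measurable (block_algebra {1..m})"
  unfolding walk_eq_bsum by (rule bsum_measurable_block) auto

lemma walk_split: "m \<le> n \<Longrightarrow> walk X n \<omega> = walk X m \<omega> + bsum {m + 1..n} \<omega>"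
  unfolding walk_def bsum_def
  using sum.ub_add_nat[of 1 m "\<lambda>i. X i \<omega>" "n - m"] by simp

lemma bsum_split: "l \<le> m \<Longrightarrow> m \<le> n \<Longrightarrow> bsum {l + 1..n} \<omega> = bsum {l + 1..m} \<omega> + bsum {m + 1..n} \<omega>"
  using walk_split[of l n \<omega>] walk_split[of l m \<omega>] walk_split[of m n \<omega>] by simp

text \<open>The right-hand side depends on the step law alone, so any two i.i.d. sequences with that
  law have equal path probabilities; this is how reversed and shifted walks are compared with the
  original one.\<close>

lemma prob_walk_path:
  assumes B: "\<And>j. B j \<in> sets borel"
  shows "prob {\<omega> \<in> space M. \<forall>j\<in>{1..k}. walk X j \<omega> \<in> B j}
    = measure (PiM {1..k} (\<lambda>_. F)) {v \<in> space (PiM {1..k} (\<lambda>_. F)). \<forall>j\<in>{1..k}. (\<Sum>i=1..j. v i) \<in> B j}"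
proof (cases "k = 0")
  \<comment> \<open>The product law is characterised over nonempty index sets; for
    \<open>k = 0\<close> both events are the whole space.\<close>
  case True
  interpret P: prob_space "PiM {1..k} (\<lambda>_. F)"
    using law_real_distribution by (intro prob_space_PiM) (simp add: real_distribution_def)
  show ?thesis using True prob_space P.prob_space by simp
next
  case False
  interpret F: real_distribution F by (rule law_real_distribution)
  let ?V = "\<lambda>\<omega>. \<lambda>i\<in>{1..k}. X i \<omega>"
  have V: "?V \<in> measurable M (PiM {1..k} (\<lambda>_. borel))"
    by (intro measurable_restrict step_measurable) auto
  have "distr M (PiM {1..k} (\<lambda>_. borel)) ?V = PiM {1..k} (\<lambda>i. distr M borel (X i))"
  proof (rule indep_vars_iff_distr_eq_PiM'[THEN iffD1])
    show "indep_vars (\<lambda>_. borel) X {1..k}" by (rule indep_vars_subset[OF indep]) auto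
  qed (use False in \<open>auto intro: step_measurable\<close>)
  also have "\<dots> = PiM {1..k} (\<lambda>_. F)" by (intro PiM_cong) (auto simp: law)
  finally have d: "distr M (PiM {1..k} (\<lambda>_. borel)) ?V = PiM {1..k} (\<lambda>_. F)" .
  let ?S = "{v \<in> space (PiM {1..k} (\<lambda>_. F)). \<forall>j\<in>{1..k}. (\<Sum>i=1..j. v i) \<in> B j}"
  have sp: "space (PiM {1..k} (\<lambda>_. F)) = space (PiM {1..k} (\<lambda>_. borel))" by (simp add: space_PiM)
  have S: "?S \<in> sets (PiM {1..k} (\<lambda>_. borel))"
    unfolding sp
  proof (rule sets.sets_Collect_finite_All')
    fix j assume j: "j \<in> {1..k}"
    have "(\<lambda>v. \<Sum>i=1..j. v i :: real) \<in> borel_measurable (PiM {1..k} (\<lambda>_. borel))"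
    proof (rule borel_measurable_sum[where f = "\<lambda>i v. v i"])
      show "(\<lambda>v. v i :: real) \<in> borel_measurable (PiM {1..k} (\<lambda>_. borel))" if "i \<in> {1..j}" for i
        using that j by (intro measurable_component_singleton) auto
    qed
    from measurable_sets[OF this B[of j]]
    show "{v \<in> space (PiM {1..k} (\<lambda>_. borel)). (\<Sum>i=1..j. v i) \<in> B j} \<in> sets (PiM {1..k} (\<lambda>_. borel))"
      by (simp add: vimage_def Int_def conj_commute)
  qed (use False in auto)
  have "measure (PiM {1..k} (\<lambda>_. F)) ?S = prob (?V -` ?S \<inter> space M)"
    unfolding d[symmetric] by (rule measure_distr[OF V S[unfolded d[symmetric]]])
  also have "?V -` ?S \<inter> space M = {\<omega> \<in> space M. \<forall>j\<in>{1..k}. walk X j \<omega> \<in> B j}"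
  proof -
    have sumV: "(\<Sum>i=1..j. ?V \<omega> i) = walk X j \<omega>" if "j \<in> {1..k}" for j \<omega>
      unfolding walk_def using that by (intro sum.cong) auto
    have Vsp: "?V \<omega> \<in> space (PiM {1..k} (\<lambda>_. F))" for \<omega> by (auto simp: space_PiM)
    show ?thesis by (auto simp only: vimage_eq Int_iff mem_Collect_eq Vsp sumV)
  qed
  finally show ?thesis by simp
qed

text \<open>The sums over the last \<open>j\<close> of \<open>m\<close> steps form a walk built from
  the steps in reverse order. Beyond \<open>m\<close> the renumbering is the identity, so as to be
  injective on all indices.\<close>

lemma prob_reversed_path:
  assumes B: "\<And>j. B j \<in> sets borel" and km: "k \<le> m"
  shows "prob {\<omega> \<in> space M. \<forall>j\<in>{1..k}. bsum {m - j + 1..m} \<omega> \<in> B j}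
    = prob {\<omega> \<in> space M. \<forall>j\<in>{1..k}. walk X j \<omega> \<in> B j}"
proof -
  define \<sigma> where "\<sigma> i = (if i \<le> m then m + 1 - i else i)" for i
  interpret R: iid_walk M "\<lambda>i. X (\<sigma> i)" F
    by (rule reindex) (auto simp: \<sigma>_def inj_on_def split: if_splits)
  have "walk (\<lambda>i. X (\<sigma> i)) j \<omega> = bsum {m - j + 1..m} \<omega>" if "j \<in> {1..k}" for j \<omega>
    unfolding walk_def bsum_def
    by (rule sum.reindex_bij_witness[of _ "\<lambda>i. m + 1 - i" "\<lambda>i. m + 1 - i"])
      (use that km in \<open>auto simp: \<sigma>_def\<close>)
  then have "{\<omega> \<in> space M. \<forall>j\<in>{1..k}. bsum {m - j + 1..m} \<omega> \<in> B j}
    = {\<omega> \<in> space M. \<forall>j\<in>{1..k}. walk (\<lambda>i. X (\<sigma> i)) j \<omega> \<in> B j}" by auto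
  then show ?thesis using R.prob_walk_path[OF B] prob_walk_path[OF B] by simp
qed

lemma prob_shifted_path:
  assumes B: "\<And>j. B j \<in> sets borel"
  shows "prob {\<omega> \<in> space M. \<forall>j\<in>{1..k}. bsum {m + 1..m + j} \<omega> \<in> B j}
    = prob {\<omega> \<in> space M. \<forall>j\<in>{1..k}. walk X j \<omega> \<in> B j}"
proof -
  interpret R: iid_walk M "\<lambda>i. X (m + i)" F
    by (rule reindex) (auto simp: inj_on_def)
  have "walk (\<lambda>i. X (m + i)) j \<omega> = bsum {m + 1..m + j} \<omega>" for j \<omega>
    unfolding walk_def bsum_def
    by (rule sum.reindex_bij_witness[of _ "\<lambda>i. i - m" "\<lambda>i. m + i"]) auto
  then show ?thesis using R.prob_walk_path[OF B] prob_walk_path[OF B] by simp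
qed

lemma prob_bsum_abs_ge:
  assumes "J \<subseteq> {1..}" "finite J"
  shows "prob {\<omega> \<in> space M. t \<le> \<bar>bsum J \<omega>\<bar>} = prob {\<omega> \<in> space M. t \<le> \<bar>walk X (card J) \<omega>\<bar>}"
  using prob_bsum_eq_walk[OF assms(2,1), of "{x. t \<le> \<bar>x\<bar>}"] by simp

text \<open>The event \<open>E j\<close> that \<open>j\<close> is the first time with \<open>2 * t \<le> \<bar>walk X j\<bar>\<close> is independent
  of the later steps, which with probability at least \<open>1 / 2\<close> do not bring the walk back below
  \<open>t\<close>.\<close>

lemma ottaviani:
  assumes small: "\<And>j. j \<le> k \<Longrightarrow> prob {\<omega> \<in> space M. t \<le> \<bar>walk X j \<omega>\<bar>} \<le> \<eta>" and \<eta>: "\<eta> \<le> 1 / 2"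
  shows "1 - 2 * \<eta> \<le> prob {\<omega> \<in> space M. \<forall>j\<in>{1..k}. \<bar>walk X j \<omega>\<bar> < 2 * t}"
proof -
  define E where "E j = {\<omega> \<in> space M. 2 * t \<le> \<bar>walk X j \<omega>\<bar> \<and> (\<forall>i\<in>{1..<j}. \<bar>walk X i \<omega>\<bar> < 2 * t)}" for j
  define D where "D j = {\<omega> \<in> space M. \<bar>bsum {j + 1..k} \<omega>\<bar> < t}" for j
  have E_block: "E j \<in> sets (block_algebra {1..j})" for j
  proof -
    have [measurable]: "i \<le> j \<Longrightarrow> walk X i \<in> borel_measurable (block_algebra {1..j})" for i
      by (rule walk_measurable_block)
    have "{\<omega> \<in> space (block_algebra {1..j}). 2 * t \<le> \<bar>walk X j \<omega>\<bar> \<and> (\<forall>i\<in>{1..<j}. \<bar>walk X i \<omega>\<bar> < 2 * t)}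
      \<in> sets (block_algebra {1..j})" by measurable
    then show ?thesis by (simp add: E_def)
  qed
  have D_block: "D j \<in> sets (block_algebra {j + 1..k})" for j
  proof -
    have [measurable]: "bsum {j + 1..k} \<in> borel_measurable (block_algebra {j + 1..k})"
      by (rule bsum_measurable_block) simp
    have "{\<omega> \<in> space (block_algebra {j + 1..k}). \<bar>bsum {j + 1..k} \<omega>\<bar> < t} \<in> sets (block_algebra {j + 1..k})"
      by measurable
    then show ?thesis by (simp add: D_def)
  qed
  have E_ev: "E j \<in> events" for j using E_block block_algebra_subset_events[of "{1..j}"] by auto
  have D_ev: "D j \<in> events" for j using D_block block_algebra_subset_events[of "{j + 1..k}"] by auto
  have D_half: "1 / 2 \<le> prob (D j)" if "j \<le> k" for j
  proof -
    have [measurable]: "bsum {j + 1..k} \<in> borel_measurable M" by (rule bsum_measurable) auto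
    have eq: "space M - D j = {\<omega> \<in> space M. t \<le> \<bar>bsum {j + 1..k} \<omega>\<bar>}" by (auto simp: D_def)
    have "1 - prob (D j) = prob (space M - D j)" by (rule prob_compl[OF D_ev, symmetric])
    also have "\<dots> = prob {\<omega> \<in> space M. t \<le> \<bar>walk X (k - j) \<omega>\<bar>}"
      unfolding eq using prob_bsum_abs_ge[of "{j + 1..k}" t] that by simp
    finally show ?thesis using small[of "k - j"] \<eta> by simp
  qed
  have disj: "disjoint_family_on E {1..k}"
    unfolding disjoint_family_on_def
  proof (intro ballI impI)
    fix i j :: nat assume "i \<in> {1..k}" "j \<in> {1..k}" "i \<noteq> j"
    then show "E i \<inter> E j = {}" by (cases "i < j") (force simp: E_def)+
  qed
  let ?U = "\<Union>j\<in>{1..k}. E j"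
  have U: "space M - ?U = {\<omega> \<in> space M. \<forall>j\<in>{1..k}. \<bar>walk X j \<omega>\<bar> < 2 * t}"
  proof (intro set_eqI iffI)
    fix \<omega> assume w: "\<omega> \<in> space M - ?U"
    have "\<bar>walk X j \<omega>\<bar> < 2 * t" if "j \<in> {1..k}" for j
      using that
    proof (induction j rule: less_induct)
      case (less j)
      then have "\<forall>i\<in>{1..<j}. \<bar>walk X i \<omega>\<bar> < 2 * t" by auto
      moreover have "\<omega> \<notin> E j" using w less by auto
      ultimately show ?case using w by (auto simp: E_def)
    qed
    then show "\<omega> \<in> {\<omega> \<in> space M. \<forall>j\<in>{1..k}. \<bar>walk X j \<omega>\<bar> < 2 * t}" using w by auto
  qed (force simp: E_def)
  have "prob ?U * (1 / 2) = (\<Sum>j\<in>{1..k}. prob (E j) * (1 / 2))"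
    using E_ev disj by (subst finite_measure_finite_Union) (auto simp: sum_distrib_right)
  also have "\<dots> \<le> (\<Sum>j\<in>{1..k}. prob (E j \<inter> D j))"
  proof (rule sum_mono)
    fix j assume j: "j \<in> {1..k}"
    have "prob (E j) * (1 / 2) \<le> prob (E j) * prob (D j)"
      using j by (intro mult_left_mono D_half) auto
    also have "\<dots> = prob (E j \<inter> D j)"
      by (rule block_indep[OF _ _ _ E_block D_block, symmetric]) auto
    finally show "prob (E j) * (1 / 2) \<le> prob (E j \<inter> D j)" .
  qed
  also have "\<dots> = prob (\<Union>j\<in>{1..k}. E j \<inter> D j)"
  proof (rule finite_measure_finite_Union[symmetric])
    show "disjoint_family_on (\<lambda>j. E j \<inter> D j) {1..k}"
      using disj unfolding disjoint_family_on_def by blast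
  qed (use E_ev D_ev in auto)
  also have "\<dots> \<le> prob {\<omega> \<in> space M. t \<le> \<bar>walk X k \<omega>\<bar>}"
  proof (rule finite_measure_mono)
    show "(\<Union>j\<in>{1..k}. E j \<inter> D j) \<subseteq> {\<omega> \<in> space M. t \<le> \<bar>walk X k \<omega>\<bar>}"
    proof
      fix \<omega> assume "\<omega> \<in> (\<Union>j\<in>{1..k}. E j \<inter> D j)"
      then obtain j where j: "j \<in> {1..k}" "\<omega> \<in> space M" "2 * t \<le> \<bar>walk X j \<omega>\<bar>" "\<bar>bsum {j + 1..k} \<omega>\<bar> < t"
        by (auto simp: E_def D_def)
      then show "\<omega> \<in> {\<omega> \<in> space M. t \<le> \<bar>walk X k \<omega>\<bar>}" using walk_split[of j k \<omega>] by auto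
    qed
  qed measurable
  also have "\<dots> \<le> \<eta>" by (rule small) simp
  finally have "prob ?U \<le> 2 * \<eta>" by simp
  moreover have "prob (space M - ?U) = 1 - prob ?U" using E_ev by (intro prob_compl) auto
  ultimately show ?thesis unfolding U by simp
qed

end

section \<open>Tightness, maxima and escape on the scale \<open>c n\<close>\<close>

locale attracted_walk = iid_walk M X F + L: attracted_law F c \<kappa> \<alpha>
  for M :: "'a measure" and X :: "nat \<Rightarrow> 'a \<Rightarrow> real" and F c \<kappa> \<alpha> +
  fixes \<nu> :: "real measure"
  assumes \<nu>: "real_distribution \<nu>" and \<nu>_pos: "0 < measure \<nu> {0<..}"
    and walk_conv: "weak_conv_m (\<lambda>n. distr M borel (\<lambda>\<omega>. walk X n \<omega> / c n)) \<nu>"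
begin

lemma scaled_walk_distribution: "real_distribution (distr M borel (\<lambda>\<omega>. walk X n \<omega> / c n))"
  by (rule real_distribution_distr) simp

lemma prob_scaled: "B \<in> sets borel \<Longrightarrow>
    measure (distr M borel (\<lambda>\<omega>. walk X n \<omega> / c n)) B = prob {\<omega> \<in> space M. walk X n \<omega> / c n \<in> B}"
  by (subst measure_distr) (auto intro!: arg_cong[where f = prob])

lemma tight:
  assumes \<eta>: "0 < \<eta>"
  shows "\<exists>R>0. \<forall>\<^sub>F n in sequentially. prob {\<omega> \<in> space M. R * c n \<le> \<bar>walk X n \<omega>\<bar>} \<le> \<eta>"
proof -
  interpret N: real_distribution \<nu> by (rule \<nu>)
  have "\<forall>\<^sub>F x in at_top. 1 - \<eta> / 4 < cdf \<nu> x"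
    using \<eta> by (intro order_tendstoD(1)[OF N.cdf_lim_at_top_prob]) auto
  then obtain u where u: "1 - \<eta> / 4 < cdf \<nu> u" by (auto simp: eventually_at_top_linorder)
  have "\<forall>\<^sub>F x in at_bot. cdf \<nu> x < \<eta> / 4"
    using \<eta> by (intro order_tendstoD(2)[OF N.cdf_lim_at_bot]) auto
  then obtain l where l: "cdf \<nu> l < \<eta> / 4" by (auto simp: eventually_at_bot_linorder)
  define R where "R = max 1 (max (u + 2) (1 - l))"
  have R: "0 < R" "u + 1 < R" "- R < l" by (auto simp: R_def)
  have e: "0 < \<eta> / 4" using \<eta> by simp
  note s1 = weak_conv_cdf_sandwich(1)[OF scaled_walk_distribution \<nu> walk_conv R(3) e]
  have "u < u + 1" by simp
  note s2 = weak_conv_cdf_sandwich(2)[OF scaled_walk_distribution \<nu> walk_conv this e]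
  show ?thesis
  proof (intro exI[of _ R] conjI R(1))
    show "\<forall>\<^sub>F n in sequentially. prob {\<omega> \<in> space M. R * c n \<le> \<bar>walk X n \<omega>\<bar>} \<le> \<eta>"
      using s1 s2 eventually_ge_at_top[of 1]
    proof eventually_elim
      case (elim n)
      interpret S: real_distribution "distr M borel (\<lambda>\<omega>. walk X n \<omega> / c n)"
        by (rule scaled_walk_distribution)
      have cn: "0 < c n" using elim by (intro L.c_pos) auto
      have "prob {\<omega> \<in> space M. R * c n \<le> \<bar>walk X n \<omega>\<bar>}
        \<le> prob ({\<omega> \<in> space M. walk X n \<omega> / c n \<in> {..-R}} \<union> {\<omega> \<in> space M. walk X n \<omega> / c n \<in> {u + 1<..}})"
      proof (rule finite_measure_mono)
        show "{\<omega> \<in> space M. R * c n \<le> \<bar>walk X n \<omega>\<bar>}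
          \<subseteq> {\<omega> \<in> space M. walk X n \<omega> / c n \<in> {..-R}} \<union> {\<omega> \<in> space M. walk X n \<omega> / c n \<in> {u + 1<..}}"
        proof
          fix \<omega> assume w: "\<omega> \<in> {\<omega> \<in> space M. R * c n \<le> \<bar>walk X n \<omega>\<bar>}"
          then have "R \<le> \<bar>walk X n \<omega>\<bar> / c n" using cn by (simp add: pos_le_divide_eq)
          then have "R \<le> \<bar>walk X n \<omega> / c n\<bar>" using cn by simp
          then have "walk X n \<omega> / c n \<le> - R \<or> u + 1 < walk X n \<omega> / c n" using R by linarith
          then show "\<omega> \<in> {\<omega> \<in> space M. walk X n \<omega> / c n \<in> {..-R}} \<union> {\<omega> \<in> space M. walk X n \<omega> / c n \<in> {u + 1<..}}"
            using w by auto
        qed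
      qed measurable
      also have "\<dots> \<le> prob {\<omega> \<in> space M. walk X n \<omega> / c n \<in> {..-R}}
        + prob {\<omega> \<in> space M. walk X n \<omega> / c n \<in> {u + 1<..}}"
        by (rule measure_Un_le) measurable
      also have "\<dots> = cdf (distr M borel (\<lambda>\<omega>. walk X n \<omega> / c n)) (- R)
        + (1 - cdf (distr M borel (\<lambda>\<omega>. walk X n \<omega> / c n)) (u + 1))"
        unfolding S.prob_greater[symmetric] unfolding cdf_def by (simp add: prob_scaled)
      also have "\<dots> \<le> \<eta>" using elim u l by simp
      finally show ?case .
    qed
  qed
qed

text \<open>For a fixed \<open>j\<close> this only expresses that \<open>c n\<close> tends to
  infinity; it disposes of the finitely many \<open>j\<close> to which the growth bound on
  \<open>c\<close> does not apply.\<close>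

lemma tail_small:
  assumes \<delta>: "0 < \<delta>" and \<eta>: "0 < \<eta>"
  shows "\<forall>\<^sub>F n in sequentially. prob {\<omega> \<in> space M. \<delta> * c n \<le> \<bar>walk X j \<omega>\<bar>} \<le> \<eta>"
proof -
  let ?D = "distr M borel (\<lambda>\<omega>. \<bar>walk X j \<omega>\<bar>)"
  interpret D: real_distribution ?D by (rule real_distribution_distr) simp
  have "\<forall>\<^sub>F x in at_top. 1 - \<eta> < cdf ?D x"
    using \<eta> by (intro order_tendstoD(1)[OF D.cdf_lim_at_top_prob]) auto
  then obtain u where u: "1 - \<eta> < cdf ?D u" by (auto simp: eventually_at_top_linorder)
  have "\<forall>\<^sub>F n in sequentially. (u + 1) / \<delta> \<le> c n"
    using L.c_at_top by (simp add: filterlim_at_top)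
  then show ?thesis
  proof eventually_elim
    case (elim n)
    then have "u < \<delta> * c n" using \<delta> by (simp add: pos_divide_le_eq mult.commute)
    then have "prob {\<omega> \<in> space M. \<delta> * c n \<le> \<bar>walk X j \<omega>\<bar>} \<le> prob ((\<lambda>\<omega>. \<bar>walk X j \<omega>\<bar>) -` {u<..} \<inter> space M)"
      by (intro finite_measure_mono) auto
    also have "\<dots> = measure ?D {u<..}" by (subst measure_distr) auto
    also have "\<dots> \<le> \<eta>" using u by (simp add: D.prob_greater)
    finally show ?case .
  qed
qed

text \<open>For large \<open>j\<close>, tightness at time \<open>j\<close> bounds the walk by
  \<open>R * c j\<close>, and \<open>A\<close> is such that
  \<open>R * c j \<le> \<delta> * c n\<close> as soon as \<open>A * j \<le> n\<close>.\<close>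

lemma early_walk_small:
  assumes \<delta>: "0 < \<delta>" and \<eta>: "0 < \<eta>"
  shows "\<exists>A::nat. 1 \<le> A \<and> (\<forall>\<^sub>F n in sequentially. \<forall>j. A * j \<le> n \<longrightarrow>
    prob {\<omega> \<in> space M. \<delta> * c n \<le> \<bar>walk X j \<omega>\<bar>} \<le> \<eta>)"
proof -
  obtain R where R: "0 < R" "\<forall>\<^sub>F n in sequentially. prob {\<omega> \<in> space M. R * c n \<le> \<bar>walk X n \<omega>\<bar>} \<le> \<eta>"
    using tight[OF \<eta>] by blast
  then obtain N1 where N1: "\<And>n. N1 \<le> n \<Longrightarrow> prob {\<omega> \<in> space M. R * c n \<le> \<bar>walk X n \<omega>\<bar>} \<le> \<eta>"
    by (auto simp: eventually_sequentially)
  obtain N where N: "1 \<le> N" and g: "\<And>R. \<exists>A\<ge>1. \<forall>j\<ge>N. \<forall>n\<ge>A * j. R * c j \<le> c n"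
    using L.c_growth by metis
  obtain A where A: "1 \<le> A" "\<And>j n. N \<le> j \<Longrightarrow> A * j \<le> n \<Longrightarrow> R / \<delta> * c j \<le> c n" using g by blast
  show ?thesis
  proof (intro exI[of _ A] conjI A(1))
    have "\<forall>\<^sub>F n in sequentially. \<forall>j\<in>{..<max N N1}. prob {\<omega> \<in> space M. \<delta> * c n \<le> \<bar>walk X j \<omega>\<bar>} \<le> \<eta>"
      by (intro eventually_ball_finite finite_lessThan ballI tail_small \<delta> \<eta>)
    then show "\<forall>\<^sub>F n in sequentially. \<forall>j. A * j \<le> n \<longrightarrow> prob {\<omega> \<in> space M. \<delta> * c n \<le> \<bar>walk X j \<omega>\<bar>} \<le> \<eta>"
    proof eventually_elim
      case (elim n)
      show ?case
      proof (intro allI impI)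
        fix j assume j: "A * j \<le> n"
        show "prob {\<omega> \<in> space M. \<delta> * c n \<le> \<bar>walk X j \<omega>\<bar>} \<le> \<eta>"
        proof (cases "j < max N N1")
          case False
          then have "R / \<delta> * c j \<le> c n" using j by (intro A) auto
          then have "R * c j \<le> \<delta> * c n" using \<delta> by (simp add: field_simps)
          then have "prob {\<omega> \<in> space M. \<delta> * c n \<le> \<bar>walk X j \<omega>\<bar>} \<le> prob {\<omega> \<in> space M. R * c j \<le> \<bar>walk X j \<omega>\<bar>}"
            by (intro finite_measure_mono) auto
          also have "\<dots> \<le> \<eta>" using False by (intro N1) auto
          finally show ?thesis .
        qed (use elim in auto)
      qed
    qed
  qed
qed

lemma early_maximum_small:
  assumes \<delta>: "0 < \<delta>" and \<eta>: "0 < \<eta>"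
  shows "\<exists>A::nat. 1 \<le> A \<and> (\<forall>\<^sub>F n in sequentially. \<forall>k. A * k \<le> n \<longrightarrow>
    1 - \<eta> \<le> prob {\<omega> \<in> space M. \<forall>j\<in>{1..k}. \<bar>walk X j \<omega>\<bar> < \<delta> * c n})"
proof -
  define \<eta>' where "\<eta>' = min (\<eta> / 2) (1 / 2)"
  have \<eta>': "0 < \<eta>'" "\<eta>' \<le> 1 / 2" "2 * \<eta>' \<le> \<eta>" using \<eta> by (auto simp: \<eta>'_def)
  have "0 < \<delta> / 2" using \<delta> by simp
  from early_walk_small[OF this \<eta>'(1)] obtain A :: nat where A: "1 \<le> A"
    "\<forall>\<^sub>F n in sequentially. \<forall>j. A * j \<le> n \<longrightarrow> prob {\<omega> \<in> space M. \<delta> / 2 * c n \<le> \<bar>walk X j \<omega>\<bar>} \<le> \<eta>'"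
    by blast
  show ?thesis
  proof (intro exI[of _ A] conjI A(1))
    from A(2) show "\<forall>\<^sub>F n in sequentially. \<forall>k. A * k \<le> n \<longrightarrow>
      1 - \<eta> \<le> prob {\<omega> \<in> space M. \<forall>j\<in>{1..k}. \<bar>walk X j \<omega>\<bar> < \<delta> * c n}"
    proof eventually_elim
      case (elim n)
      show ?case
      proof (intro allI impI)
        fix k assume k: "A * k \<le> n"
        have "1 - 2 * \<eta>' \<le> prob {\<omega> \<in> space M. \<forall>j\<in>{1..k}. \<bar>walk X j \<omega>\<bar> < 2 * (\<delta> / 2 * c n)}"
        proof (rule ottaviani[OF _ \<eta>'(2)])
          fix j assume "j \<le> k"
          then have "A * j \<le> n" using k by (meson le_trans mult_le_mono2)
          then show "prob {\<omega> \<in> space M. \<delta> / 2 * c n \<le> \<bar>walk X j \<omega>\<bar>} \<le> \<eta>'" using elim by blast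
        qed
        then show "1 - \<eta> \<le> prob {\<omega> \<in> space M. \<forall>j\<in>{1..k}. \<bar>walk X j \<omega>\<bar> < \<delta> * c n}"
          using \<eta>'(3) by simp
      qed
    qed
  qed
qed

text \<open>The positive half-line is a countable union of rays bounded away from 0, so one of them
  carries mass. Half of its level and half of its mass are given up in passing through weak
  convergence.\<close>

lemma positive_excursion:
  obtains a q where "0 < a" "0 < q" "q \<le> 1"
    "\<forall>\<^sub>F n in sequentially. q \<le> prob {\<omega> \<in> space M. a * c n < walk X n \<omega>}"
proof -
  interpret N: real_distribution \<nu> by (rule \<nu>)
  have "\<exists>b>0. 0 < measure \<nu> {b<..}"
  proof (rule ccontr)
    assume "\<not> ?thesis"
    then have z: "measure \<nu> {b<..} = 0" if "0 < b" for b
      using that measure_nonneg[of \<nu> "{b<..}"] by (metis less_eq_real_def)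
    have "{0<..} = (\<Union>n. {1 / real (Suc n)<..})"
    proof (intro set_eqI iffI)
      fix x :: real assume "x \<in> {0<..}"
      then obtain n where "1 / real (Suc n) < x" using reals_Archimedean[of x] by (auto simp: inverse_eq_divide)
      then show "x \<in> (\<Union>n. {1 / real (Suc n)<..})" by blast
    qed (auto intro: less_trans[rotated])
    moreover have "(\<Union>n. {1 / real (Suc n)<..}) \<in> null_sets \<nu>"
      by (intro null_sets_UN null_setsI) (use z in \<open>auto simp: N.emeasure_eq_measure\<close>)
    ultimately have "measure \<nu> {0<..} = 0" by (simp add: measure_eq_0_null_sets)
    then show False using \<nu>_pos by simp
  qed
  then obtain b where b: "0 < b" "0 < measure \<nu> {b<..}" by blast
  define q where "q = measure \<nu> {b<..} / 2"
  have q: "0 < q" using b by (simp add: q_def)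
  have "b / 2 < b" using b by simp
  note s = weak_conv_cdf_sandwich(1)[OF scaled_walk_distribution \<nu> walk_conv this q]
  show ?thesis
  proof (rule that[of "b / 2" q])
    show "q \<le> 1" using N.prob_le_1[of "{b<..}"] unfolding q_def by linarith
    show "\<forall>\<^sub>F n in sequentially. q \<le> prob {\<omega> \<in> space M. b / 2 * c n < walk X n \<omega>}"
      using s eventually_ge_at_top[of 1]
    proof eventually_elim
      case (elim n)
      interpret S: real_distribution "distr M borel (\<lambda>\<omega>. walk X n \<omega> / c n)"
        by (rule scaled_walk_distribution)
      have cn: "0 < c n" using elim by (intro L.c_pos) auto
      have "measure \<nu> {b<..} - q < 1 - cdf (distr M borel (\<lambda>\<omega>. walk X n \<omega> / c n)) (b / 2)"
        using elim by (simp add: N.prob_greater)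
      also have "\<dots> = prob {\<omega> \<in> space M. walk X n \<omega> / c n \<in> {b / 2<..}}"
        unfolding S.prob_greater[symmetric] by (simp add: prob_scaled)
      also have "{\<omega> \<in> space M. walk X n \<omega> / c n \<in> {b / 2<..}} = {\<omega> \<in> space M. b / 2 * c n < walk X n \<omega>}"
        using cn by (auto simp: pos_less_divide_eq)
      finally show ?case by (simp add: q_def)
    qed
  qed (use b q in auto)
qed

text \<open>Along the geometric times \<open>t i = A ^ i * t 0\<close> the increments are independent, each exceeds a
  multiple of the norming constant with a fixed probability, and by then the earlier part of the walk
  is negligible.\<close>

lemma rarely_stays_low:
  assumes \<eta>: "0 < \<eta>"
  shows "\<exists>\<delta>>0. \<forall>\<^sub>F k in sequentially. prob {\<omega> \<in> space M. \<forall>j\<in>{1..k}. walk X j \<omega> < \<delta> * c k} \<le> \<eta>"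
proof -
  obtain a q where a: "0 < a" and q: "0 < q" "q \<le> 1"
    and "\<forall>\<^sub>F n in sequentially. q \<le> prob {\<omega> \<in> space M. a * c n < walk X n \<omega>}"
    by (rule positive_excursion)
  then obtain N1 where N1: "\<And>n. N1 \<le> n \<Longrightarrow> q \<le> prob {\<omega> \<in> space M. a * c n < walk X n \<omega>}"
    by (auto simp: eventually_sequentially)
  \<comment> \<open>\<open>r\<close> scales make the chance of no large increment at most
    \<open>\<eta> / 2\<close>; the other half is shared among the \<open>r\<close> events that the
    earlier walk is not negligible.\<close>
  obtain r0 where "(1 - q) ^ r0 < \<eta> / 2"
    using real_arch_pow_inv[of "\<eta> / 2" "1 - q"] \<eta> q by auto
  moreover define r where "r = Suc r0"
  ultimately have r: "(1 - q) ^ r \<le> \<eta> / 2" "1 \<le> r"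
    using power_decreasing[of r0 "Suc r0" "1 - q"] q unfolding r_def by linarith+
  have "0 < a / 2" "0 < \<eta> / (2 * real r)" using a \<eta> r by auto
  from early_walk_small[OF this] obtain A' :: nat and N2 where A': "1 \<le> A'"
    and N2: "\<And>n j. N2 \<le> n \<Longrightarrow> A' * j \<le> n \<Longrightarrow>
      prob {\<omega> \<in> space M. a / 2 * c n \<le> \<bar>walk X j \<omega>\<bar>} \<le> \<eta> / (2 * real r)"
    by (auto simp: eventually_sequentially)
  \<comment> \<open>With this ratio \<open>t (Suc i) - t i = A' * t i\<close>, exactly the
    proportion at which the walk at time \<open>t i\<close> is negligible against
    \<open>c (s i)\<close>.\<close>
  define A where "A = A' + 1"
  have A: "2 \<le> A" using A' by (simp add: A_def)
  obtain N K where N: "1 \<le> N" and K: "0 < K" and double: "\<And>n. N \<le> n \<Longrightarrow> c (2 * n) \<le> K * c n"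
    using L.c_potter by metis
  have pow: "c (2 ^ v * n) \<le> K ^ v * c n" if n: "N \<le> n" for v n
  proof (induction v)
    case (Suc v)
    have "N \<le> 2 ^ v * n" using n by (metis le_trans mult_le_mono1 nat_mult_1 one_le_numeral one_le_power)
    then have "c (2 ^ Suc v * n) \<le> K * c (2 ^ v * n)" using double[of "2 ^ v * n"] by (simp add: mult.assoc)
    also have "\<dots> \<le> K * (K ^ v * c n)" using Suc K by (intro mult_left_mono) auto
    finally show ?case by (simp add: mult.assoc)
  qed simp
  \<comment> \<open>Covers the whole range of times: \<open>k < 2 * A ^ r * t0\<close>, so
    \<open>c k\<close> exceeds \<open>c t0\<close> by at most the factor \<open>K ^ v\<close> that
    is built into \<open>\<delta>\<close>.\<close>
  obtain v :: nat where v: "2 * A ^ r < 2 ^ v" using less_exp by blast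
  define \<delta> where "\<delta> = a / 2 / K ^ v"
  define Nm where "Nm = max N (max N1 N2)"
  have Nm: "1 \<le> Nm" "N \<le> Nm" "N1 \<le> Nm" "N2 \<le> Nm" using N by (auto simp: Nm_def)
  show ?thesis
  proof (intro exI[of _ \<delta>] conjI)
    show "0 < \<delta>" using a K by (simp add: \<delta>_def)
    show "\<forall>\<^sub>F k in sequentially. prob {\<omega> \<in> space M. \<forall>j\<in>{1..k}. walk X j \<omega> < \<delta> * c k} \<le> \<eta>"
      using eventually_ge_at_top[of "A ^ r * Nm"]
    proof eventually_elim
      case (elim k)
      define t0 where "t0 = k div A ^ r"
      have Ar: "0 < A ^ r" using A by simp
      have t0: "Nm \<le> t0" using elim Ar by (simp add: t0_def less_eq_div_iff_mult_less_eq mult.commute)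
      define t where "t i = A ^ i * t0" for i
      define s where "s i = A' * t i" for i
      have tS: "t (Suc i) = t i + s i" for i by (simp add: t_def s_def A_def algebra_simps)
      have t_ge: "t0 \<le> t i" for i using A by (simp add: t_def)
      have s_ge: "t i \<le> s i" for i using A' by (simp add: s_def)
      have t_le: "t i \<le> k" if "i \<le> r" for i
      proof -
        have "t i \<le> A ^ r * t0" unfolding t_def using that A by (intro mult_le_mono1 power_increasing) auto
        also have "\<dots> \<le> k" by (simp add: t0_def)
        finally show ?thesis .
      qed
      define G where "G i = {\<omega> \<in> space M. bsum {t i + 1..t (Suc i)} \<omega> \<le> a * c (s i)}" for i
      define H where "H i = {\<omega> \<in> space M. a / 2 * c (s i) \<le> \<bar>walk X (t i) \<omega>\<bar>}" for i
      have G_block: "G i \<in> sets (block_algebra {t i + 1..t (Suc i)})" for i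
      proof -
        have [measurable]: "bsum {t i + 1..t (Suc i)} \<in> borel_measurable (block_algebra {t i + 1..t (Suc i)})"
          by (rule bsum_measurable_block) simp
        have "{\<omega> \<in> space (block_algebra {t i + 1..t (Suc i)}). bsum {t i + 1..t (Suc i)} \<omega> \<le> a * c (s i)}
          \<in> sets (block_algebra {t i + 1..t (Suc i)})" by measurable
        then show ?thesis by (simp add: G_def)
      qed
      have G_ev: "G i \<in> events" for i
        using G_block block_algebra_subset_events[of "{t i + 1..t (Suc i)}"] by auto
      have GI_block: "space M \<inter> (\<Inter>i<m. G i) \<in> sets (block_algebra {1..t m})" for m
      proof -
        have "G i \<in> sets (block_algebra {1..t m})" if "i < m" for i
        proof -
          have "t (Suc i) \<le> t m" unfolding t_def using that A by (intro mult_le_mono1 power_increasing) auto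
          then have "{t i + 1..t (Suc i)} \<subseteq> {1..t m}" by auto
          from block_algebra_mono[OF this] G_block show ?thesis by blast
        qed
        then have "{\<omega> \<in> space (block_algebra {1..t m}). \<forall>i\<in>{..<m}. \<omega> \<in> G i} \<in> sets (block_algebra {1..t m})"
          by (intro sets.sets_Collect_finite_All) (auto simp: G_def Int_def[symmetric] intro: sets.Int_space_eq1)
        then show ?thesis by (simp add: Int_def)
      qed
      have PG: "prob (G i) \<le> 1 - q" for i
      proof -
        have [measurable]: "bsum {t i + 1..t (Suc i)} \<in> borel_measurable M" by (rule bsum_measurable) auto
        have "space M - G i = {\<omega> \<in> space M. bsum {t i + 1..t (Suc i)} \<omega> \<in> {a * c (s i)<..}}"
          by (auto simp: G_def)
        then have "1 - prob (G i) = prob {\<omega> \<in> space M. bsum {t i + 1..t (Suc i)} \<omega> \<in> {a * c (s i)<..}}"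
          using prob_compl[OF G_ev[of i]] by simp
        also have "\<dots> = prob {\<omega> \<in> space M. a * c (s i) < walk X (s i) \<omega>}"
          using prob_bsum_eq_walk[of "{t i + 1..t (Suc i)}" "{a * c (s i)<..}"] by (simp add: tS)
        also have "\<dots> \<ge> q" using Nm t0 t_ge[of i] s_ge[of i] by (intro N1) linarith
        finally show ?thesis by simp
      qed
      have PI: "prob (space M \<inter> (\<Inter>i<m. G i)) \<le> (1 - q) ^ m" for m
      proof (induction m)
        case (Suc m)
        have "space M \<inter> (\<Inter>i<Suc m. G i) = (space M \<inter> (\<Inter>i<m. G i)) \<inter> G m"
          by (auto simp: less_Suc_eq)
        also have "prob \<dots> = prob (space M \<inter> (\<Inter>i<m. G i)) * prob (G m)"
          by (rule block_indep[OF _ _ _ GI_block G_block]) auto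
        also have "\<dots> \<le> (1 - q) ^ m * (1 - q)" using q by (intro mult_mono Suc PG) auto
        finally show ?case by (simp add: mult.commute)
      qed simp
      have PH: "prob (H i) \<le> \<eta> / (2 * real r)" for i
        unfolding H_def
      proof (rule N2)
        show "N2 \<le> s i" using Nm t0 t_ge[of i] s_ge[of i] by linarith
      qed (simp add: s_def)
      have low: "\<delta> * c k \<le> a / 2 * c (s i)" for i
      proof -
        have "k < A ^ r * (t0 + 1)" using dividend_less_times_div[OF Ar, of k] by (simp add: t0_def)
        also have "\<dots> \<le> (2 * A ^ r) * t0" using t0 Nm(1) by (simp add: algebra_simps)
        also have "\<dots> \<le> 2 ^ v * t0" using v by (intro mult_le_mono1) auto
        finally have "c k \<le> c (2 ^ v * t0)" using elim Ar Nm(1) by (intro L.c_le) (auto intro: order_trans[OF _ elim])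
        also have "\<dots> \<le> K ^ v * c t0" using t0 Nm by (intro pow) auto
        finally have "\<delta> * c k \<le> \<delta> * (K ^ v * c t0)" using \<open>0 < \<delta>\<close> by (intro mult_left_mono) auto
        also have "\<dots> = a / 2 * c t0" using K by (simp add: \<delta>_def)
        also have "\<dots> \<le> a / 2 * c (s i)"
          using a t0 Nm(1) t_ge[of i] s_ge[of i] by (intro mult_left_mono L.c_le) auto
        finally show ?thesis .
      qed
      have sub: "{\<omega> \<in> space M. \<forall>j\<in>{1..k}. walk X j \<omega> < \<delta> * c k} \<subseteq> (space M \<inter> (\<Inter>i<r. G i)) \<union> (\<Union>i<r. H i)"
      proof
        fix \<omega> assume w: "\<omega> \<in> {\<omega> \<in> space M. \<forall>j\<in>{1..k}. walk X j \<omega> < \<delta> * c k}"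
        show "\<omega> \<in> (space M \<inter> (\<Inter>i<r. G i)) \<union> (\<Union>i<r. H i)"
        proof (rule ccontr)
          assume n: "\<omega> \<notin> (space M \<inter> (\<Inter>i<r. G i)) \<union> (\<Union>i<r. H i)"
          then obtain i where i: "i < r" "\<omega> \<notin> G i" "\<omega> \<notin> H i" using w by auto
          then have "a * c (s i) < bsum {t i + 1..t (Suc i)} \<omega>" "\<bar>walk X (t i) \<omega>\<bar> < a / 2 * c (s i)"
            using w by (auto simp: G_def H_def)
          then have "a / 2 * c (s i) < walk X (t (Suc i)) \<omega>"
            using walk_split[of "t i" "t (Suc i)" \<omega>] by (simp add: tS)
          moreover have "t (Suc i) \<in> {1..k}" using t_le[of "Suc i"] i t_ge[of "Suc i"] t0 Nm(1) by auto
          ultimately show False using w low[of i] by force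
        qed
      qed
      have H_ev: "H i \<in> events" for i unfolding H_def by measurable
      have I_ev: "space M \<inter> (\<Inter>i<r. G i) \<in> events"
        using GI_block[of r] block_algebra_subset_events[of "{1..t r}"] by auto
      have "prob {\<omega> \<in> space M. \<forall>j\<in>{1..k}. walk X j \<omega> < \<delta> * c k} \<le> prob ((space M \<inter> (\<Inter>i<r. G i)) \<union> (\<Union>i<r. H i))"
        using H_ev I_ev by (intro finite_measure_mono[OF sub]) auto
      also have "\<dots> \<le> prob (space M \<inter> (\<Inter>i<r. G i)) + prob (\<Union>i<r. H i)"
        using H_ev I_ev by (intro measure_Un_le) auto
      also have "\<dots> \<le> (1 - q) ^ r + (\<Sum>i<r. prob (H i))"
        using H_ev by (intro add_mono PI finite_measure_subadditive_finite) auto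
      also have "\<dots> \<le> \<eta> / 2 + (\<Sum>i<r. \<eta> / (2 * real r))"
        by (intro add_mono r sum_mono PH)
      also have "\<dots> = \<eta>" using r by simp
      finally show ?case .
    qed
  qed
qed

end

section \<open>The walk conditioned to stay positive\<close>

lemma tau_minus_greater_iff: "tau_minus X \<omega> > enat n \<longleftrightarrow> (\<forall>j\<in>{1..n}. 0 < walk X j \<omega>)"
proof
  assume t: "tau_minus X \<omega> > enat n"
  show "\<forall>j\<in>{1..n}. 0 < walk X j \<omega>"
  proof (rule ballI, rule ccontr)
    fix j assume j: "j \<in> {1..n}" "\<not> 0 < walk X j \<omega>"
    then have "tau_minus X \<omega> \<le> enat j" unfolding tau_minus_def by (intro Inf_lower) auto
    then have "enat n < enat j" using t by (rule less_le_trans[rotated])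
    then show False using j by simp
  qed
next
  assume pos: "\<forall>j\<in>{1..n}. 0 < walk X j \<omega>"
  have "enat (Suc n) \<le> tau_minus X \<omega>"
    unfolding tau_minus_def
  proof (rule Inf_greatest)
    fix k assume "k \<in> enat ` {n. 1 \<le> n \<and> walk X n \<omega> \<le> 0}"
    then obtain m where m: "k = enat m" "1 \<le> m" "walk X m \<omega> \<le> 0" by auto
    with pos have "\<not> m \<le> n" by force
    then show "enat (Suc n) \<le> k" using m by simp
  qed
  then show "tau_minus X \<omega> > enat n" by (rule less_le_trans[rotated]) simp
qed

text \<open>Polya's argument: monotone functions that converge to a continuous limit at the points
  of a fine grid are controlled between grid points.\<close>

lemma polya_uniform_cdf:
  assumes \<mu>: "\<And>n. finite_borel_measure (\<mu> n)" and \<nu>: "finite_borel_measure \<nu>"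
    and conv: "\<And>x. (\<lambda>n. cdf (\<mu> n) x) \<longlonglongrightarrow> cdf \<nu> x" and cont: "continuous_on {a..b + 1} (cdf \<nu>)"
    and e: "0 < e"
  shows "\<forall>\<^sub>F n in sequentially. \<forall>u\<in>{a..b}. \<bar>cdf (\<mu> n) u - cdf \<nu> u\<bar> < e"
proof -
  have "uniformly_continuous_on {a..b + 1} (cdf \<nu>)"
    by (rule compact_uniformly_continuous[OF cont]) simp
  then obtain d where d: "0 < d"
    "\<And>x y. x \<in> {a..b + 1} \<Longrightarrow> y \<in> {a..b + 1} \<Longrightarrow> dist y x < d \<Longrightarrow> dist (cdf \<nu> y) (cdf \<nu> x) < e / 2"
    using e unfolding uniformly_continuous_on_def by (metis half_gt_zero)
  \<comment> \<open>The mesh is at most 1, so the grid point following \<open>u \<le> b\<close>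
    still lies in \<open>[a, b + 1]\<close>.\<close>
  define h where "h = min (d / 2) 1"
  have h: "0 < h" "h < d" "h \<le> 1" using d by (auto simp: h_def)
  define N where "N = nat \<lceil>(b - a) / h\<rceil>"
  define g where "g i = a + real i * h" for i
  have "0 < e / 2" using e by simp
  then have "\<forall>\<^sub>F n in sequentially. \<forall>i\<in>{..N + 1}. dist (cdf (\<mu> n) (g i)) (cdf \<nu> (g i)) < e / 2"
    by (intro eventually_ball_finite finite_atMost ballI tendstoD[OF conv])
  then show ?thesis
  proof eventually_elim
    case (elim n)
    show ?case
    proof
      fix u assume u: "u \<in> {a..b}"
      define i where "i = nat \<lfloor>(u - a) / h\<rfloor>"
      have "0 \<le> (u - a) / h" using u h by simp
      then have i: "real i \<le> (u - a) / h" "(u - a) / h < real i + 1" unfolding i_def by linarith+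
      have iN: "i \<le> N"
      proof -
        have "(u - a) / h \<le> (b - a) / h" using u h by (intro divide_right_mono) auto
        then show ?thesis unfolding i_def N_def by (intro nat_mono) linarith
      qed
      have gi: "g i \<le> u" "u < g (Suc i)" "g (Suc i) = g i + h"
        using i h by (auto simp: g_def pos_le_divide_eq pos_divide_less_eq algebra_simps)
      have ga: "a \<le> g i" using h by (simp add: g_def)
      have "dist (cdf \<nu> (g i)) (cdf \<nu> u) < e / 2" "dist (cdf \<nu> (g (Suc i))) (cdf \<nu> u) < e / 2"
        by (rule d(2); use gi ga u h in \<open>auto simp: dist_real_def\<close>)+
      moreover have "dist (cdf (\<mu> n) (g i)) (cdf \<nu> (g i)) < e / 2"
        "dist (cdf (\<mu> n) (g (Suc i))) (cdf \<nu> (g (Suc i))) < e / 2"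
        using elim iN by auto
      moreover have "cdf (\<mu> n) (g i) \<le> cdf (\<mu> n) u" "cdf (\<mu> n) u \<le> cdf (\<mu> n) (g (Suc i))"
        using gi by (auto intro!: finite_borel_measure.cdf_nondecreasing[OF \<mu>])
      ultimately show "\<bar>cdf (\<mu> n) u - cdf \<nu> u\<bar> < e"
        unfolding dist_real_def by linarith
    qed
  qed
qed

section \<open>Conditioned laws and survival probabilities\<close>

locale conditioned_walk = attracted_walk M X F c \<kappa> \<alpha> \<nu>
  for M :: "'a measure" and X :: "nat \<Rightarrow> 'a \<Rightarrow> real" and F c \<kappa> \<alpha> \<nu> +
  fixes p :: "real \<Rightarrow> real"
  assumes limit_p: "limit_density M X c p"
begin

definition pos :: "nat \<Rightarrow> 'a set" where
  "pos n = {\<omega> \<in> space M. \<forall>j\<in>{1..n}. 0 < walk X j \<omega>}"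

definition surv :: "nat \<Rightarrow> real" where "surv n = prob (pos n)"

definition limit_law :: "real measure" where
  "limit_law = density lborel (\<lambda>x. ennreal (indicator {0<..} x * p x))"

lemma p_cont: "continuous_on {0<..} p" and p_nonneg: "0 < x \<Longrightarrow> 0 \<le> p x"
  and limit_law_prob: "prob_space limit_law"
  and limit_law_conv: "weak_conv_m (conditioned_law M X c) limit_law"
  using limit_p unfolding limit_density_def limit_law_def Let_def by auto

lemma p_measurable [measurable]: "(\<lambda>x. indicator {0<..} x * p x) \<in> borel_measurable borel"
  using borel_measurable_continuous_on_indicator[OF _ p_cont] by simp

lemma limit_law_distribution: "real_distribution limit_law"
  using limit_law_prob unfolding real_distribution_def real_distribution_axioms_def
  by (simp add: limit_law_def)

lemma limit_law_atomless: "measure limit_law {x} = 0"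
proof -
  have "emeasure limit_law {x} = 0"
    unfolding limit_law_def
    by (subst emeasure_density) (auto simp: nn_integral_0_iff_AE intro: AE_mp[OF AE_lborel_singleton[of x]])
  then show ?thesis by (simp add: measure_def)
qed

lemma limit_law_cdf_cont: "isCont (cdf limit_law) x"
proof -
  interpret LL: real_distribution limit_law by (rule limit_law_distribution)
  show ?thesis by (simp add: LL.isCont_cdf limit_law_atomless)
qed

lemma limit_law_interval_bounds:
  assumes u: "0 < u" "u \<le> v" and p: "\<And>x. u \<le> x \<Longrightarrow> x \<le> v \<Longrightarrow> lo \<le> p x \<and> p x \<le> hi"
  shows "lo * (v - u) \<le> cdf limit_law v - cdf limit_law u" "cdf limit_law v - cdf limit_law u \<le> hi * (v - u)"
proof -
  interpret LL: real_distribution limit_law by (rule limit_law_distribution)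
  have diff: "cdf limit_law v - cdf limit_law u = measure limit_law {u<..v}"
    using u by (cases "u = v") (auto simp: LL.cdf_diff_eq)
  have em: "emeasure limit_law {u<..v} = (\<integral>\<^sup>+x. ennreal (indicator {0<..} x * p x) * indicator {u<..v} x \<partial>lborel)"
    unfolding limit_law_def by (rule emeasure_density) auto
  have hi0: "0 \<le> hi" using p[of u] p_nonneg[of u] u by linarith
  have const: "(\<integral>\<^sup>+x. ennreal k * indicator {u<..v} x \<partial>lborel) = ennreal (k * (v - u))" if "0 \<le> k" for k
    using u that by (simp add: nn_integral_cmult_indicator ennreal_mult)
  have "emeasure limit_law {u<..v} \<le> (\<integral>\<^sup>+x. ennreal hi * indicator {u<..v} x \<partial>lborel)"
    unfolding em using u p by (intro nn_integral_mono) (auto simp: indicator_def intro!: ennreal_leI)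
  then have "ennreal (measure limit_law {u<..v}) \<le> ennreal (hi * (v - u))"
    unfolding const[OF hi0] by (simp add: LL.emeasure_eq_measure)
  then show "cdf limit_law v - cdf limit_law u \<le> hi * (v - u)"
    unfolding diff using hi0 u by (subst (asm) ennreal_le_iff) auto
  \<comment> \<open>\<open>ennreal\<close> would truncate a negative \<open>lo\<close>, so it is
    replaced by \<open>max 0 lo\<close>, which is still a lower bound for \<open>p\<close>.\<close>
  have "(\<integral>\<^sup>+x. ennreal (max 0 lo) * indicator {u<..v} x \<partial>lborel) \<le> emeasure limit_law {u<..v}"
    unfolding em using u p p_nonneg by (intro nn_integral_mono) (auto simp: indicator_def intro!: ennreal_leI)
  then have "ennreal (max 0 lo * (v - u)) \<le> ennreal (measure limit_law {u<..v})"
    by (subst (asm) const) (auto simp: LL.emeasure_eq_measure)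
  then have "max 0 lo * (v - u) \<le> measure limit_law {u<..v}"
    by (subst (asm) ennreal_le_iff) auto
  moreover have "lo * (v - u) \<le> max 0 lo * (v - u)" using u by (intro mult_right_mono) auto
  ultimately show "lo * (v - u) \<le> cdf limit_law v - cdf limit_law u" unfolding diff by linarith
qed

lemma pos_block: "pos n \<in> sets (block_algebra {1..n})"
proof -
  have [measurable]: "i \<le> n \<Longrightarrow> walk X i \<in> borel_measurable (block_algebra {1..n})" for i
    by (rule walk_measurable_block)
  have "{\<omega> \<in> space (block_algebra {1..n}). \<forall>j\<in>{1..n}. 0 < walk X j \<omega>} \<in> sets (block_algebra {1..n})"
    by measurable
  then show ?thesis by (simp add: pos_def)
qed

lemma pos_event [measurable]: "pos n \<in> events"
  using pos_block[of n] block_algebra_subset_events[of "{1..n}"] by auto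

lemma pos_antimono: "m \<le> n \<Longrightarrow> pos n \<subseteq> pos m"
  by (auto simp: pos_def)

lemma surv_antimono: "m \<le> n \<Longrightarrow> surv n \<le> surv m"
  unfolding surv_def by (intro finite_measure_mono pos_antimono pos_event)

lemma surv_nonneg: "0 \<le> surv n" by (simp add: surv_def)

lemma conditioned_law_eq:
  "conditioned_law M X c n = distr (uniform_measure M (pos n)) borel (\<lambda>\<omega>. walk X n \<omega> / c n)"
  unfolding conditioned_law_def tau_minus_greater_iff pos_def ..

lemma scaled_preimage [measurable]: "B \<in> sets borel \<Longrightarrow> {\<omega> \<in> space M. walk X n \<omega> / c n \<in> B} \<in> events"
  using measurable_sets[of "\<lambda>\<omega>. walk X n \<omega> / c n" M borel B] by (simp add: vimage_def Int_def conj_commute)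

lemma conditioned_law_emeasure:
  assumes "B \<in> sets borel"
  shows "emeasure (conditioned_law M X c n) B
    = emeasure M (pos n \<inter> {\<omega> \<in> space M. walk X n \<omega> / c n \<in> B}) / emeasure M (pos n)"
proof -
  have "(\<lambda>\<omega>. walk X n \<omega> / c n) \<in> measurable (uniform_measure M (pos n)) borel"
    by (simp add: measurable_cong_sets[OF sets_uniform_measure refl])
  then have "emeasure (conditioned_law M X c n) B
    = emeasure (uniform_measure M (pos n)) {\<omega> \<in> space M. walk X n \<omega> / c n \<in> B}"
    unfolding conditioned_law_eq using assms
    by (subst emeasure_distr) (simp_all add: vimage_def Int_def conj_commute)
  also have "\<dots> = emeasure M (pos n \<inter> {\<omega> \<in> space M. walk X n \<omega> / c n \<in> B}) / emeasure M (pos n)"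
    by (rule emeasure_uniform_measure[OF pos_event scaled_preimage[OF assms]])
  finally show ?thesis .
qed

lemma conditioned_law_measure:
  assumes "B \<in> sets borel"
  shows "measure (conditioned_law M X c n) B
    = prob (pos n \<inter> {\<omega> \<in> space M. walk X n \<omega> / c n \<in> B}) / surv n"
proof (cases "surv n = 0")
  \<comment> \<open>Conditioning on a null event: both quotients are 0 by the conventions for
    division by 0, which is what the proof of \<open>surv_pos\<close> exploits.\<close>
  case True
  then have "emeasure M (pos n) = 0" by (simp add: surv_def emeasure_eq_measure)
  moreover from this have "emeasure M (pos n \<inter> {\<omega> \<in> space M. walk X n \<omega> / c n \<in> B}) = 0"
    using emeasure_mono[of "pos n \<inter> {\<omega> \<in> space M. walk X n \<omega> / c n \<in> B}" "pos n" M] by simp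
  ultimately show ?thesis using True by (simp add: measure_def conditioned_law_emeasure[OF assms])
next
  case False
  then have "0 < surv n" using surv_nonneg[of n] by simp
  then show ?thesis unfolding measure_def[of "conditioned_law M X c n"] conditioned_law_emeasure[OF assms]
    by (simp add: emeasure_eq_measure surv_def divide_ennreal)
qed

text \<open>If \<open>surv k\<close> were 0, the conditioned law would be the zero measure, against
  convergence to a probability law. This gives positivity at arbitrarily large times, and
  \<open>surv\<close> is antitone.\<close>

lemma surv_pos: "0 < surv n"
proof -
  interpret LL: real_distribution limit_law by (rule limit_law_distribution)
  have "\<forall>\<^sub>F x in at_top. 0 < cdf limit_law x"
    by (intro order_tendstoD(1)[OF LL.cdf_lim_at_top_prob]) auto
  then obtain x where x: "0 < cdf limit_law x" by (auto simp: eventually_at_top_linorder)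
  have "(\<lambda>n. cdf (conditioned_law M X c n) x) \<longlonglongrightarrow> cdf limit_law x"
    using limit_law_conv limit_law_cdf_cont by (simp add: weak_conv_m_def weak_conv_def)
  from order_tendstoD(1)[OF this x] have "\<forall>\<^sub>F k in sequentially. 0 < cdf (conditioned_law M X c k) x" .
  then have "\<forall>\<^sub>F k in sequentially. n \<le> k \<and> 0 < cdf (conditioned_law M X c k) x"
    using eventually_ge_at_top[of n] by eventually_elim auto
  then obtain k where k: "n \<le> k" "0 < cdf (conditioned_law M X c k) x"
    by (auto simp: eventually_sequentially)
  have "surv k \<noteq> 0" using k(2) by (auto simp: cdf_def conditioned_law_measure)
  then have "0 < surv k" using surv_nonneg[of k] by simp
  then show ?thesis using surv_antimono[OF k(1)] by simp
qed

lemma conditioned_law_distribution: "real_distribution (conditioned_law M X c n)"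
proof -
  have "emeasure M (pos n) \<noteq> 0" using surv_pos[of n] by (simp add: surv_def emeasure_eq_measure)
  then interpret U: prob_space "uniform_measure M (pos n)"
    by (intro prob_space_uniform_measure) (auto simp: emeasure_eq_measure)
  show ?thesis unfolding conditioned_law_eq
    by (rule U.real_distribution_distr) (simp add: measurable_cong_sets[OF sets_uniform_measure refl])
qed

lemma conditioned_cdf_conv: "(\<lambda>n. cdf (conditioned_law M X c n) x) \<longlonglongrightarrow> cdf limit_law x"
  using limit_law_conv limit_law_cdf_cont by (simp add: weak_conv_m_def weak_conv_def)

lemma conditioned_prob:
  "1 \<le> n \<Longrightarrow> prob (pos n \<inter> {\<omega> \<in> space M. walk X n \<omega> \<le> x * c n}) = cdf (conditioned_law M X c n) x * surv n"
  using surv_pos[of n] L.c_pos[of n] by (simp add: cdf_def conditioned_law_measure pos_divide_le_eq)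

text \<open>The limit law has no mass on \<open>{..0}\<close> and a continuous distribution
  function, so some level of order \<open>c n\<close> is exceeded with conditional probability at
  least 1/2.\<close>

lemma conditioned_median:
  "\<exists>\<delta>>0. \<forall>\<^sub>F n in sequentially. surv n / 2 \<le> prob (pos n \<inter> {\<omega> \<in> space M. \<delta> * c n < walk X n \<omega>})"
proof -
  interpret L': real_distribution limit_law by (rule limit_law_distribution)
  have "emeasure limit_law {..0} = 0"
  proof -
    have "(\<integral>\<^sup>+x. ennreal (indicator {0<..} x * p x) * indicator {..0} x \<partial>lborel) = (\<integral>\<^sup>+x. 0 \<partial>(lborel :: real measure))"
      by (intro nn_integral_cong) (auto simp: indicator_def)
    then show ?thesis unfolding limit_law_def by (subst emeasure_density) simp_all
  qed
  then have c0: "cdf limit_law 0 = 0" by (simp add: cdf_def measure_def)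
  have "(cdf limit_law \<longlongrightarrow> cdf limit_law 0) (at 0)" using limit_law_cdf_cont[of 0] by (simp add: isCont_def)
  then have "\<forall>\<^sub>F x in at 0. cdf limit_law x < 1 / 2" unfolding c0 by (rule order_tendstoD) simp
  then obtain d where d: "0 < d" "\<And>x. x \<noteq> 0 \<Longrightarrow> dist x 0 < d \<Longrightarrow> cdf limit_law x < 1 / 2"
    by (auto simp: eventually_at)
  have "cdf limit_law (d / 2) < 1 / 2" using d by (intro d) auto
  from order_tendstoD(2)[OF conditioned_cdf_conv this] eventually_ge_at_top[of 1]
  have "\<forall>\<^sub>F n in sequentially. surv n / 2 \<le> prob (pos n \<inter> {\<omega> \<in> space M. d / 2 * c n < walk X n \<omega>})"
  proof eventually_elim
    case (elim n)
    have "prob (pos n \<inter> {\<omega> \<in> space M. walk X n \<omega> \<le> d / 2 * c n})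
      + prob (pos n \<inter> {\<omega> \<in> space M. d / 2 * c n < walk X n \<omega>}) = surv n"
      unfolding surv_def
      by (subst finite_measure_Union[symmetric]) (auto intro!: arg_cong[where f = prob] simp: pos_def)
    moreover have "cdf (conditioned_law M X c n) (d / 2) * surv n \<le> 1 / 2 * surv n"
      using elim surv_pos[of n] by (intro mult_right_mono) auto
    ultimately show ?case using conditioned_prob[OF elim(2), of "d / 2"] by simp
  qed
  then show ?thesis using d by (intro exI[of _ "d / 2"]) auto
qed

lemma conditioned_tail:
  assumes \<eta>: "0 < \<eta>"
  shows "\<exists>K>0. \<forall>\<^sub>F n in sequentially. prob (pos n \<inter> {\<omega> \<in> space M. K * c n < walk X n \<omega>}) \<le> \<eta> * surv n"
proof -
  interpret L': real_distribution limit_law by (rule limit_law_distribution)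
  have "\<forall>\<^sub>F x in at_top. 1 - \<eta> < cdf limit_law x"
    using \<eta> by (intro order_tendstoD(1)[OF L'.cdf_lim_at_top_prob]) auto
  then obtain K0 where K0: "\<And>x. K0 \<le> x \<Longrightarrow> 1 - \<eta> < cdf limit_law x" by (auto simp: eventually_at_top_linorder)
  define K where "K = max K0 1"
  have "1 - \<eta> < cdf limit_law K" by (intro K0) (simp add: K_def)
  from order_tendstoD(1)[OF conditioned_cdf_conv this] eventually_ge_at_top[of 1]
  have "\<forall>\<^sub>F n in sequentially. prob (pos n \<inter> {\<omega> \<in> space M. K * c n < walk X n \<omega>}) \<le> \<eta> * surv n"
  proof eventually_elim
    case (elim n)
    have "prob (pos n \<inter> {\<omega> \<in> space M. walk X n \<omega> \<le> K * c n})
      + prob (pos n \<inter> {\<omega> \<in> space M. K * c n < walk X n \<omega>}) = surv n"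
      unfolding surv_def
      by (subst finite_measure_Union[symmetric]) (auto intro!: arg_cong[where f = prob] simp: pos_def)
    moreover have "(1 - \<eta>) * surv n \<le> cdf (conditioned_law M X c n) K * surv n"
      using elim surv_pos[of n] by (intro mult_right_mono) auto
    ultimately show ?case using conditioned_prob[OF elim(2), of K] by (simp add: algebra_simps)
  qed
  then show ?thesis by (intro exI[of _ K]) (simp add: K_def)
qed

text \<open>Being above \<open>\<delta> * c m\<close> at time \<open>m\<close> costs a factor 2 by
  the conditioned median; independently of that, the next \<open>m div A\<close> partial sums stay
  below \<open>\<delta> * c m\<close> in modulus with probability at least 1/2.\<close>

lemma surv_extend:
  "\<exists>A N. 1 \<le> A \<and> (\<forall>m\<ge>N. surv m / 4 \<le> surv (m + m div A))"
proof -
  obtain \<delta> where \<delta>: "0 < \<delta>"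
    and med: "\<forall>\<^sub>F n in sequentially. surv n / 2 \<le> prob (pos n \<inter> {\<omega> \<in> space M. \<delta> * c n < walk X n \<omega>})"
    using conditioned_median by blast
  have "0 < (1 / 2 :: real)" by simp
  from early_maximum_small[OF \<delta> this] obtain A :: nat where A: "1 \<le> A"
    and max: "\<forall>\<^sub>F n in sequentially. \<forall>k. A * k \<le> n \<longrightarrow>
      1 - 1 / 2 \<le> prob {\<omega> \<in> space M. \<forall>j\<in>{1..k}. \<bar>walk X j \<omega>\<bar> < \<delta> * c n}" by blast
  from med max have "\<forall>\<^sub>F m in sequentially. surv m / 4 \<le> surv (m + m div A)"
  proof eventually_elim
    case (elim m)
    define k where "k = m div A"
    define E where "E = {\<omega> \<in> space M. \<forall>j\<in>{1..k}. bsum {m + 1..m + j} \<omega> \<in> {-(\<delta> * c m)<..<\<delta> * c m}}"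
    define D where "D = pos m \<inter> {\<omega> \<in> space M. \<delta> * c m < walk X m \<omega>}"
    have D: "D \<in> sets (block_algebra {1..m})"
    proof -
      have [measurable]: "walk X m \<in> borel_measurable (block_algebra {1..m})" by (rule walk_measurable_block) simp
      have "{\<omega> \<in> space (block_algebra {1..m}). \<delta> * c m < walk X m \<omega>} \<in> sets (block_algebra {1..m})" by measurable
      then show ?thesis unfolding D_def using pos_block by (intro sets.Int) simp_all
    qed
    have E: "E \<in> sets (block_algebra {m + 1..m + k})"
    proof -
      have [measurable]: "j \<in> {1..k} \<Longrightarrow> bsum {m + 1..m + j} \<in> borel_measurable (block_algebra {m + 1..m + k})" for j
        by (rule bsum_measurable_block) auto
      have "{\<omega> \<in> space (block_algebra {m + 1..m + k}). \<forall>j\<in>{1..k}. bsum {m + 1..m + j} \<omega> \<in> {-(\<delta> * c m)<..<\<delta> * c m}}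
        \<in> sets (block_algebra {m + 1..m + k})" by measurable
      then show ?thesis by (simp add: E_def)
    qed
    have "1 / 2 \<le> prob {\<omega> \<in> space M. \<forall>j\<in>{1..k}. \<bar>walk X j \<omega>\<bar> < \<delta> * c m}"
      using elim(2) by (auto simp: k_def)
    also have "{\<omega> \<in> space M. \<forall>j\<in>{1..k}. \<bar>walk X j \<omega>\<bar> < \<delta> * c m}
      = {\<omega> \<in> space M. \<forall>j\<in>{1..k}. walk X j \<omega> \<in> {-(\<delta> * c m)<..<\<delta> * c m}}" by (auto simp: abs_less_iff)
    also have "prob \<dots> = prob E"
      unfolding E_def by (rule prob_shifted_path[symmetric]) simp
    finally have PE: "1 / 2 \<le> prob E" .
    have "surv m / 4 = surv m / 2 * (1 / 2)" by simp
    also have "\<dots> \<le> prob D * prob E"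
      using elim(1) PE surv_nonneg[of m] by (intro mult_mono) (auto simp: D_def)
    also have "\<dots> = prob (D \<inter> E)"
      by (rule block_indep[OF _ _ _ D E, symmetric]) auto
    also have "\<dots> \<le> surv (m + k)" unfolding surv_def
    proof (intro finite_measure_mono pos_event subsetI)
      fix \<omega> assume w: "\<omega> \<in> D \<inter> E"
      have "0 < walk X j \<omega>" if j: "j \<in> {1..m + k}" for j
      proof (cases "j \<le> m")
        case True
        then show ?thesis using w j by (auto simp: D_def pos_def)
      next
        case False
        then have "j - m \<in> {1..k}" using j by auto
        then have "bsum {m + 1..m + (j - m)} \<omega> \<in> {-(\<delta> * c m)<..<\<delta> * c m}" using w unfolding E_def by blast
        then have "-(\<delta> * c m) < bsum {m + 1..j} \<omega>" using False by simp
        then show ?thesis using w walk_split[of m j \<omega>] False by (auto simp: D_def)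
      qed
      then show "\<omega> \<in> pos (m + k)" using w by (auto simp: pos_def D_def)
    qed
    finally show ?case by (simp add: k_def)
  qed
  then show ?thesis using A by (auto simp: eventually_sequentially)
qed

text \<open>Each extension multiplies the time by at least a fixed \<open>b > 1\<close> and costs a
  factor 4, so finitely many bridge a ratio 8. This ratio suits blocks of length
  \<open>n div 4\<close>, as \<open>n \<le> 8 * (n div 4)\<close> once
  \<open>n \<ge> 4\<close>.\<close>

lemma surv_ratio:
  "\<exists>C>0. \<forall>\<^sub>F n in sequentially. \<forall>m. n \<le> 8 * m \<longrightarrow> surv m \<le> C * surv n"
proof -
  obtain A N where A: "1 \<le> A" and N: "\<And>m. N \<le> m \<Longrightarrow> surv m / 4 \<le> surv (m + m div A)"
    using surv_extend by blast
  define f where "f m = m + m div A" for m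
  have f_ge: "m \<le> f m" for m by (simp add: f_def)
  have f_iter_ge: "m \<le> (f ^^ i) m" for i m
    by (induction i) (auto intro: order_trans[OF _ f_ge])
  have iter: "surv m / 4 ^ i \<le> surv ((f ^^ i) m)" if "N \<le> m" for m i
  proof (induction i)
    case (Suc i)
    have "surv m / 4 ^ Suc i = surv m / 4 ^ i / 4" by simp
    also have "\<dots> \<le> surv ((f ^^ i) m) / 4" using Suc by simp
    also have "\<dots> \<le> surv (f ((f ^^ i) m))"
      using N[of "(f ^^ i) m"] le_trans[OF that f_iter_ge[of m i]] by (simp add: f_def[of "(f ^^ i) m"])
    finally show ?case by simp
  qed simp
  \<comment> \<open>For \<open>m \<ge> A\<close> the integer quotient \<open>m div A\<close> is at
    least \<open>m / (2 * A)\<close>.\<close>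
  define b where "b = 1 + 1 / (2 * real A)"
  have b: "1 < b" using A by (simp add: b_def)
  have fb: "b * real m \<le> real (f m)" if "A \<le> m" for m
  proof -
    define d where "d = m div A"
    have "1 \<le> d" using that A by (simp add: d_def Suc_le_eq div_greater_zero_iff)
    have "m < A * (d + 1)" using dividend_less_times_div[of A m] A by (simp add: d_def)
    also have "\<dots> \<le> A * (2 * d)" using \<open>1 \<le> d\<close> by (intro mult_le_mono2) simp
    finally have "real m \<le> real (A * (2 * d))" by (simp only: of_nat_le_iff less_imp_le)
    then have "real m / (2 * real A) \<le> real d" using A by (simp add: pos_divide_le_eq mult_ac)
    then show ?thesis by (simp add: f_def b_def d_def distrib_right)
  qed
  have grow: "b ^ i * real m \<le> real ((f ^^ i) m)" if "A \<le> m" for i m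
  proof (induction i)
    case (Suc i)
    have "b ^ Suc i * real m = b * (b ^ i * real m)" by simp
    also have "\<dots> \<le> b * real ((f ^^ i) m)" using Suc b by (intro mult_left_mono) auto
    also have "\<dots> \<le> real (f ((f ^^ i) m))" using that f_iter_ge[of m i] by (intro fb) simp
    finally show ?case by simp
  qed simp
  obtain I where I: "8 < b ^ I" using real_arch_pow[OF b] by blast
  show ?thesis
  proof (intro exI[of _ "4 ^ I"] conjI)
    show "\<forall>\<^sub>F n in sequentially. \<forall>m. n \<le> 8 * m \<longrightarrow> surv m \<le> 4 ^ I * surv n"
      using eventually_ge_at_top[of "8 * (N + A)"]
    proof eventually_elim
      case (elim n)
      show ?case
      proof (intro allI impI)
        fix m assume m: "n \<le> 8 * m"
        then have m': "N \<le> m" "A \<le> m" using elim by auto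
        have "real n \<le> 8 * real m" using m by linarith
        also have "\<dots> \<le> b ^ I * real m" using I by (intro mult_right_mono) auto
        also have "\<dots> \<le> real ((f ^^ I) m)" by (rule grow[OF m'(2)])
        finally have "n \<le> (f ^^ I) m" by simp
        then have "surv m / 4 ^ I \<le> surv n" using iter[OF m'(1), of I] surv_antimono by (meson order_trans)
        then show "surv m \<le> 4 ^ I * surv n" by (simp add: pos_divide_le_eq mult.commute)
      qed
    qed
  qed simp
qed

end

section \<open>Local estimates\<close>

context conditioned_walk
begin

definition win :: "nat \<Rightarrow> real \<Rightarrow> real \<Rightarrow> 'a set" where
  "win n x L = {\<omega> \<in> space M. walk X n \<omega> \<in> {x..<x + L}}"

lemma win_event [measurable]: "win n x L \<in> events"
  unfolding win_def by measurable

lemma bsum_in_window_eq: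
  assumes "I \<inter> J = {}" "I \<union> J = {1..n}"
  shows "{\<omega> \<in> space M. bsum J \<omega> \<in> {x - bsum I \<omega>..<x - bsum I \<omega> + L}} = win n x L"
proof -
  have "finite I" "finite J" using assms(2) by (metis finite_Un finite_atLeastAtMost)+
  then have "walk X n \<omega> = bsum I \<omega> + bsum J \<omega>" for \<omega>
    unfolding walk_eq_bsum assms(2)[symmetric] bsum_def using assms(1) by (rule sum.union_disjoint)
  then show ?thesis unfolding win_def by auto
qed

text \<open>Given the steps in \<open>I\<close>, the event asks the independent sum over
  \<open>J\<close> to hit a window in a known position, which costs \<open>1 / c n\<close> when
  \<open>J\<close> has a fixed proportion of the steps. \<open>J\<close> is arbitrary, since the
  spared block may also sit in the middle of the path.\<close>

lemma block_window_bound: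
  "\<exists>C>0. \<forall>L>0. \<forall>\<^sub>F n in sequentially. \<forall>I J A x. I \<inter> J = {} \<longrightarrow> I \<union> J = {1..n} \<longrightarrow> n \<le> 8 * card J \<longrightarrow>
    A \<in> sets (block_algebra I) \<longrightarrow> prob (A \<inter> win n x L) \<le> prob A * (C * L / c n)"
proof -
  have "0 < (1 / 8 :: real)" by simp
  from L.window_concentration[OF this] obtain C where C: "0 < C"
    "\<And>L. 0 < L \<Longrightarrow> \<forall>\<^sub>F n in sequentially. \<forall>k \<mu> x. 1 / 8 * real n \<le> real k \<longrightarrow>
      real_distribution \<mu> \<longrightarrow> (\<forall>t. char \<mu> t = char F t ^ k) \<longrightarrow> measure \<mu> {x..<x + L} \<le> C * L / c n" by blast
  show ?thesis
  proof (intro exI[of _ C] conjI allI impI C(1))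
    fix L :: real assume "0 < L"
    from C(2)[OF this]
    show "\<forall>\<^sub>F n in sequentially. \<forall>I J A x. I \<inter> J = {} \<longrightarrow> I \<union> J = {1..n} \<longrightarrow> n \<le> 8 * card J \<longrightarrow>
      A \<in> sets (block_algebra I) \<longrightarrow> prob (A \<inter> win n x L) \<le> prob A * (C * L / c n)"
    proof eventually_elim
      case (elim n)
      show ?case
      proof (intro allI impI)
        fix I J A x
        assume IJ: "I \<inter> J = {}" "I \<union> J = {1..n}" and J: "n \<le> 8 * card J" and A: "A \<in> sets (block_algebra I)"
        have sub: "I \<subseteq> {1..}" "J \<subseteq> {1..}" using IJ(2) by auto
        have fin: "finite J" using IJ(2) by (metis finite_Un finite_atLeastAtMost)
        have h: "(\<lambda>\<omega>. x - bsum I \<omega>) \<in> borel_measurable (block_algebra I)"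
          by (intro borel_measurable_diff bsum_measurable_block) auto
        show "prob (A \<inter> win n x L) \<le> prob A * (C * L / c n)"
          unfolding bsum_in_window_eq[OF IJ, symmetric]
        proof (rule block_smoothing_le[OF IJ(1) sub A h])
          fix y
          have "1 / 8 * real n \<le> real (card J)" using J by linarith
          then show "measure (distr M borel (bsum J)) {y..<y + L} \<le> C * L / c n"
            using elim bsum_distribution[OF sub(2)] char_bsum[OF fin sub(2)] by blast
        qed
      qed
    qed
  qed
qed

text \<open>Positivity is kept on the first half only; the second half is free to spread out the end
  point, and \<open>surv\<close> at half time is comparable with \<open>surv n\<close>.\<close>

lemma local_upper_bound:
  "\<exists>C>0. \<forall>\<Delta>>0. \<forall>\<^sub>F n in sequentially. \<forall>x. prob (pos n \<inter> win n x \<Delta>) \<le> C * \<Delta> * surv n / c n"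
proof -
  obtain C where C: "0 < C" "\<And>L. 0 < L \<Longrightarrow> \<forall>\<^sub>F n in sequentially. \<forall>I J A x. I \<inter> J = {} \<longrightarrow> I \<union> J = {1..n} \<longrightarrow>
    n \<le> 8 * card J \<longrightarrow> A \<in> sets (block_algebra I) \<longrightarrow> prob (A \<inter> win n x L) \<le> prob A * (C * L / c n)"
    using block_window_bound by blast
  obtain C2 where C2: "0 < C2" "\<forall>\<^sub>F n in sequentially. \<forall>m. n \<le> 8 * m \<longrightarrow> surv m \<le> C2 * surv n"
    using surv_ratio by blast
  show ?thesis
  proof (intro exI[of _ "C2 * C"] conjI allI impI)
    fix \<Delta> :: real assume \<Delta>: "0 < \<Delta>"
    from C(2)[OF \<Delta>] C2(2) eventually_ge_at_top[of 4]
    show "\<forall>\<^sub>F n in sequentially. \<forall>x. prob (pos n \<inter> win n x \<Delta>) \<le> C2 * C * \<Delta> * surv n / c n"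
    proof eventually_elim
      case (elim n)
      show ?case
      proof
        fix x
        define m where "m = n div 2"
        have m: "n \<le> 8 * m" "m \<le> n" "n \<le> 8 * (n - m)" using elim(3) by (auto simp: m_def)
        have cn: "0 < c n" using elim(3) by (intro L.c_pos) auto
        have "prob (pos n \<inter> win n x \<Delta>) \<le> prob (pos m \<inter> win n x \<Delta>)"
          using pos_antimono[OF m(2)] by (intro finite_measure_mono) auto
        also have "\<dots> \<le> prob (pos m) * (C * \<Delta> / c n)"
        proof (rule elim(1)[rule_format, where I = "{1..m}" and J = "{m + 1..n}"])
          show "pos m \<in> sets (block_algebra {1..m})" by (rule pos_block)
        qed (use m in auto)
        also have "\<dots> \<le> C2 * surv n * (C * \<Delta> / c n)"
          using elim(2) m C cn \<Delta> unfolding surv_def[symmetric] by (intro mult_right_mono) auto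
        finally show "prob (pos n \<inter> win n x \<Delta>) \<le> C2 * C * \<Delta> * surv n / c n" by (simp add: mult_ac)
      qed
    qed
  qed (use C C2 in simp)
qed

text \<open>Since \<open>walk X (n - j)\<close> is positive, the last \<open>j\<close> steps sum to
  less than \<open>x + \<Delta>\<close>, so the reversed walk stays low for \<open>k\<close> steps.
  Positivity up to \<open>m\<close>, this rare event and a free middle block live on disjoint sets
  of steps and give the three factors.\<close>

lemma local_bound_near_zero:
  assumes \<Delta>: "0 < \<Delta>" and \<eta>: "0 < \<eta>"
  shows "\<exists>\<delta>>0. \<forall>\<^sub>F n in sequentially. \<forall>x. x < \<delta> * c n \<longrightarrow> prob (pos n \<inter> win n x \<Delta>) \<le> \<eta> * surv n / c n"
proof -
  obtain C where C: "0 < C" "\<And>L. 0 < L \<Longrightarrow> \<forall>\<^sub>F n in sequentially. \<forall>I J A x. I \<inter> J = {} \<longrightarrow> I \<union> J = {1..n} \<longrightarrow>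
    n \<le> 8 * card J \<longrightarrow> A \<in> sets (block_algebra I) \<longrightarrow> prob (A \<inter> win n x L) \<le> prob A * (C * L / c n)"
    using block_window_bound by blast
  obtain C2 where C2: "0 < C2" "\<forall>\<^sub>F n in sequentially. \<forall>m. n \<le> 8 * m \<longrightarrow> surv m \<le> C2 * surv n"
    using surv_ratio by blast
  \<comment> \<open>Divides out the constants of the survival and window bounds, so that the product
    of the three factors is exactly \<open>\<eta> * surv n / c n\<close>.\<close>
  define \<eta>' where "\<eta>' = \<eta> / (C2 * C * \<Delta>)"
  have \<eta>': "0 < \<eta>'" using \<eta> \<Delta> C C2 by (simp add: \<eta>'_def)
  obtain \<delta>' N' where \<delta>': "0 < \<delta>'"
    and low: "\<And>k. N' \<le> k \<Longrightarrow> prob {\<omega> \<in> space M. \<forall>j\<in>{1..k}. walk X j \<omega> < \<delta>' * c k} \<le> \<eta>'"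
    using rarely_stays_low[OF \<eta>'] by (auto simp: eventually_sequentially)
  obtain N K where N: "1 \<le> N" and K: "0 < K" and double: "\<And>n. N \<le> n \<Longrightarrow> c (2 * n) \<le> K * c n"
    using L.c_potter by metis
  \<comment> \<open>One half is for \<open>x\<close>, the other for \<open>\<Delta>\<close>;
    \<open>K\<close> compares \<open>c n\<close> with \<open>c k\<close>, as
    \<open>n \<le> 2 * k\<close>.\<close>
  define \<delta> where "\<delta> = \<delta>' / (2 * K)"
  have \<delta>: "0 < \<delta>" using \<delta>' K by (simp add: \<delta>_def)
  have "\<forall>\<^sub>F n in sequentially. \<Delta> / \<delta> \<le> c n" using L.c_at_top by (simp add: filterlim_at_top)
  with C(2)[OF \<Delta>] C2(2) eventually_ge_at_top[of "4 + 2 * N + 2 * N'"]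
  have "\<forall>\<^sub>F n in sequentially. \<forall>x. x < \<delta> * c n \<longrightarrow> prob (pos n \<inter> win n x \<Delta>) \<le> \<eta> * surv n / c n"
  proof eventually_elim
    case (elim n)
    show ?case
    proof (intro allI impI)
      fix x assume x: "x < \<delta> * c n"
      define m where "m = n div 4"
      \<comment> \<open>The reversed stretch reaches back to time \<open>2 * m \<ge> 1\<close>, so
        \<open>walk X (n - j)\<close> is positive for every \<open>j \<le> k\<close>; at time 0 it
        would vanish.\<close>
      define k where "k = n - 2 * m"
      have m: "n \<le> 8 * m" "2 * m \<le> n" "1 \<le> m" 
      proof -
        have "4 * m \<le> n" "n < 4 * m + 4" by (simp_all add: m_def)
        moreover have "1 \<le> m" using elim(3) by (simp add: m_def Suc_le_eq div_greater_zero_iff)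
        ultimately show "n \<le> 8 * m" "2 * m \<le> n" "1 \<le> m" using elim(3) by linarith+
      qed
      have k: "n \<le> 2 * k" "N' \<le> k" "N \<le> k" "k \<le> n" using elim(3) m by (auto simp: k_def m_def)
      have cn: "0 < c n" using elim(3) by (intro L.c_pos) auto
      have "c n \<le> c (2 * k)" using k elim(3) by (intro L.c_le) auto
      also have "\<dots> \<le> K * c k" using k by (intro double) auto
      finally have ck: "c n \<le> K * c k" .
      have "x + \<Delta> < \<delta> * c n + \<delta> * c n" using x elim(4) \<delta> by (simp add: pos_divide_le_eq mult.commute)
      also have "\<dots> = \<delta>' / K * c n" using K by (simp add: \<delta>_def)
      also have "\<dots> \<le> \<delta>' / K * (K * c k)" using ck \<delta>' K by (intro mult_left_mono) auto
      also have "\<dots> = \<delta>' * c k" using K by simp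
      finally have xk: "x + \<Delta> \<le> \<delta>' * c k" by simp
      define E where "E = {\<omega> \<in> space M. \<forall>j\<in>{1..k}. bsum {n - j + 1..n} \<omega> \<in> {..<x + \<Delta>}}"
      have E: "E \<in> sets (block_algebra {2 * m + 1..n})"
      proof -
        have [measurable]: "j \<in> {1..k} \<Longrightarrow> bsum {n - j + 1..n} \<in> borel_measurable (block_algebra {2 * m + 1..n})" for j
          by (rule bsum_measurable_block) (auto simp: k_def)
        have "{\<omega> \<in> space (block_algebra {2 * m + 1..n}). \<forall>j\<in>{1..k}. bsum {n - j + 1..n} \<omega> \<in> {..<x + \<Delta>}}
          \<in> sets (block_algebra {2 * m + 1..n})" by measurable
        then show ?thesis by (simp add: E_def)
      qed
      have "prob E = prob {\<omega> \<in> space M. \<forall>j\<in>{1..k}. walk X j \<omega> \<in> {..<x + \<Delta>}}"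
        unfolding E_def using k by (intro prob_reversed_path) auto
      also have "\<dots> \<le> prob {\<omega> \<in> space M. \<forall>j\<in>{1..k}. walk X j \<omega> < \<delta>' * c k}"
        using xk by (intro finite_measure_mono) (auto intro: less_le_trans)
      also have "\<dots> \<le> \<eta>'" by (rule low[OF k(2)])
      finally have PE: "prob E \<le> \<eta>'" .
      have A: "pos m \<inter> E \<in> sets (block_algebra ({1..m} \<union> {2 * m + 1..n}))"
        using pos_block[of m] E block_algebra_mono[of "{1..m}" "{1..m} \<union> {2 * m + 1..n}"]
          block_algebra_mono[of "{2 * m + 1..n}" "{1..m} \<union> {2 * m + 1..n}"] by (intro sets.Int) auto
      have PA: "prob (pos m \<inter> E) \<le> C2 * surv n * \<eta>'"
      proof -
        have "prob (pos m \<inter> E) = prob (pos m) * prob E"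
          by (rule block_indep[OF _ _ _ pos_block E]) auto
        also have "\<dots> \<le> C2 * surv n * \<eta>'"
          using elim(2) m PE C2 surv_nonneg[of n] unfolding surv_def[symmetric] by (intro mult_mono) auto
        finally show ?thesis .
      qed
      have "prob (pos n \<inter> win n x \<Delta>) \<le> prob ((pos m \<inter> E) \<inter> win n x \<Delta>)"
      proof (rule finite_measure_mono)
        show "pos n \<inter> win n x \<Delta> \<subseteq> pos m \<inter> E \<inter> win n x \<Delta>"
        proof
          fix \<omega> assume w: "\<omega> \<in> pos n \<inter> win n x \<Delta>"
          have "bsum {n - j + 1..n} \<omega> < x + \<Delta>" if "j \<in> {1..k}" for j
          proof -
            have "n - j \<in> {1..n}" using that m by (auto simp: k_def)
            then have "0 < walk X (n - j) \<omega>" using w by (auto simp: pos_def)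
            then show ?thesis using walk_split[of "n - j" n \<omega>] w by (auto simp: win_def)
          qed
          then have "\<omega> \<in> E" using w by (auto simp: E_def win_def)
          moreover have "m \<le> n" using m by simp
          ultimately show "\<omega> \<in> pos m \<inter> E \<inter> win n x \<Delta>" using w pos_antimono[of m n] by auto
        qed
        show "pos m \<inter> E \<inter> win n x \<Delta> \<in> events"
          using E block_algebra_subset_events[of "{2 * m + 1..n}"] by auto
      qed
      also have "\<dots> \<le> prob (pos m \<inter> E) * (C * \<Delta> / c n)"
      proof (rule elim(1)[rule_format, where I = "{1..m} \<union> {2 * m + 1..n}" and J = "{m + 1..2 * m}"])
        show "pos m \<inter> E \<in> sets (block_algebra ({1..m} \<union> {2 * m + 1..n}))" by (rule A)
      qed (use m in auto)
      also have "\<dots> \<le> (C2 * surv n * \<eta>') * (C * \<Delta> / c n)"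
        using PA C cn \<Delta> by (intro mult_right_mono) auto
      also have "\<dots> = \<eta> * surv n / c n" using C C2 \<Delta> by (simp add: \<eta>'_def)
      finally show "prob (pos n \<inter> win n x \<Delta>) \<le> \<eta> * surv n / c n" .
    qed
  qed
  then show ?thesis using \<delta> by blast
qed

text \<open>Three block sums add up to at least \<open>x\<close> only if one of them reaches
  \<open>x / 3\<close>. The initial block is controlled by the conditioned limit, the other two by
  tightness of the free walk; each time a block other than the large one is left free to spread out
  the end point.\<close>

lemma local_bound_far:
  assumes \<Delta>: "0 < \<Delta>" and \<eta>: "0 < \<eta>"
  shows "\<exists>K>0. \<forall>\<^sub>F n in sequentially. \<forall>x. K * c n \<le> x \<longrightarrow> prob (pos n \<inter> win n x \<Delta>) \<le> \<eta> * surv n / c n"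
proof -
  obtain C where C: "0 < C" "\<And>L. 0 < L \<Longrightarrow> \<forall>\<^sub>F n in sequentially. \<forall>I J A x. I \<inter> J = {} \<longrightarrow> I \<union> J = {1..n} \<longrightarrow>
    n \<le> 8 * card J \<longrightarrow> A \<in> sets (block_algebra I) \<longrightarrow> prob (A \<inter> win n x L) \<le> prob A * (C * L / c n)"
    using block_window_bound by blast
  obtain C2 where C2: "0 < C2" "\<forall>\<^sub>F n in sequentially. \<forall>m. n \<le> 8 * m \<longrightarrow> surv m \<le> C2 * surv n"
    using surv_ratio by blast
  define \<eta>' where "\<eta>' = \<eta> / (3 * C2 * C * \<Delta>)"
  have \<eta>': "0 < \<eta>'" using \<eta> \<Delta> C C2 by (simp add: \<eta>'_def)
  obtain K1 N1 where K1: "0 < K1"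
    and tail1: "\<And>n. N1 \<le> n \<Longrightarrow> prob (pos n \<inter> {\<omega> \<in> space M. K1 * c n < walk X n \<omega>}) \<le> \<eta>' * surv n"
    using conditioned_tail[OF \<eta>'] by (auto simp: eventually_sequentially)
  obtain K2 N2 where K2: "0 < K2"
    and tail2: "\<And>n. N2 \<le> n \<Longrightarrow> prob {\<omega> \<in> space M. K2 * c n \<le> \<bar>walk X n \<omega>\<bar>} \<le> \<eta>'"
    using tight[OF \<eta>'] by (auto simp: eventually_sequentially)
  define K where "K = 3 * (K1 + K2)"
  have K: "0 < K" using K1 K2 by (simp add: K_def)
  have "\<forall>\<^sub>F n in sequentially. \<forall>x. K * c n \<le> x \<longrightarrow> prob (pos n \<inter> win n x \<Delta>) \<le> \<eta> * surv n / c n"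
    using C(2)[OF \<Delta>] C2(2) eventually_ge_at_top[of "4 + 4 * N1 + 4 * N2"]
  proof eventually_elim
    case (elim n)
    show ?case
    proof (intro allI impI)
      fix x assume x: "K * c n \<le> x"
      define m where "m = n div 4"
      define z where "z = x / 3"
      have m: "n \<le> 8 * m" "2 * m \<le> n" "1 \<le> m" "N1 \<le> m" "N2 \<le> m" "m \<le> n - 2 * m"
      proof -
        have "4 * m \<le> n" "n < 4 * m + 4" by (simp_all add: m_def)
        moreover have "1 \<le> m" using elim(3) by (simp add: m_def Suc_le_eq div_greater_zero_iff)
        ultimately show "n \<le> 8 * m" "2 * m \<le> n" "1 \<le> m" "N1 \<le> m" "N2 \<le> m" "m \<le> n - 2 * m"
          using elim(3) by linarith+
      qed
      have cn: "0 < c n" using elim(3) by (intro L.c_pos) auto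
      have z: "(K1 + K2) * c n \<le> z" using x by (simp add: z_def K_def algebra_simps)
      have z1: "K1 * c j < z" and z2: "K2 * c j \<le> z" if "1 \<le> j" "j \<le> n" for j
      proof -
        have "K1 * c j \<le> K1 * c n" "K2 * c j \<le> K2 * c n"
          using that K1 K2 by (auto intro!: mult_left_mono L.c_le)
        moreover have "0 < K1 * c n" "0 < K2 * c n" "K1 * c n + K2 * c n \<le> z"
          using K1 K2 cn z by (auto simp: distrib_right)
        ultimately show "K1 * c j < z" "K2 * c j \<le> z" by linarith+
      qed
      have far: "prob {\<omega> \<in> space M. z \<le> bsum J \<omega>} \<le> \<eta>'"
        if J: "finite J" "J \<subseteq> {1..}" "N2 \<le> card J" "1 \<le> card J" "card J \<le> n" for J
      proof -
        have "prob {\<omega> \<in> space M. z \<le> bsum J \<omega>} = prob {\<omega> \<in> space M. z \<le> walk X (card J) \<omega>}"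
          using prob_bsum_eq_walk[OF J(1,2), of "{z..}"] by simp
        also have "\<dots> \<le> prob {\<omega> \<in> space M. K2 * c (card J) \<le> \<bar>walk X (card J) \<omega>\<bar>}"
          using z2[OF J(4,5)] by (intro finite_measure_mono) auto
        also have "\<dots> \<le> \<eta>'" by (rule tail2[OF J(3)])
        finally show ?thesis .
      qed
      have block: "{\<omega> \<in> space M. z \<le> bsum J \<omega>} \<in> sets (block_algebra J)" for J
      proof -
        have [measurable]: "bsum J \<in> borel_measurable (block_algebra J)" by (rule bsum_measurable_block) simp
        have "{\<omega> \<in> space (block_algebra J). z \<le> bsum J \<omega>} \<in> sets (block_algebra J)" by measurable
        then show ?thesis by simp
      qed
      define A1 where "A1 = pos m \<inter> {\<omega> \<in> space M. z \<le> bsum {1..m} \<omega>}"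
      define A2 where "A2 = pos m \<inter> {\<omega> \<in> space M. z \<le> bsum {m + 1..2 * m} \<omega>}"
      define A3 where "A3 = pos m \<inter> {\<omega> \<in> space M. z \<le> bsum {2 * m + 1..n} \<omega>}"
      have surv_m: "surv m \<le> C2 * surv n" using elim(2) m by auto
      have P1: "prob A1 \<le> C2 * surv n * \<eta>'"
      proof -
        have "prob A1 \<le> prob (pos m \<inter> {\<omega> \<in> space M. K1 * c m < walk X m \<omega>})"
          unfolding A1_def walk_eq_bsum[symmetric] using z1[of m] m
          by (intro finite_measure_mono) auto
        also have "\<dots> \<le> \<eta>' * surv m" by (rule tail1[OF m(4)])
        also have "\<dots> \<le> \<eta>' * (C2 * surv n)" using surv_m \<eta>' by (intro mult_left_mono) auto
        finally show ?thesis by (simp add: mult_ac)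
      qed
      have P23: "prob (pos m \<inter> {\<omega> \<in> space M. z \<le> bsum J \<omega>}) \<le> C2 * surv n * \<eta>'"
        if J: "{1..m} \<inter> J = {}" "finite J" "J \<subseteq> {1..}" "N2 \<le> card J" "1 \<le> card J" "card J \<le> n" for J
      proof -
        have "prob (pos m \<inter> {\<omega> \<in> space M. z \<le> bsum J \<omega>}) = prob (pos m) * prob {\<omega> \<in> space M. z \<le> bsum J \<omega>}"
          by (rule block_indep[OF J(1) _ J(3) pos_block block]) auto
        also have "\<dots> \<le> C2 * surv n * \<eta>'"
          using surv_m far[OF J(2-6)] C2 surv_nonneg[of n] unfolding surv_def[symmetric] by (intro mult_mono) auto
        finally show ?thesis .
      qed
      have P2: "prob A2 \<le> C2 * surv n * \<eta>'" unfolding A2_def using m by (intro P23) auto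
      have P3: "prob A3 \<le> C2 * surv n * \<eta>'" unfolding A3_def using m by (intro P23) auto
      have A1: "A1 \<in> sets (block_algebra {1..m})" unfolding A1_def by (intro sets.Int pos_block block)
      have A2: "A2 \<in> sets (block_algebra {1..2 * m})"
        unfolding A2_def using pos_block[of m] block[of "{m + 1..2 * m}"]
          block_algebra_mono[of "{1..m}" "{1..2 * m}"] block_algebra_mono[of "{m + 1..2 * m}" "{1..2 * m}"]
        by (intro sets.Int) auto
      have A3: "A3 \<in> sets (block_algebra ({1..m} \<union> {2 * m + 1..n}))"
        unfolding A3_def using pos_block[of m] block[of "{2 * m + 1..n}"]
          block_algebra_mono[of "{1..m}" "{1..m} \<union> {2 * m + 1..n}"]
          block_algebra_mono[of "{2 * m + 1..n}" "{1..m} \<union> {2 * m + 1..n}"]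
        by (intro sets.Int) auto
      have ev: "A1 \<in> events" "A2 \<in> events" "A3 \<in> events"
        using A1 A2 A3 block_algebra_subset_events[of "{1..m}"] block_algebra_subset_events[of "{1..2 * m}"]
          block_algebra_subset_events[of "{1..m} \<union> {2 * m + 1..n}"] by auto
      let ?W = "win n x \<Delta>" and ?b = "C2 * surv n * \<eta>' * (C * \<Delta> / c n)"
      have CD: "0 \<le> C * \<Delta> / c n" using C cn \<Delta> by simp
      have Q1: "prob (A1 \<inter> ?W) \<le> ?b"
      proof -
        have "prob (A1 \<inter> ?W) \<le> prob A1 * (C * \<Delta> / c n)"
          by (rule elim(1)[rule_format, where I = "{1..m}" and J = "{m + 1..n}"]) (use A1 m in auto)
        also have "\<dots> \<le> ?b" by (intro mult_right_mono P1 CD)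
        finally show ?thesis .
      qed
      have Q2: "prob (A2 \<inter> ?W) \<le> ?b"
      proof -
        have "prob (A2 \<inter> ?W) \<le> prob A2 * (C * \<Delta> / c n)"
          by (rule elim(1)[rule_format, where I = "{1..2 * m}" and J = "{2 * m + 1..n}"]) (use A2 m in \<open>auto simp: m_def\<close>)
        also have "\<dots> \<le> ?b" by (intro mult_right_mono P2 CD)
        finally show ?thesis .
      qed
      have Q3: "prob (A3 \<inter> ?W) \<le> ?b"
      proof -
        have "prob (A3 \<inter> ?W) \<le> prob A3 * (C * \<Delta> / c n)"
          by (rule elim(1)[rule_format, where I = "{1..m} \<union> {2 * m + 1..n}" and J = "{m + 1..2 * m}"]) (use A3 m in auto)
        also have "\<dots> \<le> ?b" by (intro mult_right_mono P3 CD)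
        finally show ?thesis .
      qed
      have "prob (pos n \<inter> ?W) \<le> prob (A1 \<inter> ?W \<union> (A2 \<inter> ?W \<union> A3 \<inter> ?W))"
      proof (rule finite_measure_mono)
        show "pos n \<inter> ?W \<subseteq> A1 \<inter> ?W \<union> (A2 \<inter> ?W \<union> A3 \<inter> ?W)"
        proof
          fix \<omega> assume w: "\<omega> \<in> pos n \<inter> ?W"
          then have "\<omega> \<in> pos m" "\<omega> \<in> space M" "x \<le> walk X n \<omega>"
            using pos_antimono[of m n] m by (auto simp: win_def)
          moreover have "walk X n \<omega> = bsum {1..m} \<omega> + (bsum {m + 1..2 * m} \<omega> + bsum {2 * m + 1..n} \<omega>)"
            using walk_split[of m n \<omega>] bsum_split[of m "2 * m" n \<omega>] m by (simp add: walk_eq_bsum)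
          ultimately show "\<omega> \<in> A1 \<inter> ?W \<union> (A2 \<inter> ?W \<union> A3 \<inter> ?W)"
            using w by (auto simp: A1_def A2_def A3_def z_def)
        qed
      qed (use ev in auto)
      also have "\<dots> \<le> prob (A1 \<inter> ?W) + (prob (A2 \<inter> ?W) + prob (A3 \<inter> ?W))"
        using ev by (intro order_trans[OF measure_Un_le] add_left_mono measure_Un_le) auto
      also have "\<dots> \<le> 3 * ?b"
      proof -
        have "p1 \<le> b \<Longrightarrow> p2 \<le> b \<Longrightarrow> p3 \<le> b \<Longrightarrow> p1 + (p2 + p3) \<le> 3 * b" for p1 p2 p3 b :: real by simp
        from this[OF Q1 Q2 Q3] show ?thesis .
      qed
      also have "\<dots> = \<eta> * surv n / c n" using C C2 \<Delta> by (simp add: \<eta>'_def)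
      finally show "prob (pos n \<inter> win n x \<Delta>) \<le> \<eta> * surv n / c n" .
    qed
  qed
  then show ?thesis using K by blast
qed

text \<open>Dropping positivity after time \<open>l\<close> adds only paths that dip to 0 in the
  last \<open>k\<close> steps and still end above \<open>\<delta> * c n\<close>; reversed, such a
  path moves by \<open>\<delta> * c n\<close> within a short time. Once the constraint is gone the
  equicontinuity of the law of the last \<open>k\<close> steps applies. The proportion of that
  stretch is fixed before \<open>C3\<close>, and \<open>C3\<close> before \<open>h\<close>.\<close>

lemma local_equicontinuity:
  assumes \<Delta>: "0 < \<Delta>" and \<delta>: "0 < \<delta>" and \<eta>: "0 < \<eta>"
  shows "\<exists>h>0. \<forall>\<^sub>F n in sequentially. \<forall>x y. \<delta> * c n \<le> x \<longrightarrow> \<delta> * c n \<le> y \<longrightarrow> \<bar>x - y\<bar> \<le> h * c n \<longrightarrow>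
    \<bar>prob (pos n \<inter> win n x \<Delta>) - prob (pos n \<inter> win n y \<Delta>)\<bar> \<le> \<eta> * surv n / c n"
proof -
  obtain C where C: "0 < C" "\<And>L. 0 < L \<Longrightarrow> \<forall>\<^sub>F n in sequentially. \<forall>I J A x. I \<inter> J = {} \<longrightarrow> I \<union> J = {1..n} \<longrightarrow>
    n \<le> 8 * card J \<longrightarrow> A \<in> sets (block_algebra I) \<longrightarrow> prob (A \<inter> win n x L) \<le> prob A * (C * L / c n)"
    using block_window_bound by blast
  obtain C2 where C2: "0 < C2" "\<forall>\<^sub>F n in sequentially. \<forall>m. n \<le> 8 * m \<longrightarrow> surv m \<le> C2 * surv n"
    using surv_ratio by blast
  \<comment> \<open>Splits \<open>\<eta>\<close> in halves: \<open>C2 * C3 * h\<close> for the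
    shift, \<open>C2 * (1 + C * \<Delta>) * \<eta>'\<close> for the residual error and the dropped
    constraint.\<close>
  define \<eta>' where "\<eta>' = \<eta> / (2 * (C2 * (1 + C * \<Delta>)))"
  have CD: "0 < C2 * (1 + C * \<Delta>)" using C C2 \<Delta> by (intro mult_pos_pos add_pos_pos) auto
  have \<eta>': "0 < \<eta>'" using \<eta> CD by (simp add: \<eta>'_def)
  obtain A0 :: nat where A0: "1 \<le> A0" and max: "\<forall>\<^sub>F n in sequentially. \<forall>k. A0 * k \<le> n \<longrightarrow>
    1 - \<eta>' \<le> prob {\<omega> \<in> space M. \<forall>j\<in>{1..k}. \<bar>walk X j \<omega>\<bar> < \<delta> * c n}"
    using early_maximum_small[OF \<delta> \<eta>'] by blast
  \<comment> \<open>At least 2, so that the final stretch \<open>n div A\<close> takes at most half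
    of the path and a free block of order \<open>n\<close> remains before it.\<close>
  define A where "A = A0 + 1"
  have A: "2 \<le> A" "A0 \<le> A" using A0 by (auto simp: A_def)
  have "0 < 1 / (2 * real A)" using A by simp
  from L.window_equicontinuous[OF this \<Delta>] obtain C3 where C3: "0 < C3"
    "\<And>\<eta>. 0 < \<eta> \<Longrightarrow> \<forall>\<^sub>F n in sequentially. \<forall>k \<mu> x y. 1 / (2 * real A) * real n \<le> real k \<longrightarrow>
      real_distribution \<mu> \<longrightarrow> (\<forall>t. char \<mu> t = char F t ^ k) \<longrightarrow>
      \<bar>measure \<mu> {x..<x + \<Delta>} - measure \<mu> {y..<y + \<Delta>}\<bar> \<le> (C3 * \<bar>x - y\<bar> / c n + \<eta>) / c n"
    by blast
  define h where "h = \<eta> / (2 * C2 * C3)"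
  have h: "0 < h" using \<eta> C2 C3 by (simp add: h_def)
  have "\<forall>\<^sub>F n in sequentially. \<forall>x y. \<delta> * c n \<le> x \<longrightarrow> \<delta> * c n \<le> y \<longrightarrow> \<bar>x - y\<bar> \<le> h * c n \<longrightarrow>
    \<bar>prob (pos n \<inter> win n x \<Delta>) - prob (pos n \<inter> win n y \<Delta>)\<bar> \<le> \<eta> * surv n / c n"
    using C(2)[OF \<Delta>] C2(2) max C3(2)[OF \<eta>'] eventually_ge_at_top[of "4 + A"]
  proof eventually_elim
    case (elim n)
    define k where "k = n div A"
    define l where "l = n - k"
    define m where "m = n div 4"
    have k2: "k \<le> n div 2" unfolding k_def using A by (intro div_le_mono2) auto
    have k1: "1 \<le> k" using elim(5) A by (simp add: k_def Suc_le_eq div_greater_zero_iff)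
    have m: "n \<le> 8 * m" "m \<le> l" "n \<le> 8 * (l - m)" "n \<le> 8 * l" "l \<le> n" "1 \<le> m"
    proof -
      have "4 * m \<le> n" "n < 4 * m + 4" "2 * k \<le> n" using k2 by (simp_all add: m_def)
      moreover have "1 \<le> m" using elim(5) by (simp add: m_def Suc_le_eq div_greater_zero_iff)
      ultimately show "n \<le> 8 * m" "m \<le> l" "n \<le> 8 * (l - m)" "n \<le> 8 * l" "l \<le> n" "1 \<le> m"
        using elim(5) unfolding l_def by linarith+
    qed
    have nl: "n - l = k" using k2 by (simp add: l_def)
    have kA: "1 / (2 * real A) * real n \<le> real k"
    proof -
      have "n < A * (k + 1)" using dividend_less_times_div[of A n] A by (simp add: k_def)
      also have "\<dots> \<le> A * (2 * k)" using k1 by (intro mult_le_mono2) simp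
      finally have "real n \<le> real (A * (2 * k))" by (simp only: of_nat_le_iff less_imp_le)
      then show ?thesis using A by (simp add: pos_divide_le_eq mult_ac)
    qed
    have cn: "0 < c n" using elim(5) by (intro L.c_pos) auto
    define G where "G = {\<omega> \<in> space M. \<forall>j\<in>{1..k}. bsum {n - j + 1..n} \<omega> \<in> {- (\<delta> * c n)<..<\<delta> * c n}}"
    have G: "G \<in> sets (block_algebra {l + 1..n})"
    proof -
      have [measurable]: "j \<in> {1..k} \<Longrightarrow> bsum {n - j + 1..n} \<in> borel_measurable (block_algebra {l + 1..n})" for j
        by (rule bsum_measurable_block) (auto simp: l_def)
      have "{\<omega> \<in> space (block_algebra {l + 1..n}). \<forall>j\<in>{1..k}. bsum {n - j + 1..n} \<omega> \<in> {- (\<delta> * c n)<..<\<delta> * c n}}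
        \<in> sets (block_algebra {l + 1..n})" by measurable
      then show ?thesis by (simp add: G_def)
    qed
    have bad: "space M - G \<in> sets (block_algebra {l + 1..n})"
      using sets.compl_sets[OF G] by simp
    have Pbad: "prob (space M - G) \<le> \<eta>'"
    proof -
      have "A0 * k \<le> A * (n div A)" unfolding k_def using A by (intro mult_le_mono1)
      also have "\<dots> \<le> n" by simp
      finally have "1 - \<eta>' \<le> prob {\<omega> \<in> space M. \<forall>j\<in>{1..k}. \<bar>walk X j \<omega>\<bar> < \<delta> * c n}" using elim(3) by blast
      also have "{\<omega> \<in> space M. \<forall>j\<in>{1..k}. \<bar>walk X j \<omega>\<bar> < \<delta> * c n}
        = {\<omega> \<in> space M. \<forall>j\<in>{1..k}. walk X j \<omega> \<in> {- (\<delta> * c n)<..<\<delta> * c n}}" by (auto simp: abs_less_iff)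
      also have "prob \<dots> = prob G"
        unfolding G_def using k2 by (intro prob_reversed_path[symmetric]) auto
      finally have "1 - \<eta>' \<le> prob G" .
      moreover have "G \<in> events" using G block_algebra_subset_events[of "{l + 1..n}"] by auto
      ultimately show ?thesis using prob_compl[of G] by simp
    qed
    have ml: "pos m \<inter> (space M - G) \<in> sets (block_algebra ({1..m} \<union> {l + 1..n}))"
      using pos_block[of m] bad block_algebra_mono[of "{1..m}" "{1..m} \<union> {l + 1..n}"]
        block_algebra_mono[of "{l + 1..n}" "{1..m} \<union> {l + 1..n}"] by (intro sets.Int) auto
    have Pml: "prob (pos m \<inter> (space M - G)) \<le> C2 * surv n * \<eta>'"
    proof -
      have "prob (pos m \<inter> (space M - G)) = prob (pos m) * prob (space M - G)"
        by (rule block_indep[OF _ _ _ pos_block bad]) (use m in auto)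
      also have "\<dots> \<le> C2 * surv n * \<eta>'"
        using elim(2) m Pbad C2 surv_nonneg[of n] unfolding surv_def[symmetric] by (intro mult_mono) auto
      finally show ?thesis .
    qed
    \<comment> \<open>The difference lies in \<open>[0, b]\<close>; centring it at
      \<open>b / 2\<close> makes the losses at \<open>x\<close> and \<open>y\<close> cost
      \<open>b\<close> together instead of \<open>2 * b\<close>.\<close>
    have loss: "\<bar>prob (pos l \<inter> win n x \<Delta>) - prob (pos n \<inter> win n x \<Delta>) - b / 2\<bar> \<le> b / 2"
      if x: "\<delta> * c n \<le> x" and b: "b = C2 * surv n * \<eta>' * (C * \<Delta> / c n)" for x b
    proof -
      have "prob (pos l \<inter> win n x \<Delta>) - prob (pos n \<inter> win n x \<Delta>)
        = prob (pos l \<inter> win n x \<Delta> - pos n \<inter> win n x \<Delta>)"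
        using pos_antimono[OF m(5)] by (intro finite_measure_Diff[symmetric]) auto
      also have "\<dots> \<le> prob ((pos m \<inter> (space M - G)) \<inter> win n x \<Delta>)"
      proof (rule finite_measure_mono)
        show "pos l \<inter> win n x \<Delta> - pos n \<inter> win n x \<Delta> \<subseteq> pos m \<inter> (space M - G) \<inter> win n x \<Delta>"
        proof
          fix \<omega> assume w: "\<omega> \<in> pos l \<inter> win n x \<Delta> - pos n \<inter> win n x \<Delta>"
          then have wM: "\<omega> \<in> space M" "x \<le> walk X n \<omega>" by (auto simp: win_def)
          have "\<omega> \<notin> pos n" using w by auto
          then obtain i where i: "i \<in> {1..n}" "walk X i \<omega> \<le> 0" using wM by (force simp: pos_def)
          have "\<not> i \<le> l"
          proof
            assume "i \<le> l"
            then have "0 < walk X i \<omega>" using i w by (auto simp: pos_def)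
            then show False using i by simp
          qed
          \<comment> \<open>The end point is positive, so the dip occurs strictly before
            \<open>n\<close> and the reversed index \<open>n - i\<close> is at least 1.\<close>
          moreover have "0 < \<delta> * c n" using \<delta> cn by simp
          then have "i \<noteq> n" using i wM x by auto
          ultimately have j: "n - i \<in> {1..k}" "n - (n - i) = i" using i by (auto simp: l_def)
          have "\<delta> * c n \<le> bsum {i + 1..n} \<omega>" using walk_split[of i n \<omega>] i wM x by simp
          then have "\<omega> \<notin> G" using j unfolding G_def by force
          then show "\<omega> \<in> pos m \<inter> (space M - G) \<inter> win n x \<Delta>"
            using w wM pos_antimono[OF m(2)] by auto
        qed
        show "pos m \<inter> (space M - G) \<inter> win n x \<Delta> \<in> events"
          using bad block_algebra_subset_events[of "{l + 1..n}"] by auto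
      qed
      also have "\<dots> \<le> prob (pos m \<inter> (space M - G)) * (C * \<Delta> / c n)"
      proof (rule elim(1)[rule_format, where I = "{1..m} \<union> {l + 1..n}" and J = "{m + 1..l}"])
        show "pos m \<inter> (space M - G) \<in> sets (block_algebra ({1..m} \<union> {l + 1..n}))" by (rule ml)
      qed (use m in auto)
      also have "\<dots> \<le> b" unfolding b using Pml C cn \<Delta> by (intro mult_right_mono) auto
      finally have "prob (pos l \<inter> win n x \<Delta>) - prob (pos n \<inter> win n x \<Delta>) \<le> b" .
      moreover have "prob (pos n \<inter> win n x \<Delta>) \<le> prob (pos l \<inter> win n x \<Delta>)"
        using pos_antimono[OF m(5)] by (intro finite_measure_mono) auto
      moreover have "p - q \<le> b \<Longrightarrow> q \<le> p \<Longrightarrow> \<bar>p - q - b / 2\<bar> \<le> b / 2" for p q :: real by linarith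
      ultimately show ?thesis by blast
    qed
    show ?case
    proof (intro allI impI)
      fix x y assume xy: "\<delta> * c n \<le> x" "\<delta> * c n \<le> y" "\<bar>x - y\<bar> \<le> h * c n"
      define b where "b = C2 * surv n * \<eta>' * (C * \<Delta> / c n)"
      have IJ: "{1..l} \<inter> {l + 1..n} = {}" "{1..l} \<union> {l + 1..n} = {1..n}" using m by auto
      have hx: "(\<lambda>\<omega>. u - bsum {1..l} \<omega>) \<in> borel_measurable (block_algebra {1..l})" for u
        by (intro borel_measurable_diff bsum_measurable_block) auto
      have "\<bar>prob (pos l \<inter> win n x \<Delta>) - prob (pos l \<inter> win n y \<Delta>)\<bar>
        \<le> prob (pos l) * ((C3 * \<bar>x - y\<bar> / c n + \<eta>') / c n)"
        unfolding bsum_in_window_eq[OF IJ, symmetric]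
      proof (rule block_smoothing_diff_le[OF IJ(1) _ _ pos_block hx hx])
        fix \<omega>
        have "\<bar>measure (distr M borel (bsum {l + 1..n})) {u..<u + \<Delta>} - measure (distr M borel (bsum {l + 1..n})) {v..<v + \<Delta>}\<bar>
          \<le> (C3 * \<bar>u - v\<bar> / c n + \<eta>') / c n" for u v
          using elim(4) kA bsum_distribution[of "{l + 1..n}"] char_bsum[of "{l + 1..n}"] nl by auto
        from this[of "x - bsum {1..l} \<omega>" "y - bsum {1..l} \<omega>"]
        show "\<bar>measure (distr M borel (bsum {l + 1..n})) {x - bsum {1..l} \<omega>..<x - bsum {1..l} \<omega> + \<Delta>}
          - measure (distr M borel (bsum {l + 1..n})) {y - bsum {1..l} \<omega>..<y - bsum {1..l} \<omega> + \<Delta>}\<bar>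
          \<le> (C3 * \<bar>x - y\<bar> / c n + \<eta>') / c n" by simp
      qed auto
      also have "\<dots> \<le> (C2 * surv n) * ((C3 * h + \<eta>') / c n)"
      proof (intro mult_mono divide_right_mono add_right_mono)
        show "prob (pos l) \<le> C2 * surv n" using elim(2) m unfolding surv_def[symmetric] by auto
        have "C3 * \<bar>x - y\<bar> \<le> C3 * (h * c n)" using xy C3 by (intro mult_left_mono) auto
        then show "C3 * \<bar>x - y\<bar> / c n \<le> C3 * h" using cn by (simp add: pos_divide_le_eq mult_ac)
      qed (use C2 C3 \<eta>' cn surv_nonneg[of n] in auto)
      finally have "\<bar>prob (pos l \<inter> win n x \<Delta>) - prob (pos l \<inter> win n y \<Delta>)\<bar>
        \<le> (C2 * surv n) * ((C3 * h + \<eta>') / c n)" .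
      moreover have "\<bar>l1 - l2\<bar> \<le> d \<Longrightarrow> \<bar>l1 - n1 - b / 2\<bar> \<le> b / 2 \<Longrightarrow> \<bar>l2 - n2 - b / 2\<bar> \<le> b / 2 \<Longrightarrow>
        \<bar>n1 - n2\<bar> \<le> d + b" for l1 l2 n1 n2 b d :: real by linarith
      ultimately have "\<bar>prob (pos n \<inter> win n x \<Delta>) - prob (pos n \<inter> win n y \<Delta>)\<bar>
        \<le> (C2 * surv n) * ((C3 * h + \<eta>') / c n) + b"
        using loss[OF xy(1) b_def] loss[OF xy(2) b_def] by blast
      also have "\<dots> = (C2 * C3 * h + C2 * (1 + C * \<Delta>) * \<eta>') * (surv n / c n)"
        by (simp add: b_def add_divide_distrib distrib_left distrib_right mult_ac)
      also have "C2 * C3 * h = \<eta> / 2" using C2 C3 by (simp add: h_def)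
      also have "C2 * (1 + C * \<Delta>) * \<eta>' = \<eta> / 2"
      proof -
        have "G * (\<eta> / (2 * G)) = \<eta> / 2" if "0 < G" for G :: real using that by simp
        from this[OF CD] show ?thesis unfolding \<eta>'_def .
      qed
      finally show "\<bar>prob (pos n \<inter> win n x \<Delta>) - prob (pos n \<inter> win n y \<Delta>)\<bar> \<le> \<eta> * surv n / c n" by simp
    qed
  qed
  then show ?thesis using h by blast
qed

end

section \<open>The local limit theorem\<close>

context conditioned_walk
begin

lemma window_sum:
  assumes "0 < L"
  shows "prob (pos n \<inter> win n x (real N * L)) = (\<Sum>i<N. prob (pos n \<inter> win n (x + real i * L) L))"
proof (induction N)
  case 0
  have "win n x (real 0 * L) = {}" by (auto simp: win_def)
  then show ?case by simp
next
  case (Suc N)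
  define z where "z = real N * L"
  have z: "0 \<le> z" "real (Suc N) * L = z + L" using assms by (simp_all add: z_def algebra_simps)
  have "pos n \<inter> win n x (real (Suc N) * L)
    = pos n \<inter> win n x (real N * L) \<union> pos n \<inter> win n (x + real N * L) L"
    unfolding z(2) z_def[symmetric] using assms z(1) by (auto simp: win_def)
  also have "prob \<dots> = prob (pos n \<inter> win n x (real N * L)) + prob (pos n \<inter> win n (x + real N * L) L)"
    by (rule finite_measure_Union) (auto simp: win_def)
  finally show ?case using Suc by simp
qed

text \<open>Windows are closed on the left, increments of distribution functions on the right; the
  two differ by atoms at the end points, each covered by one short window of length
  \<open>L\<close>.\<close>

lemma window_cdf_diff:
  assumes n: "1 \<le> n" and w: "0 \<le> w" and L: "0 < L"
    and B: "\<And>x. prob (pos n \<inter> win n x L) \<le> B * surv n"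
  shows "\<bar>prob (pos n \<inter> win n x (w * c n)) / surv n
    - (cdf (conditioned_law M X c n) (x / c n + w) - cdf (conditioned_law M X c n) (x / c n))\<bar> \<le> B"
proof -
  have cn: "0 < c n" using n by (rule L.c_pos)
  have s: "0 < surv n" by (rule surv_pos)
  let ?le = "\<lambda>y. pos n \<inter> {\<omega> \<in> space M. walk X n \<omega> \<le> y}"
  have cdf_eq: "cdf (conditioned_law M X c n) v = prob (?le (v * c n)) / surv n" for v
    using conditioned_prob[OF n, of v] s by simp
  define y where "y = x + w * c n"
  have y: "x \<le> y" "(x / c n + w) * c n = y" "x / c n * c n = x" using w cn by (auto simp: y_def distrib_right)
  have eq: "prob (?le y) = prob (?le x) + prob (?le y - ?le x)"
    using y by (subst finite_measure_Diff) auto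
  have "prob (pos n \<inter> win n x (w * c n)) \<le> prob ((?le y - ?le x) \<union> (pos n \<inter> win n x L))"
    using L by (intro finite_measure_mono) (auto simp: win_def y_def)
  also have "\<dots> \<le> prob (?le y - ?le x) + prob (pos n \<inter> win n x L)"
    by (rule measure_Un_le) auto
  finally have 1: "prob (pos n \<inter> win n x (w * c n)) \<le> prob (?le y - ?le x) + B * surv n"
    using B[of x] by linarith
  have "prob (?le y - ?le x) \<le> prob ((pos n \<inter> win n x (w * c n)) \<union> (pos n \<inter> win n y L))"
    using L by (intro finite_measure_mono) (auto simp: win_def y_def)
  also have "\<dots> \<le> prob (pos n \<inter> win n x (w * c n)) + prob (pos n \<inter> win n y L)"
    by (rule measure_Un_le) auto
  finally have 2: "prob (?le y - ?le x) \<le> prob (pos n \<inter> win n x (w * c n)) + B * surv n"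
    using B[of y] by linarith
  have "cdf (conditioned_law M X c n) (x / c n + w) - cdf (conditioned_law M X c n) (x / c n)
    = prob (?le y - ?le x) / surv n"
    unfolding cdf_eq y eq by (simp add: add_divide_distrib)
  then have "\<bar>prob (pos n \<inter> win n x (w * c n)) / surv n
    - (cdf (conditioned_law M X c n) (x / c n + w) - cdf (conditioned_law M X c n) (x / c n))\<bar>
    = \<bar>prob (pos n \<inter> win n x (w * c n)) - prob (?le y - ?le x)\<bar> / surv n"
    using s by (simp add: diff_divide_distrib[symmetric] abs_divide)
  also have "\<dots> \<le> B * surv n / surv n" using 1 2 s by (intro divide_right_mono) (auto simp: abs_le_iff)
  finally show ?thesis using s by simp
qed

text \<open>Equicontinuity turns the weak limit, tested on windows of width proportional to \<open>c n\<close>, into the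
  local limit: such a wide window is a disjoint union of windows of width \<open>\<Delta>\<close> with nearly equal
  probabilities.\<close>

lemma local_limit_compact:
  assumes \<Delta>: "0 < \<Delta>" and \<delta>: "0 < \<delta>" and \<eta>: "0 < \<eta>"
  shows "\<forall>\<^sub>F n in sequentially. \<forall>x. \<delta> * c n \<le> x \<longrightarrow> x \<le> K * c n \<longrightarrow>
    \<bar>c n * prob (pos n \<inter> win n x \<Delta>) / surv n - \<Delta> * p (x / c n)\<bar> \<le> \<eta>"
proof -
  have "0 < \<eta> / 4" using \<eta> by simp
  from local_equicontinuity[OF \<Delta> \<delta> this] obtain h0 where h0: "0 < h0" and equi:
    "\<forall>\<^sub>F n in sequentially. \<forall>x y. \<delta> * c n \<le> x \<longrightarrow> \<delta> * c n \<le> y \<longrightarrow> \<bar>x - y\<bar> \<le> h0 * c n \<longrightarrow>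
      \<bar>prob (pos n \<inter> win n x \<Delta>) - prob (pos n \<inter> win n y \<Delta>)\<bar> \<le> \<eta> / 4 * surv n / c n" by blast
  have "uniformly_continuous_on {\<delta>..K + 1} p"
    using \<delta> by (intro compact_uniformly_continuous continuous_on_subset[OF p_cont]) auto
  moreover have e4: "0 < \<eta> / (4 * \<Delta>)" using \<eta> \<Delta> by simp
  ultimately obtain h1 where h1: "0 < h1"
    "\<And>u v. u \<in> {\<delta>..K + 1} \<Longrightarrow> v \<in> {\<delta>..K + 1} \<Longrightarrow> dist v u < h1 \<Longrightarrow> dist (p v) (p u) < \<eta> / (4 * \<Delta>)"
    unfolding uniformly_continuous_on_def by metis
  \<comment> \<open>\<open>h0\<close> serves the equicontinuity, \<open>h1\<close> the variation of
    \<open>p\<close>, and 1 keeps \<open>u + w\<close> in \<open>[\<delta>, K + 1]\<close>.\<close>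
  define h where "h = min h0 (min (h1 / 2) 1)"
  have h: "0 < h" "h \<le> h0" "h < h1" "h \<le> 1" using h0 h1 by (auto simp: h_def)
  \<comment> \<open>Chosen so that the three errors \<open>e\<close> below sum to at most
    \<open>w / \<Delta> * (\<eta> / 2)\<close>, by \<open>h / 2 \<le> w\<close>.\<close>
  define e where "e = \<eta> * h / (16 * \<Delta>)"
  have e: "0 < e" using \<eta> h \<Delta> by (simp add: e_def)
  obtain C where C: "0 < C" "\<forall>\<^sub>F n in sequentially. \<forall>x. prob (pos n \<inter> win n x \<Delta>) \<le> C * \<Delta> * surv n / c n"
    using local_upper_bound \<Delta> by blast
  have polya: "\<forall>\<^sub>F n in sequentially. \<forall>u\<in>{\<delta>..K + 1}. \<bar>cdf (conditioned_law M X c n) u - cdf limit_law u\<bar> < e"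
  proof (rule polya_uniform_cdf[OF _ _ conditioned_cdf_conv _ e])
    show "finite_borel_measure (conditioned_law M X c n)" for n
      using conditioned_law_distribution by (rule real_distribution.finite_borel_measure_M)
    show "finite_borel_measure limit_law"
      using limit_law_distribution by (rule real_distribution.finite_borel_measure_M)
    show "continuous_on {\<delta>..K + 1 + 1} (cdf limit_law)"
      by (intro continuous_at_imp_continuous_on ballI limit_law_cdf_cont)
  qed
  have "\<forall>\<^sub>F n in sequentially. max (\<Delta> / h) (C * \<Delta> / e) \<le> c n"
    using L.c_at_top unfolding filterlim_at_top by blast
  with equi C(2) polya eventually_ge_at_top[of 1] show ?thesis
  proof eventually_elim
    case (elim n)
    have cn: "0 < c n" using elim(4) by (rule L.c_pos)
    have s: "0 < surv n" by (rule surv_pos)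
    have c1: "1 \<le> h * c n / \<Delta>" and c2: "C * \<Delta> / c n \<le> e"
      using elim(5) h e \<Delta> cn by (auto simp: field_simps)
    \<comment> \<open>The number of windows of width \<open>\<Delta>\<close> that fit into
      \<open>h * c n\<close>; the exact relative width \<open>w\<close> of their union replaces
      \<open>h\<close> and lies between \<open>h / 2\<close> and \<open>h\<close>.\<close>
    define N where "N = nat \<lfloor>h * c n / \<Delta>\<rfloor>"
    have N: "real N \<le> h * c n / \<Delta>" "h * c n / \<Delta> / 2 \<le> real N" "1 \<le> N"
    proof -
      have fl: "real (nat \<lfloor>y\<rfloor>) \<le> y \<and> y / 2 \<le> real (nat \<lfloor>y\<rfloor>) \<and> 1 \<le> nat \<lfloor>y\<rfloor>" if "1 \<le> y" for y :: real
      proof -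
        have "1 \<le> \<lfloor>y\<rfloor>" using that by simp
        then have "1 \<le> nat \<lfloor>y\<rfloor>" "real (nat \<lfloor>y\<rfloor>) = of_int \<lfloor>y\<rfloor>" "(1::real) \<le> of_int \<lfloor>y\<rfloor>"
          by linarith+
        then show ?thesis
          using of_int_floor_le[of y] real_of_int_floor_add_one_gt[of y] by (intro conjI) linarith+
      qed
      from fl[OF c1] show "real N \<le> h * c n / \<Delta>" "h * c n / \<Delta> / 2 \<le> real N" "1 \<le> N"
        unfolding N_def by blast+
    qed
    define w where "w = real N * \<Delta> / c n"
    have w: "h / 2 \<le> w" "w \<le> h" "w * c n = real N * \<Delta>"
      using N(1,2) cn \<Delta> by (auto simp: w_def field_simps)
    have w0: "0 < w" using w(1) h by linarith
    show ?case
    proof (intro allI impI)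
      fix x assume x: "\<delta> * c n \<le> x" "x \<le> K * c n"
      define u where "u = x / c n"
      have u: "\<delta> \<le> u" "u \<le> K" using x cn by (auto simp: u_def pos_le_divide_eq pos_divide_le_eq)
      define Q where "Q y = prob (pos n \<inter> win n y \<Delta>) / surv n" for y
      define S where "S = prob (pos n \<inter> win n x (w * c n)) / surv n"
      have Q_equi: "\<bar>Q (x + real i * \<Delta>) - Q x\<bar> \<le> \<eta> / 4 / c n" if "i < N" for i
      proof -
        have "real i * \<Delta> \<le> real N * \<Delta>" using that \<Delta> by (intro mult_right_mono) auto
        also have "\<dots> = w * c n" by (rule w(3)[symmetric])
        also have "\<dots> \<le> h0 * c n" using w h cn by (intro mult_right_mono) auto
        finally have "\<bar>(x + real i * \<Delta>) - x\<bar> \<le> h0 * c n" using \<Delta> by simp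
        moreover have "\<delta> * c n \<le> x + real i * \<Delta>" using x \<Delta> by (simp add: add_increasing2)
        ultimately have "\<bar>prob (pos n \<inter> win n (x + real i * \<Delta>) \<Delta>) - prob (pos n \<inter> win n x \<Delta>)\<bar> \<le> \<eta> / 4 * surv n / c n"
          using elim(1) x(1) by blast
        then have "\<bar>prob (pos n \<inter> win n (x + real i * \<Delta>) \<Delta>) - prob (pos n \<inter> win n x \<Delta>)\<bar> / surv n
          \<le> \<eta> / 4 * surv n / c n / surv n" using s by (intro divide_right_mono) auto
        then show ?thesis using s by (simp add: Q_def diff_divide_distrib[symmetric] abs_divide)
      qed
      have "S = (\<Sum>i<N. Q (x + real i * \<Delta>))"
        unfolding S_def w(3) window_sum[OF \<Delta>] Q_def by (rule sum_divide_distrib)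
      then have "\<bar>S - real N * Q x\<bar> = \<bar>\<Sum>i<N. (Q (x + real i * \<Delta>) - Q x)\<bar>"
        by (simp add: sum_subtractf)
      also have "\<dots> \<le> (\<Sum>i<N. \<eta> / 4 / c n)"
        by (rule order_trans[OF sum_abs sum_mono]) (use Q_equi in auto)
      also have "\<dots> = w / \<Delta> * (\<eta> / 4)" using cn \<Delta> by (simp add: w_def)
      finally have 1: "\<bar>S - real N * Q x\<bar> \<le> w / \<Delta> * (\<eta> / 4)" .
      have 2: "\<bar>S - (cdf (conditioned_law M X c n) (u + w) - cdf (conditioned_law M X c n) u)\<bar> \<le> C * \<Delta> / c n"
        unfolding S_def u_def using elim(2,4) w0 by (intro window_cdf_diff[OF _ _ \<Delta>]) (auto simp: mult_ac)
      have 3: "\<bar>cdf (conditioned_law M X c n) (u + w) - cdf limit_law (u + w)\<bar> < e"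
        "\<bar>cdf (conditioned_law M X c n) u - cdf limit_law u\<bar> < e"
        using elim(3) u w w0 h by auto
      have near: "p u - \<eta> / (4 * \<Delta>) \<le> p v \<and> p v \<le> p u + \<eta> / (4 * \<Delta>)" if "u \<le> v" "v \<le> u + w" for v
      proof -
        have "dist (p v) (p u) < \<eta> / (4 * \<Delta>)"
          by (rule h1(2)) (use that u w h in \<open>auto simp: dist_real_def\<close>)
        then show ?thesis by (auto simp: dist_real_def)
      qed
      have u0: "0 < u" using u \<delta> by linarith
      have uw: "u \<le> u + w" using w0 by simp
      have 4: "\<bar>cdf limit_law (u + w) - cdf limit_law u - w * p u\<bar> \<le> w * (\<eta> / (4 * \<Delta>))"
        using limit_law_interval_bounds[OF u0 uw near] by (simp add: algebra_simps abs_le_iff)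
      have "\<bar>real N * Q x - w * p u\<bar> \<le> w / \<Delta> * (\<eta> / 4) + e + 2 * e + w * (\<eta> / (4 * \<Delta>))"
        using 1 2 3 4 c2 by linarith
      also have "\<dots> = w / \<Delta> * (\<eta> / 2) + 3 * e" by (simp add: field_simps)
      also have "3 * e \<le> w / \<Delta> * (\<eta> / 2)"
      proof -
        have "3 * e \<le> 4 * e" using e by simp
        also have "\<dots> = h / 2 / \<Delta> * (\<eta> / 2)" by (simp add: e_def)
        also have "\<dots> \<le> w / \<Delta> * (\<eta> / 2)" using w \<Delta> \<eta> by (intro mult_right_mono divide_right_mono) auto
        finally show ?thesis .
      qed
      finally have 5: "\<bar>real N * Q x - w * p u\<bar> \<le> w / \<Delta> * \<eta>" by (simp add: mult_ac)
      \<comment> \<open>As \<open>w / \<Delta> = N / c n\<close>, dividing by it returns from the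
        wide window to a single one.\<close>
      have "real N * Q x - w * p u = w / \<Delta> * (c n * Q x - \<Delta> * p u)"
        using cn \<Delta> by (simp add: w_def field_simps)
      then have "\<bar>real N * Q x - w * p u\<bar> = w / \<Delta> * \<bar>c n * Q x - \<Delta> * p u\<bar>"
        using w0 \<Delta> by (simp add: abs_mult)
      with 5 have "w / \<Delta> * \<bar>c n * Q x - \<Delta> * p u\<bar> \<le> w / \<Delta> * \<eta>" by simp
      then have "\<bar>c n * Q x - \<Delta> * p u\<bar> \<le> \<eta>"
        using w0 \<Delta> by (subst (asm) mult_le_cancel_left_pos) auto
      then show "\<bar>c n * prob (pos n \<inter> win n x \<Delta>) / surv n - \<Delta> * p (x / c n)\<bar> \<le> \<eta>"
        by (simp add: Q_def u_def)
    qed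
  qed
qed

lemma local_limit_pointwise:
  assumes \<Delta>: "0 < \<Delta>" and u: "0 < u"
  shows "(\<lambda>n. c n * prob (pos n \<inter> win n (u * c n) \<Delta>) / surv n) \<longlonglongrightarrow> \<Delta> * p u"
proof (rule tendstoI)
  fix e :: real assume "0 < e"
  then have "0 < e / 2" by simp
  from local_limit_compact[OF \<Delta> u this, of u] eventually_ge_at_top[of 1]
  show "\<forall>\<^sub>F n in sequentially. dist (c n * prob (pos n \<inter> win n (u * c n) \<Delta>) / surv n) (\<Delta> * p u) < e"
  proof eventually_elim
    case (elim n)
    have "0 < c n" using elim(2) by (rule L.c_pos)
    then have "u * c n / c n = u" by simp
    then have "\<bar>c n * prob (pos n \<inter> win n (u * c n) \<Delta>) / surv n - \<Delta> * p u\<bar> \<le> e / 2"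
      using elim(1) by (metis order_refl)
    then show ?case using \<open>0 < e\<close> by (simp add: dist_real_def)
  qed
qed

lemma scaled_bound:
  "1 \<le> n \<Longrightarrow> prob E \<le> \<eta> * surv n / c n \<Longrightarrow> c n * prob E / surv n \<le> \<eta>"
  using surv_pos[of n] L.c_pos[of n] by (simp add: field_simps)

text \<open>Where \<open>x / c n\<close> is neither small nor large the compact case applies. In the
  other two ranges both terms are small separately, the one with \<open>p\<close> because
  \<open>p\<close> inherits the bounds on the probabilities through the pointwise limit.\<close>

lemma local_limit:
  assumes \<Delta>: "0 < \<Delta>"
  shows "uniform_limit {0<..} (\<lambda>n x. c n * (prob (win n x \<Delta> \<inter> pos n) / surv n) - \<Delta> * p (x / c n)) (\<lambda>_. 0) sequentially"
proof (rule uniform_limitI)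
  fix \<eta> :: real assume \<eta>: "0 < \<eta>"
  define \<eta>' where "\<eta>' = \<eta> / 3"
  have \<eta>': "0 < \<eta>'" using \<eta> by (simp add: \<eta>'_def)
  let ?q = "\<lambda>n x. c n * prob (pos n \<inter> win n x \<Delta>) / surv n"
  obtain \<delta> where \<delta>: "0 < \<delta>" and small: "\<forall>\<^sub>F n in sequentially. \<forall>x. x < \<delta> * c n \<longrightarrow>
    prob (pos n \<inter> win n x \<Delta>) \<le> \<eta>' * surv n / c n"
    using local_bound_near_zero[OF \<Delta> \<eta>'] by blast
  obtain K where K: "0 < K" and far: "\<forall>\<^sub>F n in sequentially. \<forall>x. K * c n \<le> x \<longrightarrow>
    prob (pos n \<inter> win n x \<Delta>) \<le> \<eta>' * surv n / c n"
    using local_bound_far[OF \<Delta> \<eta>'] by blast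
  have p_small: "\<Delta> * p u \<le> \<eta>'" if u: "0 < u" "u < \<delta> \<or> K \<le> u" for u
  proof (rule tendsto_upperbound[OF local_limit_pointwise[OF \<Delta> u(1)]])
    show "\<forall>\<^sub>F n in sequentially. ?q n (u * c n) \<le> \<eta>'"
      using small far eventually_ge_at_top[of 1]
    proof eventually_elim
      case (elim n)
      have "0 < c n" using elim(3) by (rule L.c_pos)
      then have "u * c n < \<delta> * c n \<or> K * c n \<le> u * c n" using u by auto
      then show ?case using elim by (intro scaled_bound) auto
    qed
  qed simp
  show "\<forall>\<^sub>F n in sequentially. \<forall>x\<in>{0<..}.
    dist (c n * (prob (win n x \<Delta> \<inter> pos n) / surv n) - \<Delta> * p (x / c n)) 0 < \<eta>"
    using small far local_limit_compact[OF \<Delta> \<delta> \<eta>', of K] eventually_ge_at_top[of 1]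
  proof eventually_elim
    case (elim n)
    have cn: "0 < c n" using elim(4) by (rule L.c_pos)
    show ?case
    proof
      fix x :: real assume "x \<in> {0<..}"
      then have x: "0 < x" by simp
      have "\<bar>?q n x - \<Delta> * p (x / c n)\<bar> \<le> 2 * \<eta>'"
      proof (cases "\<delta> * c n \<le> x \<and> x \<le> K * c n")
        case True
        then show ?thesis using elim(3) \<eta>' by force
      next
        case False
        then have "x < \<delta> * c n \<or> K * c n \<le> x" by auto
        then have "?q n x \<le> \<eta>'" "\<Delta> * p (x / c n) \<le> \<eta>'"
          using elim cn x by (auto intro!: scaled_bound p_small simp: pos_divide_less_eq pos_le_divide_eq)
        moreover have "0 \<le> ?q n x" using cn surv_nonneg[of n] by simp
        moreover have "0 \<le> \<Delta> * p (x / c n)" using \<Delta> cn x by (intro mult_nonneg_nonneg p_nonneg) auto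
        ultimately show ?thesis by linarith
      qed
      also have "2 * \<eta>' < \<eta>" using \<eta> by (simp add: \<eta>'_def)
      finally show "dist (c n * (prob (win n x \<Delta> \<inter> pos n) / surv n) - \<Delta> * p (x / c n)) 0 < \<eta>"
        by (simp add: dist_real_def Int_commute)
    qed
  qed
qed

end

theorem theorem2:
  fixes M :: "'a measure" and X :: "nat \<Rightarrow> 'a \<Rightarrow> real" and F :: "real measure"
    and c :: "nat \<Rightarrow> real" and \<alpha> \<beta> :: real and p :: "real \<Rightarrow> real"
  assumes iid: "iid_with_law M X F"
    and c: "norming_sequence F c"
    and admissible: "(\<alpha>, \<beta>) \<in> admissible"
    and D: "class_D M X F c \<alpha> \<beta>"
    and non_lattice: "\<not> lattice_distribution F"
    and p: "limit_density M X c p"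
  shows "\<forall>\<Delta>>0. uniform_limit {0<..}
           (\<lambda>n x. c n * \<P>(\<omega> in M. walk X n \<omega> \<in> {x..<x + \<Delta>} \<bar> tau_minus X \<omega> > enat n)
                   - \<Delta> * p (x / c n))
           (\<lambda>_. 0) sequentially"
proof -
  obtain \<kappa> \<nu> where \<kappa>: "0 < \<kappa>" and stable: "stable_law \<kappa> \<alpha> \<beta> \<nu>"
    and conv: "weak_conv_m (\<lambda>n. distr M borel (\<lambda>\<omega>. walk X n \<omega> / c n)) \<nu>"
    using D by (auto simp: class_D_def)
  have \<nu>: "real_distribution \<nu>" and char_\<nu>: "char \<nu> t = stable_char \<kappa> \<alpha> \<beta> t" for t
    using stable by (auto simp: stable_law_def)
  interpret iid_walk M X F
    using iid by (auto simp: iid_with_law_def iid_walk_def iid_walk_axioms_def)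
  have F: "real_distribution F" by (rule law_real_distribution)
  have scaled: "real_distribution (distr M borel (\<lambda>\<omega>. walk X n \<omega> / c n))" for n
    by (rule real_distribution_distr) simp
  have char_scaled: "char (distr M borel (\<lambda>\<omega>. walk X n \<omega> / c n)) t = char F (t / c n) ^ n" for n t
  proof -
    have "char (distr M borel (\<lambda>\<omega>. walk X n \<omega> / c n)) t = char (distr M borel (walk X n)) (t / c n)"
      unfolding char_def by (simp add: integral_distr)
    then show ?thesis using char_bsum[of "{1..n}"] by (simp add: walk_eq_bsum)
  qed
  have "attracted_law F c \<kappa> \<alpha>"
    unfolding attracted_law_def attracted_law_axioms_def
  proof (intro conjI allI impI F \<kappa>)
    show "0 < c n" if "1 \<le> n" for n using c that by (auto simp: norming_sequence_def)
    show "mono_on {1..} c" using c by (simp add: norming_sequence_def)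
    show "0 < \<alpha>" using admissible by (auto simp: admissible_def)
    show "cmod (char F t) < 1" if "t \<noteq> 0" for t using F non_lattice that by (rule char_less_1_of_non_lattice)
    fix T
    have "uniform_limit {-T..T} (\<lambda>n t. char (distr M borel (\<lambda>\<omega>. walk X n \<omega> / c n)) t) (char \<nu>) sequentially"
      by (rule weak_conv_imp_char_uniform[OF scaled \<nu> conv])
    \<comment> \<open>Taking moduli removes the skewness and leaves
      \<open>exp (- (\<kappa> * \<bar>t\<bar> powr \<alpha>))\<close>.\<close>
    from uniform_limit_norm[OF this]
    show "uniform_limit {-T..T} (\<lambda>n t. cmod (char F (t / c n)) ^ n) (\<lambda>t. exp (- (\<kappa> * \<bar>t\<bar> powr \<alpha>))) sequentially"
      by (simp add: char_scaled norm_power char_\<nu> cmod_stable_char)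
  qed
  then interpret conditioned_walk M X F c \<kappa> \<alpha> \<nu> p
    using \<nu> conv p stable_law_positive_mass[OF admissible \<kappa> stable]
    by (intro conditioned_walk.intro attracted_walk.intro attracted_walk_axioms.intro
        conditioned_walk_axioms.intro iid_walk_axioms)
  have "\<P>(\<omega> in M. walk X n \<omega> \<in> {x..<x + \<Delta>} \<bar> tau_minus X \<omega> > enat n) = prob (win n x \<Delta> \<inter> pos n) / surv n"
    for n x \<Delta>
    unfolding cond_prob_def tau_minus_greater_iff surv_def win_def pos_def
    by (auto intro!: arg_cong2[where f = "(/)"] arg_cong[where f = prob])
  then show ?thesis using local_limit by simp
qed

end
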